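(* Let $q=p^d$ be a prime power ($p$ prime, $d\ge 1$), and let $G$ be a profinite group of Galois relation type (relative to $q$). Then $G^{(3)}=\Delta_G$, where $\Delta_G$ is the intersection of all distinguished subgroups of $G$.
   Context: $G^{(1)}=G$ and $G^{(i+1)}=(G^{(i)})^q[G^{(i)},G]$ is the closed subgroup of $G$ generated by all $h^q$ and $[h,g]=h^{-1}g^{-1}hg$, $h\in G^{(i)}$, $g\in G$. For a profinite group $G$, $H^i(G)=H^i(G,\mathbb{Z}/q)$ is continuous cohomology with trivial action, so $H^1(G)=\mathrm{Hom}_{cont}(G,\mathbb{Z}/q)$. The Bockstein map $\beta_G\colon H^1(G)\to H^2(G)$ is the connecting homomorphism of $0\to\mathbb{Z}/q\to\mathbb{Z}/q^2\to\mathbb{Z}/q\to0$ (trivial actions). Galois relation type: $G$ has Galois relation type (relative to $q=p^d$) if (i) the kernel of the homomorphism $\cup\colon H^1(G)\otimes_{\mathbb{Z}}H^1(G)\to H^2(G)$ induced by the cup product is generated by elements of the form $\psi\otimes\psi'$ with $\psi,\psi'\in H^1(G)$; (ii) there exists $\xi\in H^1(G)$ such that $\psi\cup\xi+\beta_G(\psi)=0$ for every $\psi\in H^1(G)$; and (iii) the natural map $H^1(G,\mathbb{Z}/q)\to H^1(G,\mathbb{Z}/p^i)$ is surjective for $1\le i\le d$. Define $\Omega(G)=H^1(G)\otimes_{\mathbb{Z}}H^1(G)$ if $q=2$, and $\Omega(G)=(H^1(G)\otimes_{\mathbb{Z}}H^1(G))\oplus H^1(G)$ if $q\ne2$. Define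 $\Lambda_G\colon\Omega(G)\to H^2(G)$ by $\Lambda_G(\alpha)=\cup\alpha$ if $q=2$, and $\Lambda_G(\alpha_1,\alpha_2)=\cup\alpha_1+\beta_G(\alpha_2)$ if $q\ne2$. An element $\alpha\in\Omega(G)$ has simple type if $\alpha=\psi\otimes\psi'$ (when $q=2$), respectively $\alpha=(\psi\otimes\psi',\psi)$ (when $q\neq2$), for some $\psi,\psi'\in H^1(G)$; then $\mathrm{Ker}(\psi)\cap\mathrm{Ker}(\psi')$ is called a kernel of $\alpha$ (it may depend on the choice of $\psi,\psi'$). "Of simple type and with trivial kernel" means $\psi,\psi'$ can be chosen with $\mathrm{Ker}(\psi)\cap\mathrm{Ker}(\psi')=1$. For an open normal subgroup $M$ of $G$, $H^1(M)^G$ is the group of $\varphi\in H^1(M)$ with $\varphi(g^{-1}mg)=\varphi(m)$ for all $g\in G$, $m\in M$, and $\mathrm{trg}_{G/M}\colon H^1(M)^G\to H^2(G/M)$ is the transgression map of the 5-term exact sequence of the Hochschild–Serre spectral sequence. A subgroup $N$ of $G$ is distinguished if there are an open normal subgroup $M$ of $G$, $\varphi\in H^1(M)^G$, and $\bar\alpha\in\Omega(G/M)$ of simple type and with trivial kernel, such that $\Lambda_{G/M}(\bar\alpha)=\mathrm{trg}_{G/M}(\varphi)$ and $N=\mathrm{Ker}(\varphi)$. *)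

theory Defs
  imports
    "HOL-Analysis.Analysis"
    "HOL-Algebra.Free_Abelian_Groups"
    "HOL-Computational_Algebra.Primes"
begin

section \<open>Profinite groups\<close>

locale topological_group = group G for G (structure) +
  fixes T :: "'a topology"
  assumes topspace_eq: "topspace T = carrier G"
    and continuous_mult: "continuous_map (prod_topology T T) T (\<lambda>(x, y). x \<otimes> y)"
    and continuous_inv: "continuous_map T T (\<lambda>x. inv x)"

locale profinite_group = topological_group G T for G (structure) and T +
  assumes compact: "compact_space T"
    and Hausdorff: "Hausdorff_space T"
    and totally_disconnected:
      "\<And>x. x \<in> carrier G \<Longrightarrow> connected_component_of_set T x = {x}"

text \<open>The descending \<open>q\<close>-central series, indexed from 1 (the value at 0 is a dummy).\<close>

fun central_series :: "nat \<Rightarrow> ('a, 'm) monoid_scheme \<Rightarrow> 'a topology \<Rightarrow> nat \<Rightarrow> 'a set" where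
  "central_series q G T 0 = carrier G"
| "central_series q G T (Suc 0) = carrier G"
| "central_series q G T (Suc (Suc i)) =
     T closure_of generate G
       ({h [^]\<^bsub>G\<^esub> q | h. h \<in> central_series q G T (Suc i)} \<union>
        {inv\<^bsub>G\<^esub> h \<otimes>\<^bsub>G\<^esub> inv\<^bsub>G\<^esub> g \<otimes>\<^bsub>G\<^esub> h \<otimes>\<^bsub>G\<^esub> g | h g. h \<in> central_series q G T (Suc i) \<and> g \<in> carrier G})"


section \<open>Tensor products of abelian groups\<close>

definition tensor_relations ::
  "('a, 'm) monoid_scheme \<Rightarrow> ('b, 'n) monoid_scheme \<Rightarrow> ('a \<times> 'b \<Rightarrow>\<^sub>0 int) set" where
  "tensor_relations A B =
     generate (free_Abelian_group (carrier A \<times> carrier B))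
       ({frag_of (a \<otimes>\<^bsub>A\<^esub> a', b) - frag_of (a, b) - frag_of (a', b) | a a' b.
           a \<in> carrier A \<and> a' \<in> carrier A \<and> b \<in> carrier B} \<union>
        {frag_of (a, b \<otimes>\<^bsub>B\<^esub> b') - frag_of (a, b) - frag_of (a, b') | a b b'.
           a \<in> carrier A \<and> b \<in> carrier B \<and> b' \<in> carrier B})"

definition tensor ::
  "('a, 'm) monoid_scheme \<Rightarrow> ('b, 'n) monoid_scheme \<Rightarrow> ('a \<times> 'b \<Rightarrow>\<^sub>0 int) set monoid" where
  "tensor A B = free_Abelian_group (carrier A \<times> carrier B) Mod tensor_relations A B"

definition pure_tensor ::
  "('a, 'm) monoid_scheme \<Rightarrow> ('b, 'n) monoid_scheme \<Rightarrow> 'a \<Rightarrow> 'b \<Rightarrow> ('a \<times> 'b \<Rightarrow>\<^sub>0 int) set" where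
  "pure_tensor A B a b =
     tensor_relations A B #>\<^bsub>free_Abelian_group (carrier A \<times> carrier B)\<^esub> frag_of (a, b)"

text \<open>The homomorphism out of the tensor product induced by a bilinear map.\<close>

definition tensor_lift ::
  "('a, 'm) monoid_scheme \<Rightarrow> ('b, 'n) monoid_scheme \<Rightarrow> ('c, 'k) monoid_scheme \<Rightarrow>
   ('a \<Rightarrow> 'b \<Rightarrow> 'c) \<Rightarrow> ('a \<times> 'b \<Rightarrow>\<^sub>0 int) set \<Rightarrow> 'c" where
  "tensor_lift A B C f =
     (THE h. h \<in> hom (tensor A B) C \<and> h \<in> extensional (carrier (tensor A B)) \<and>
        (\<forall>a\<in>carrier A. \<forall>b\<in>carrier B. h (pure_tensor A B a b) = f a b))"


section \<open>Continuous cohomology with trivial coefficients \<open>\<int>/n\<close>\<close>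

text \<open>
  The coefficient group is \<open>\<int>/n\<close>, represented by \<^const>\<open>integer_mod_group\<close> with
  carrier \<open>{0..<n}\<close> and the discrete topology.  Inhomogeneous cochains of degree 1 and 2 are the
  continuous functions on \<open>T\<close> and on \<open>T \<times> T\<close>; like all functions on carriers below, they are
  extensional.
\<close>

definition cont_fun_group :: "nat \<Rightarrow> 'x topology \<Rightarrow> ('x \<Rightarrow> int) monoid" where
  "cont_fun_group n X =
     (product_group (topspace X) (\<lambda>_. integer_mod_group n))
       \<lparr>carrier := {f \<in> extensional (topspace X).
          continuous_map X (discrete_topology (carrier (integer_mod_group n))) f}\<rparr>"

definition H1 :: "nat \<Rightarrow> ('a, 'm) monoid_scheme \<Rightarrow> 'a topology \<Rightarrow> ('a \<Rightarrow> int) monoid" where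
  "H1 n G T = (cont_fun_group n T)
     \<lparr>carrier := {\<psi> \<in> carrier (cont_fun_group n T). \<psi> \<in> hom G (integer_mod_group n)}\<rparr>"

definition coboundary ::
  "nat \<Rightarrow> ('a, 'm) monoid_scheme \<Rightarrow> ('a \<Rightarrow> int) \<Rightarrow> 'a \<times> 'a \<Rightarrow> int" where
  "coboundary n G y =
     (\<lambda>(g, h) \<in> carrier G \<times> carrier G. (y h - y (g \<otimes>\<^bsub>G\<^esub> h) + y g) mod int n)"

definition Z2 :: "nat \<Rightarrow> ('a, 'm) monoid_scheme \<Rightarrow> 'a topology \<Rightarrow> ('a \<times> 'a \<Rightarrow> int) monoid" where
  "Z2 n G T = (cont_fun_group n (prod_topology T T))
     \<lparr>carrier := {f \<in> carrier (cont_fun_group n (prod_topology T T)).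
        \<forall>g\<in>carrier G. \<forall>h\<in>carrier G. \<forall>k\<in>carrier G.
          (f (h, k) - f (g \<otimes>\<^bsub>G\<^esub> h, k) + f (g, h \<otimes>\<^bsub>G\<^esub> k) - f (g, h)) mod int n = 0}\<rparr>"

definition B2 :: "nat \<Rightarrow> ('a, 'm) monoid_scheme \<Rightarrow> 'a topology \<Rightarrow> ('a \<times> 'a \<Rightarrow> int) set" where
  "B2 n G T = coboundary n G ` carrier (cont_fun_group n T)"

definition H2 ::
  "nat \<Rightarrow> ('a, 'm) monoid_scheme \<Rightarrow> 'a topology \<Rightarrow> ('a \<times> 'a \<Rightarrow> int) set monoid" where
  "H2 n G T = Z2 n G T Mod B2 n G T"

definition H2_class ::
  "nat \<Rightarrow> ('a, 'm) monoid_scheme \<Rightarrow> 'a topology \<Rightarrow> ('a \<times> 'a \<Rightarrow> int) \<Rightarrow> ('a \<times> 'a \<Rightarrow> int) set" where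
  "H2_class n G T f = B2 n G T #>\<^bsub>Z2 n G T\<^esub> f"

definition cup ::
  "nat \<Rightarrow> ('a, 'm) monoid_scheme \<Rightarrow> 'a topology \<Rightarrow> ('a \<Rightarrow> int) \<Rightarrow> ('a \<Rightarrow> int) \<Rightarrow>
   ('a \<times> 'a \<Rightarrow> int) set" where
  "cup n G T \<psi> \<psi>' =
     H2_class n G T (\<lambda>(g, h) \<in> carrier G \<times> carrier G. (\<psi> g * \<psi>' h) mod int n)"

abbreviation H1_tensor_H1 ::
  "nat \<Rightarrow> ('a, 'm) monoid_scheme \<Rightarrow> 'a topology \<Rightarrow>
   (('a \<Rightarrow> int) \<times> ('a \<Rightarrow> int) \<Rightarrow>\<^sub>0 int) set monoid" where
  "H1_tensor_H1 n G T \<equiv> tensor (H1 n G T) (H1 n G T)"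

definition cup_hom ::
  "nat \<Rightarrow> ('a, 'm) monoid_scheme \<Rightarrow> 'a topology \<Rightarrow>
   (('a \<Rightarrow> int) \<times> ('a \<Rightarrow> int) \<Rightarrow>\<^sub>0 int) set \<Rightarrow> ('a \<times> 'a \<Rightarrow> int) set" where
  "cup_hom n G T = tensor_lift (H1 n G T) (H1 n G T) (H2 n G T) (cup n G T)"

text \<open>
  The connecting homomorphism of \<open>0 \<rightarrow> \<int>/q \<rightarrow> \<int>/q\<^sup>2 \<rightarrow> \<int>/q \<rightarrow> 0\<close>, the first map being
  multiplication by \<open>q\<close>: lift \<open>\<psi>\<close> to a \<open>\<int>/q\<^sup>2\<close>-valued cochain \<open>y\<close>; its coboundary is then
  the image of a cocycle \<open>f\<close>.
\<close>

definition bockstein ::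
  "nat \<Rightarrow> ('a, 'm) monoid_scheme \<Rightarrow> 'a topology \<Rightarrow> ('a \<Rightarrow> int) \<Rightarrow> ('a \<times> 'a \<Rightarrow> int) set" where
  "bockstein q G T \<psi> =
     (THE c. \<exists>y\<in>carrier (cont_fun_group (q\<^sup>2) T). \<exists>f\<in>carrier (Z2 q G T).
        (\<forall>g\<in>carrier G. y g mod int q = \<psi> g) \<and>
        (\<forall>g\<in>carrier G. \<forall>h\<in>carrier G. coboundary (q\<^sup>2) G y (g, h) = int q * f (g, h)) \<and>
        c = H2_class q G T f)"


section \<open>Galois relation type\<close>

definition galois_relation_type ::
  "nat \<Rightarrow> nat \<Rightarrow> ('a, 'm) monoid_scheme \<Rightarrow> 'a topology \<Rightarrow> bool" where
  "galois_relation_type p d G T \<longleftrightarrow> (let q = p ^ d in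
     (\<exists>S. S \<subseteq> {pure_tensor (H1 q G T) (H1 q G T) \<psi> \<psi>' | \<psi> \<psi>'.
               \<psi> \<in> carrier (H1 q G T) \<and> \<psi>' \<in> carrier (H1 q G T)} \<and>
          kernel (H1_tensor_H1 q G T) (H2 q G T) (cup_hom q G T) =
            generate (H1_tensor_H1 q G T) S) \<and>
     (\<exists>\<xi>\<in>carrier (H1 q G T). \<forall>\<psi>\<in>carrier (H1 q G T).
        cup q G T \<psi> \<xi> \<otimes>\<^bsub>H2 q G T\<^esub> bockstein q G T \<psi> = \<one>\<^bsub>H2 q G T\<^esub>) \<and>
     (\<forall>i. 1 \<le> i \<and> i \<le> d \<longrightarrow>
        (\<lambda>\<psi>. \<lambda>g\<in>carrier G. \<psi> g mod int (p ^ i)) ` carrier (H1 q G T) = carrier (H1 (p ^ i) G T)))"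


section \<open>Distinguished subgroups\<close>

text \<open>
  \<open>\<Omega>(G)\<close> is a different group for \<open>q = 2\<close> and \<open>q \<noteq> 2\<close>; the two cases are the two summands of
  a sum type.
\<close>

type_synonym 'a omega =
  "(('a \<Rightarrow> int) \<times> ('a \<Rightarrow> int) \<Rightarrow>\<^sub>0 int) set +
   ((('a \<Rightarrow> int) \<times> ('a \<Rightarrow> int) \<Rightarrow>\<^sub>0 int) set \<times> ('a \<Rightarrow> int))"

definition Omega :: "nat \<Rightarrow> ('a, 'm) monoid_scheme \<Rightarrow> 'a topology \<Rightarrow> 'a omega set" where
  "Omega q G T =
     (if q = 2 then Inl ` carrier (H1_tensor_H1 q G T)
      else Inr ` carrier (H1_tensor_H1 q G T \<times>\<times> H1 q G T))"

definition Lambda ::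
  "nat \<Rightarrow> ('a, 'm) monoid_scheme \<Rightarrow> 'a topology \<Rightarrow> 'a omega \<Rightarrow> ('a \<times> 'a \<Rightarrow> int) set" where
  "Lambda q G T \<alpha> =
     (case \<alpha> of
        Inl t \<Rightarrow> cup_hom q G T t
      | Inr (t, \<psi>) \<Rightarrow> cup_hom q G T t \<otimes>\<^bsub>H2 q G T\<^esub> bockstein q G T \<psi>)"

definition simple_elt ::
  "nat \<Rightarrow> ('a, 'm) monoid_scheme \<Rightarrow> 'a topology \<Rightarrow> ('a \<Rightarrow> int) \<Rightarrow> ('a \<Rightarrow> int) \<Rightarrow> 'a omega" where
  "simple_elt q G T \<psi> \<psi>' =
     (if q = 2 then Inl (pure_tensor (H1 q G T) (H1 q G T) \<psi> \<psi>')
      else Inr (pure_tensor (H1 q G T) (H1 q G T) \<psi> \<psi>', \<psi>))"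

text \<open>\<open>K\<close> is one of the kernels of the element \<open>\<alpha>\<close> of simple type.\<close>

definition simple_type_with_kernel ::
  "nat \<Rightarrow> ('a, 'm) monoid_scheme \<Rightarrow> 'a topology \<Rightarrow> 'a omega \<Rightarrow> 'a set \<Rightarrow> bool" where
  "simple_type_with_kernel q G T \<alpha> K \<longleftrightarrow>
     (\<exists>\<psi>\<in>carrier (H1 q G T). \<exists>\<psi>'\<in>carrier (H1 q G T).
        \<alpha> = simple_elt q G T \<psi> \<psi>' \<and>
        K = kernel G (integer_mod_group q) \<psi> \<inter> kernel G (integer_mod_group q) \<psi>')"

text \<open>\<open>H\<^sup>1(M)\<^sup>G\<close>, for a subgroup \<open>M\<close> with the subspace topology.\<close>

definition H1_invariant ::
  "nat \<Rightarrow> ('a, 'm) monoid_scheme \<Rightarrow> 'a topology \<Rightarrow> 'a set \<Rightarrow> ('a \<Rightarrow> int) set" where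
  "H1_invariant n G T M =
     {\<phi> \<in> carrier (H1 n (G\<lparr>carrier := M\<rparr>) (subtopology T M)).
        \<forall>g\<in>carrier G. \<forall>m\<in>M. \<phi> (inv\<^bsub>G\<^esub> g \<otimes>\<^bsub>G\<^esub> m \<otimes>\<^bsub>G\<^esub> g) = \<phi> m}"

text \<open>For open \<open>M\<close> the quotient topology on \<open>G/M\<close> is the discrete one.\<close>

abbreviation quotient_topology :: "('a, 'm) monoid_scheme \<Rightarrow> 'a set \<Rightarrow> 'a set topology" where
  "quotient_topology G M \<equiv> discrete_topology (carrier (G Mod M))"

text \<open>
  The edge map of the 5-term exact sequence on the level of cochains: for invariant \<open>\<phi>\<close> there is
  a cochain \<open>y\<close> on \<open>G\<close> extending \<open>\<phi>\<close> whose coboundary is the inflation of a cocycle \<open>f\<close>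
  on \<open>G/M\<close>, and the class of \<open>f\<close> does not depend on the choice of \<open>y\<close>.
\<close>

definition transgression ::
  "nat \<Rightarrow> ('a, 'm) monoid_scheme \<Rightarrow> 'a topology \<Rightarrow> 'a set \<Rightarrow> ('a \<Rightarrow> int) \<Rightarrow>
   ('a set \<times> 'a set \<Rightarrow> int) set" where
  "transgression n G T M \<phi> =
     (THE c. \<exists>y\<in>carrier (cont_fun_group n T). \<exists>f\<in>carrier (Z2 n (G Mod M) (quotient_topology G M)).
        (\<forall>m\<in>M. y m = \<phi> m) \<and>
        (\<forall>g\<in>carrier G. \<forall>h\<in>carrier G. coboundary n G y (g, h) = f (M #>\<^bsub>G\<^esub> g, M #>\<^bsub>G\<^esub> h)) \<and>
        c = H2_class n (G Mod M) (quotient_topology G M) f)"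

definition distinguished ::
  "nat \<Rightarrow> ('a, 'm) monoid_scheme \<Rightarrow> 'a topology \<Rightarrow> 'a set \<Rightarrow> bool" where
  "distinguished q G T N \<longleftrightarrow>
     (\<exists>M \<phi> \<alpha>. M \<lhd> G \<and> openin T M \<and> \<phi> \<in> H1_invariant q G T M \<and>
        \<alpha> \<in> Omega q (G Mod M) (quotient_topology G M) \<and>
        simple_type_with_kernel q (G Mod M) (quotient_topology G M) \<alpha> {\<one>\<^bsub>G Mod M\<^esub>} \<and>
        Lambda q (G Mod M) (quotient_topology G M) \<alpha> = transgression q G T M \<phi> \<and>
        N = kernel (G\<lparr>carrier := M\<rparr>) (integer_mod_group q) \<phi>)"

definition Delta :: "nat \<Rightarrow> ('a, 'm) monoid_scheme \<Rightarrow> 'a topology \<Rightarrow> 'a set" where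
  "Delta q G T = {x \<in> carrier G. \<forall>N. distinguished q G T N \<longrightarrow> x \<in> N}"

end

theory Submission
  imports Defs "HOL-Number_Theory.Cong" "HOL-Algebra.SndIsomorphismGrp"
begin

text \<open>
  Everything is done with inhomogeneous cochains \<open>y : G \<rightarrow> \<int>/q\<close> and their coboundaries
  \<open>(\<delta>y)(g, h) = y h - y (gh) + y g\<close>.  Two cocycles matter: the cup product
  \<open>\<psi> g * \<psi>' h\<close> of two characters, and the carry \<open>(\<psi> g + \<psi> h) div q\<close> of a character,
  which represents its Bockstein class (\<open>bockstein_eq\<close>).  If \<open>\<delta>y\<close> is the cocycle attached to an
  element of simple type, given by \<open>\<psi>\<close> and \<open>\<psi>'\<close>, then \<open>y\<close> restricts on
  \<open>M = Ker \<psi> \<inter> Ker \<psi>'\<close> to an invariant homomorphism, whose transgression is the class of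
  that cocycle on \<open>G/M\<close>; so \<open>{m \<in> M. y m = 0}\<close> is distinguished
  (\<open>distinguished_of_simple_coboundary\<close>).

  For the inclusion of \<open>G\<^sup>(\<^sup>3\<^sup>)\<close> in \<open>\<Delta>\<close>, note that since the kernel of the element of simple type is
  trivial, \<open>G/M\<close> embeds into \<open>(\<int>/q)\<^sup>2\<close>, so \<open>M\<close> contains \<open>G\<^sup>(\<^sup>2\<^sup>)\<close>; and an
  invariant homomorphism on \<open>M\<close> kills \<open>h\<^sup>q\<close> and \<open>[h, g]\<close> for \<open>h \<in> M\<close>
  (\<open>central_series_subset_Delta\<close>).

  For the reverse inclusion call a function on \<open>G \<times> G\<close> \<open>\<Delta>\<close>-trivial if it is the coboundary of a
  cochain that vanishes on \<open>\<Delta>\<close>.  By the first paragraph this holds for the cocycle of an element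
  of simple type as soon as it is a coboundary.  In particular, from \<open>\<psi> = \<psi>' = 0\<close>, characters
  vanish on \<open>\<Delta>\<close>, so that every solution of the coboundary equation of a \<open>\<Delta>\<close>-trivial function
  vanishes on \<open>\<Delta>\<close>.  Galois relation type extends this to all relations: the relation
  \<open>\<psi> \<union> \<xi> + \<beta>(\<psi>) = 0\<close> is of simple type, it turns every Bockstein into a cup product, and the
  relations among cup products are generated by relations \<open>\<psi> \<union> \<psi>' = 0\<close>, each a difference of
  two relations of simple type.  (For \<open>q = 2\<close> these are themselves of simple type, and
  \<open>\<beta>(\<psi>) = \<psi> \<union> \<psi>\<close>.)  Hence every coboundary in the span of cup products and carries is
  \<open>\<Delta>\<close>-trivial (\<open>cup_carry_span_Delta_trivial\<close>).

  Let now \<open>x \<in> \<Delta>\<close>.  All characters vanish at \<open>x\<close>, so \<open>x \<in> G\<^sup>(\<^sup>2\<^sup>)\<close>.  If \<open>x\<close> were not in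
  \<open>G\<^sup>(\<^sup>3\<^sup>)\<close>, some invariant homomorphism \<open>\<phi>\<close> on an open subgroup containing \<open>G\<^sup>(\<^sup>2\<^sup>)\<close>
  would not vanish at \<open>x\<close> (\<open>invariant_character_exists\<close>).  The third condition of Galois relation
  type provides characters \<open>\<eta>\<^sub>1, \<dots>, \<eta>\<^sub>k\<close> and elements \<open>t\<^sub>1, \<dots>, t\<^sub>k\<close> dual to them whose
  common kernel \<open>M\<close> lies in that subgroup (\<open>dual_system_exists\<close>).  Every element of \<open>G\<close> is
  uniquely \<open>m t\<^sub>1\<^sup>a t\<^sub>2\<^sup>b \<cdots>\<close> with \<open>m \<in> M\<close> and exponents in \<open>{0..<q}\<close>, and sending it to \<open>\<phi> m\<close>
  extends \<open>\<phi>\<close> to a cochain \<open>y\<close>.  Collecting a product of two such expressions produces commutators,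
  which contribute cup products to \<open>\<delta>y\<close>, and \<open>q\<close>-th powers, which contribute carries
  (\<open>extension_of_invariant_character\<close>).  So \<open>\<delta>y\<close> is \<open>\<Delta>\<close>-trivial and \<open>\<phi> x = y x = 0\<close>, a contradiction.
\<close>


section \<open>The universal property of the tensor product\<close>

lemma free_Abelian_group_diff:
  assumes "x \<in> carrier (free_Abelian_group S)" and "y \<in> carrier (free_Abelian_group S)"
  shows "x - y = x \<otimes>\<^bsub>free_Abelian_group S\<^esub> inv\<^bsub>free_Abelian_group S\<^esub> y"
  using assms
  by (simp only: mult_free_Abelian_group inv_free_Abelian_group carrier_free_Abelian_group_iff
      diff_conv_add_uminus)

lemma free_Abelian_group_diff_closed:
  assumes "x \<in> carrier (free_Abelian_group S)" and "y \<in> carrier (free_Abelian_group S)"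
  shows "x - y \<in> carrier (free_Abelian_group S)"
  unfolding free_Abelian_group_diff[OF assms]
  by (intro monoid.m_closed[OF group.is_monoid] group.inv_closed group_free_Abelian_group assms)

lemma normal_tensor_relations:
  assumes "group A" and "group B"
  shows "tensor_relations A B \<lhd> free_Abelian_group (carrier A \<times> carrier B)"
proof -
  interpret A: group A by fact
  interpret B: group B by fact
  let ?F = "free_Abelian_group (carrier A \<times> carrier B)"
  interpret F: comm_group "free_Abelian_group (carrier A \<times> carrier B)"
    by (rule abelian_free_Abelian_group)
  have l: "frag_of (a \<otimes>\<^bsub>A\<^esub> a', b) - frag_of (a, b) - frag_of (a', b) \<in> carrier ?F"
    if "a \<in> carrier A" "a' \<in> carrier A" "b \<in> carrier B" for a a' b
    by (intro free_Abelian_group_diff_closed) (simp_all add: that)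
  have r: "frag_of (a, b \<otimes>\<^bsub>B\<^esub> b') - frag_of (a, b) - frag_of (a, b') \<in> carrier ?F"
    if "a \<in> carrier A" "b \<in> carrier B" "b' \<in> carrier B" for a b b'
    by (intro free_Abelian_group_diff_closed) (simp_all add: that)
  have "subgroup (tensor_relations A B) ?F"
    unfolding tensor_relations_def
    by (rule F.generate_is_subgroup, rule Un_least; rule subsetI; drule CollectD; use l r in metis)
  then show ?thesis
    by (simp add: F.normal_iff_subgroup)
qed

lemma comm_group_tensor:
  assumes "group A" and "group B"
  shows "comm_group (tensor A B)"
  unfolding tensor_def
  using comm_group.abelian_FactGroup[OF abelian_free_Abelian_group
      normal_imp_subgroup[OF normal_tensor_relations[OF assms]]] .

lemma pure_tensor_closed:
  assumes "a \<in> carrier A" and "b \<in> carrier B"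
  shows "pure_tensor A B a b \<in> carrier (tensor A B)"
  unfolding pure_tensor_def tensor_def carrier_FactGroup
  by (rule imageI) (simp add: assms)

text \<open>A bilinear map extends to the free abelian group on \<open>A \<times> B\<close>, and bilinearity says exactly that
  the extension kills the defining relations of the tensor product.\<close>

lemma hom_tensor_exists:
  fixes f :: "'a \<Rightarrow> 'b \<Rightarrow> 'c"
  assumes "group A" and "group B" and "comm_group C"
    and closed: "\<And>a b. a \<in> carrier A \<Longrightarrow> b \<in> carrier B \<Longrightarrow> f a b \<in> carrier C"
    and left: "\<And>a a' b. \<lbrakk>a \<in> carrier A; a' \<in> carrier A; b \<in> carrier B\<rbrakk> \<Longrightarrow>
      f (a \<otimes>\<^bsub>A\<^esub> a') b = f a b \<otimes>\<^bsub>C\<^esub> f a' b"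
    and right: "\<And>a b b'. \<lbrakk>a \<in> carrier A; b \<in> carrier B; b' \<in> carrier B\<rbrakk> \<Longrightarrow>
      f a (b \<otimes>\<^bsub>B\<^esub> b') = f a b \<otimes>\<^bsub>C\<^esub> f a b'"
  obtains h where "h \<in> hom (tensor A B) C"
    and "\<And>a b. a \<in> carrier A \<Longrightarrow> b \<in> carrier B \<Longrightarrow> h (pure_tensor A B a b) = f a b"
proof -
  interpret A: group A by fact
  interpret B: group B by fact
  interpret C: comm_group C by fact
  let ?F = "free_Abelian_group (carrier A \<times> carrier B)"
  let ?R = "tensor_relations A B"
  interpret F: comm_group ?F by (rule abelian_free_Abelian_group)
  interpret R: normal ?R ?F by (rule normal_tensor_relations) fact+
  have "(\<lambda>(a, b). f a b) ` (carrier A \<times> carrier B) \<subseteq> carrier C"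
    using closed by auto
  then obtain h0 where h0: "h0 \<in> hom ?F C"
    and h0_of: "\<And>x. x \<in> carrier A \<times> carrier B \<Longrightarrow> h0 (frag_of x) = (\<lambda>(a, b). f a b) x"
    by (rule C.free_Abelian_group_universal) blast
  interpret h0: group_hom ?F C h0 by unfold_locales fact
  have diff1: "h0 (x - y) = h0 x \<otimes>\<^bsub>C\<^esub> inv\<^bsub>C\<^esub> h0 y"
    if "x \<in> carrier ?F" "y \<in> carrier ?F" for x y
    unfolding free_Abelian_group_diff[OF that]
    using that by (simp only: h0.hom_mult h0.hom_inv F.inv_closed)
  have diff: "h0 (x - y - z) = h0 x \<otimes>\<^bsub>C\<^esub> inv\<^bsub>C\<^esub> h0 y \<otimes>\<^bsub>C\<^esub> inv\<^bsub>C\<^esub> h0 z"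
    and diff_closed: "x - y - z \<in> carrier ?F"
    if "x \<in> carrier ?F" "y \<in> carrier ?F" "z \<in> carrier ?F" for x y z
    using that by (simp_all only: diff1 free_Abelian_group_diff_closed)
  have cancel: "(u \<otimes>\<^bsub>C\<^esub> v) \<otimes>\<^bsub>C\<^esub> inv\<^bsub>C\<^esub> u \<otimes>\<^bsub>C\<^esub> inv\<^bsub>C\<^esub> v = \<one>\<^bsub>C\<^esub>"
    if "u \<in> carrier C" "v \<in> carrier C" for u v
    using that C.m_comm[of u v] by (simp add: C.m_assoc)
  have "?R \<subseteq> kernel ?F C h0"
    unfolding tensor_relations_def
  proof (rule F.generate_subgroup_incl[OF _ h0.subgroup_kernel], rule subsetI)
    fix x
    assume "x \<in> {frag_of (a \<otimes>\<^bsub>A\<^esub> a', b) - frag_of (a, b) - frag_of (a', b) | a a' b.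
           a \<in> carrier A \<and> a' \<in> carrier A \<and> b \<in> carrier B} \<union>
        {frag_of (a, b \<otimes>\<^bsub>B\<^esub> b') - frag_of (a, b) - frag_of (a, b') | a b b'.
           a \<in> carrier A \<and> b \<in> carrier B \<and> b' \<in> carrier B}"
    then consider (l) a a' b where "x = frag_of (a \<otimes>\<^bsub>A\<^esub> a', b) - frag_of (a, b) - frag_of (a', b)"
        "a \<in> carrier A" "a' \<in> carrier A" "b \<in> carrier B"
      | (r) a b b' where "x = frag_of (a, b \<otimes>\<^bsub>B\<^esub> b') - frag_of (a, b) - frag_of (a, b')"
        "a \<in> carrier A" "b \<in> carrier B" "b' \<in> carrier B"
      by blast
    then show "x \<in> kernel ?F C h0"
    proof cases
      case l
      then show ?thesis
        by (simp add: kernel_def diff diff_closed h0_of left closed cancel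
            del: carrier_free_Abelian_group_iff)
    next
      case r
      then show ?thesis
        by (simp add: kernel_def diff diff_closed h0_of right closed cancel
            del: carrier_free_Abelian_group_iff)
    qed
  qed
  then have "h0 x = h0 y"
    if "x \<in> carrier ?F" "y \<in> carrier ?F" "?R #>\<^bsub>?F\<^esub> x = ?R #>\<^bsub>?F\<^esub> y" for x y
  proof -
    have "x \<in> ?R #>\<^bsub>?F\<^esub> y"
      using F.rcos_self[OF that(1) R.subgroup_axioms] that(3) by simp
    then obtain r where "r \<in> ?R" "x = r \<otimes>\<^bsub>?F\<^esub> y"
      by (auto simp: r_coset_def)
    moreover have "r \<in> carrier ?F" and "h0 r = \<one>\<^bsub>C\<^esub>"
      using \<open>?R \<subseteq> kernel ?F C h0\<close> \<open>r \<in> ?R\<close> by (auto simp: kernel_def)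
    ultimately show ?thesis
      using that(2) by (simp del: mult_free_Abelian_group carrier_free_Abelian_group_iff)
  qed
  then obtain h where h: "h \<in> hom (?F Mod ?R) C"
    and h_of: "\<And>x. x \<in> carrier ?F \<Longrightarrow> h (?R #>\<^bsub>?F\<^esub> x) = h0 x"
    using FactGroup_universal[OF h0 R.normal_axioms] by blast
  show thesis
  proof
    show "h \<in> hom (tensor A B) C"
      using h by (simp add: tensor_def)
    show "h (pure_tensor A B a b) = f a b" if "a \<in> carrier A" "b \<in> carrier B" for a b
      using that by (simp add: pure_tensor_def h_of h0_of)
  qed
qed

text \<open>The pure tensors generate the tensor product.\<close>

lemma hom_tensor_eqI:
  assumes "group A" and "group B" and "group C"
    and h: "h \<in> hom (tensor A B) C" and k: "k \<in> hom (tensor A B) C"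
    and eq: "\<And>a b. a \<in> carrier A \<Longrightarrow> b \<in> carrier B \<Longrightarrow>
      h (pure_tensor A B a b) = k (pure_tensor A B a b)"
    and t: "t \<in> carrier (tensor A B)"
  shows "h t = k t"
proof -
  interpret C: group C by fact
  let ?F = "free_Abelian_group (carrier A \<times> carrier B)"
  let ?R = "tensor_relations A B"
  let ?\<pi> = "\<lambda>x. ?R #>\<^bsub>?F\<^esub> x"
  interpret F: comm_group ?F by (rule abelian_free_Abelian_group)
  interpret R: normal ?R ?F by (rule normal_tensor_relations) fact+
  interpret T: comm_group "tensor A B" by (rule comm_group_tensor) fact+
  have \<pi>: "?\<pi> \<in> hom ?F (tensor A B)"
    unfolding tensor_def by (rule R.r_coset_hom_Mod)
  interpret \<pi>: group_hom ?F "tensor A B" ?\<pi> by unfold_locales (rule \<pi>)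
  interpret h: group_hom "tensor A B" C h by unfold_locales fact
  interpret k: group_hom "tensor A B" C k by unfold_locales fact
  obtain x where x: "x \<in> carrier ?F" "t = ?\<pi> x"
    using t by (auto simp: tensor_def carrier_FactGroup)
  have "Poly_Mapping.keys x \<subseteq> carrier A \<times> carrier B"
    using x(1) by simp
  then have "h (?\<pi> x) = k (?\<pi> x)"
  proof (rule free_Abelian_group_induct)
    show "h (?\<pi> 0) = k (?\<pi> 0)"
      using \<pi>.hom_one h.hom_one k.hom_one by simp
  next
    fix x y
    assume xy: "Poly_Mapping.keys x \<subseteq> carrier A \<times> carrier B"
      "Poly_Mapping.keys y \<subseteq> carrier A \<times> carrier B"
      and IH: "h (?\<pi> x) = k (?\<pi> x)" "h (?\<pi> y) = k (?\<pi> y)"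
    have c: "x \<in> carrier ?F" "y \<in> carrier ?F"
      using xy by simp_all
    with free_Abelian_group_diff[OF this] have "?\<pi> (x - y) = ?\<pi> x \<otimes>\<^bsub>tensor A B\<^esub> inv\<^bsub>tensor A B\<^esub> ?\<pi> y"
      by (metis F.inv_closed \<pi>.hom_inv \<pi>.hom_mult)
    then show "h (?\<pi> (x - y)) = k (?\<pi> (x - y))"
      using IH c by (metis T.inv_closed \<pi>.hom_closed h.hom_inv h.hom_mult k.hom_inv k.hom_mult)
  next
    fix a
    assume "a \<in> carrier A \<times> carrier B"
    then show "h (?\<pi> (frag_of a)) = k (?\<pi> (frag_of a))"
      using eq by (auto simp: pure_tensor_def)
  qed
  then show ?thesis by (simp add: x(2))
qed

text \<open>The definite description in \<^const>\<open>tensor_lift\<close> is met as soon as some homomorphism has the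
  prescribed values on pure tensors.\<close>

lemma tensor_lift_eq:
  assumes "group A" and "group B" and "group C"
    and h: "h \<in> hom (tensor A B) C"
    and pure: "\<And>a b. a \<in> carrier A \<Longrightarrow> b \<in> carrier B \<Longrightarrow> h (pure_tensor A B a b) = f a b"
    and t: "t \<in> carrier (tensor A B)"
  shows "tensor_lift A B C f t = h t"
proof -
  interpret T: comm_group "tensor A B" by (rule comm_group_tensor) fact+
  let ?h = "restrict h (carrier (tensor A B))"
  have "tensor_lift A B C f = ?h"
    unfolding tensor_lift_def
  proof (rule the_equality)
    show "?h \<in> hom (tensor A B) C \<and> ?h \<in> extensional (carrier (tensor A B)) \<and>
        (\<forall>a\<in>carrier A. \<forall>b\<in>carrier B. ?h (pure_tensor A B a b) = f a b)"
      using h by (auto simp: pure pure_tensor_closed hom_def)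
    fix k
    assume k: "k \<in> hom (tensor A B) C \<and> k \<in> extensional (carrier (tensor A B)) \<and>
        (\<forall>a\<in>carrier A. \<forall>b\<in>carrier B. k (pure_tensor A B a b) = f a b)"
    have "k x = h x" if "x \<in> carrier (tensor A B)" for x
      using hom_tensor_eqI[OF assms(1-3) _ h _ that, of k] k pure by auto
    then show "k = ?h"
      using k by (intro extensionalityI[of k "carrier (tensor A B)"]) auto
  qed
  then show ?thesis using t by simp
qed

section \<open>Locally constant functions and cochains\<close>

text \<open>For equations between reduced representatives of expressions of the same shape.\<close>

lemmas mod_congs = mod_add_cong mod_diff_cong mod_mult_cong refl

text \<open>Continuity into a discrete space.  No range is fixed, so the notion is stable under composition
  with arbitrary functions.\<close>

definition locally_constant :: "'x topology \<Rightarrow> ('x \<Rightarrow> 'v) \<Rightarrow> bool" where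
  "locally_constant X f \<longleftrightarrow> (\<forall>v. openin X {x \<in> topspace X. f x = v})"

lemma locally_constant_openin:
  assumes "locally_constant X f"
  shows "openin X {x \<in> topspace X. P (f x)}"
proof -
  have "{x \<in> topspace X. P (f x)} = (\<Union>v\<in>{v. P v}. {x \<in> topspace X. f x = v})"
    by auto
  then show ?thesis
    using assms by (auto simp: locally_constant_def)
qed

lemma locally_constant_closedin:
  assumes "locally_constant X f"
  shows "closedin X {x \<in> topspace X. P (f x)}"
proof -
  have "topspace X - {x \<in> topspace X. P (f x)} = {x \<in> topspace X. \<not> P (f x)}"
    by auto
  then show ?thesis
    using locally_constant_openin[OF assms, of "\<lambda>v. \<not> P v"] by (auto simp: closedin_def)
qed

lemma locally_constant_const [simp]: "locally_constant X (\<lambda>x. c)"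
  unfolding locally_constant_def
proof
  fix v show "openin X {x \<in> topspace X. c = v}" by (cases "c = v") auto
qed

lemma locally_constant_comp:
  assumes "locally_constant X f"
  shows "locally_constant X (\<lambda>x. F (f x))"
  using locally_constant_openin[OF assms, of "\<lambda>u. F u = _"] by (simp add: locally_constant_def)

lemma locally_constant_comp2:
  assumes "locally_constant X f" and "locally_constant X g"
  shows "locally_constant X (\<lambda>x. F (f x) (g x))"
  unfolding locally_constant_def
proof
  fix v
  have "{x \<in> topspace X. F (f x) (g x) = v} =
      (\<Union>a. {x \<in> topspace X. f x = a} \<inter> {x \<in> topspace X. F a (g x) = v})"
    by auto
  also have "openin X \<dots>"
    using locally_constant_openin[OF assms(1), of "\<lambda>u. u = _"]
      locally_constant_openin[OF assms(2), of "\<lambda>u. F _ u = v"]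
    by (intro openin_Union) (auto intro: openin_Int)
  finally show "openin X {x \<in> topspace X. F (f x) (g x) = v}" .
qed

lemma locally_constant_pullback:
  assumes "continuous_map X Y h" and "locally_constant Y f"
  shows "locally_constant X (\<lambda>x. f (h x))"
  unfolding locally_constant_def
proof
  fix v
  have "{x \<in> topspace X. f (h x) = v} = {x \<in> topspace X. h x \<in> {y \<in> topspace Y. f y = v}}"
    using continuous_map_image_subset_topspace[OF assms(1)] by auto
  also have "openin X \<dots>"
    using assms(2) by (intro openin_continuous_map_preimage[OF assms(1)]) (simp add: locally_constant_def)
  finally show "openin X {x \<in> topspace X. f (h x) = v}" .
qed

lemma locally_constant_cong:
  assumes "\<And>x. x \<in> topspace X \<Longrightarrow> f x = g x"
  shows "locally_constant X f \<longleftrightarrow> locally_constant X g"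
proof -
  have "{x \<in> topspace X. f x = v} = {x \<in> topspace X. g x = v}" for v
    using assms by auto
  then show ?thesis by (simp add: locally_constant_def)
qed

lemma locally_constant_subtopology:
  assumes "locally_constant X f"
  shows "locally_constant (subtopology X S) f"
  using locally_constant_pullback[OF continuous_map_from_subtopology[OF continuous_map_id] assms]
  by simp

lemma locally_constant_discrete [simp]: "locally_constant (discrete_topology U) f"
  by (auto simp: locally_constant_def)

lemma cont_fun_group_carrier_iff:
  assumes "n > 0"
  shows "f \<in> carrier (cont_fun_group n X) \<longleftrightarrow>
    f \<in> extensional (topspace X) \<and> (\<forall>x\<in>topspace X. 0 \<le> f x \<and> f x < int n) \<and> locally_constant X f"
  (is "_ = ?rhs")
proof -
  have "continuous_map X (discrete_topology {0..<int n}) f \<longleftrightarrow>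
      (\<forall>x\<in>topspace X. 0 \<le> f x \<and> f x < int n) \<and> locally_constant X f" (is "?l = ?r")
  proof
    assume l: ?l
    then have "f ` topspace X \<subseteq> {0..<int n}"
      using continuous_map_image_subset_topspace by fastforce
    moreover have "locally_constant X (\<lambda>x. id (f x))"
      by (rule locally_constant_pullback[OF l]) simp
    ultimately show ?r by auto
  next
    assume r: ?r
    then show ?l
      using locally_constant_openin[of X f] by (auto simp: continuous_map_def)
  qed
  then show ?thesis
    using assms by (simp add: cont_fun_group_def carrier_integer_mod_group conj_ac)
qed

lemma cont_fun_group_mult [simp]:
  "f \<otimes>\<^bsub>cont_fun_group n X\<^esub> g = (\<lambda>x\<in>topspace X. (f x + g x) mod int n)"
  by (simp add: cont_fun_group_def)

lemma cont_fun_group_one [simp]: "\<one>\<^bsub>cont_fun_group n X\<^esub> = (\<lambda>x\<in>topspace X. 0)"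
  by (simp add: cont_fun_group_def)

lemma cont_fun_restrict_mod:
  assumes "n > 0" and "locally_constant X f"
  shows "(\<lambda>x\<in>topspace X. f x mod int n) \<in> carrier (cont_fun_group n X)"
proof -
  have "locally_constant X (\<lambda>x\<in>topspace X. f x mod int n) = locally_constant X (\<lambda>x. f x mod int n)"
    by (rule locally_constant_cong) simp
  also have "\<dots>" by (rule locally_constant_comp[OF assms(2), of "\<lambda>u. u mod int n"])
  finally show ?thesis
    using assms(1) by (simp add: cont_fun_group_carrier_iff)
qed

text \<open>Groups of cochains, of cocycles and of characters all arise from the group of continuous
  functions by shrinking the carrier.\<close>

lemma comm_group_cont_fun_subset:
  assumes n: "n > 0" and S: "S \<subseteq> carrier (cont_fun_group n X)"
    and zero: "(\<lambda>x\<in>topspace X. 0) \<in> S"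
    and add: "\<And>f g. f \<in> S \<Longrightarrow> g \<in> S \<Longrightarrow> (\<lambda>x\<in>topspace X. (f x + g x) mod int n) \<in> S"
    and minus: "\<And>f. f \<in> S \<Longrightarrow> (\<lambda>x\<in>topspace X. (- f x) mod int n) \<in> S"
  shows "comm_group ((cont_fun_group n X)\<lparr>carrier := S\<rparr>)"
proof (rule comm_groupI, goal_cases)
  case (1 x y)
  then show ?case using add by simp
next
  case 2
  then show ?case using zero by simp
next
  case (3 x y z)
  show ?case by (auto simp: mod_simps ac_simps intro!: restrict_ext)
next
  case (4 x y)
  show ?case by (auto simp: ac_simps intro!: restrict_ext)
next
  case (5 x)
  then have "x \<in> carrier (cont_fun_group n X)" using S by auto
  then show ?case
    unfolding cont_fun_group_carrier_iff[OF n]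
    by (auto simp: fun_eq_iff extensional_def restrict_def)
next
  case (6 x)
  then show ?case
    using minus[of x] by (auto intro!: bexI[of _ "\<lambda>t\<in>topspace X. (- x t) mod int n"] restrict_ext simp: mod_simps)
qed


text \<open>The coefficients are \<open>\<int>/n\<close>.  The topological group is kept general, since the same facts are
  needed for \<open>G\<close> and for its discrete quotients \<open>G/M\<close>.  Below, \<open>X\<close> is the group of continuous
  characters \<open>H\<^sup>1(G, \<int>/n)\<close>, and \<open>C1\<close> consists of the continuous 1-cochains.\<close>

locale coefficient_setting = topological_group G T for G (structure) and T +
  fixes n :: nat
  assumes n_pos: "n > 0"
begin

abbreviation C1 where "C1 \<equiv> carrier (cont_fun_group n T)"

abbreviation X where "X \<equiv> carrier (H1 n G T)"

lemma locally_constant_fst: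
  "locally_constant T f \<Longrightarrow> locally_constant (prod_topology T T) (\<lambda>z. f (fst z))"
  by (rule locally_constant_pullback[OF continuous_map_fst])

lemma locally_constant_snd:
  "locally_constant T f \<Longrightarrow> locally_constant (prod_topology T T) (\<lambda>z. f (snd z))"
  by (rule locally_constant_pullback[OF continuous_map_snd])

lemma locally_constant_mult:
  "locally_constant T f \<Longrightarrow> locally_constant (prod_topology T T) (\<lambda>z. f (fst z \<otimes> snd z))"
  using locally_constant_pullback[OF continuous_mult, of f] by (simp add: case_prod_beta)

lemma C1_iff:
  "y \<in> C1 \<longleftrightarrow> y \<in> extensional (carrier G) \<and> (\<forall>g\<in>carrier G. 0 \<le> y g \<and> y g < int n) \<and>
    locally_constant T y"
  using cont_fun_group_carrier_iff[OF n_pos, of y T] by (simp add: topspace_eq)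

lemma H1_iff:
  "\<psi> \<in> X \<longleftrightarrow> \<psi> \<in> C1 \<and>
    (\<forall>g\<in>carrier G. \<forall>h\<in>carrier G. \<psi> (g \<otimes> h) = (\<psi> g + \<psi> h) mod int n)"
  unfolding H1_def by (auto simp: hom_def C1_iff carrier_integer_mod_group n_pos)

lemma H1_mult [simp]: "\<psi> \<otimes>\<^bsub>H1 n G T\<^esub> \<psi>' = (\<lambda>x\<in>carrier G. (\<psi> x + \<psi>' x) mod int n)"
  by (simp add: H1_def topspace_eq)

lemma H1_one [simp]: "\<one>\<^bsub>H1 n G T\<^esub> = (\<lambda>x\<in>carrier G. 0)"
  by (simp add: H1_def topspace_eq)

lemma H1_hom: "\<psi> \<in> X \<Longrightarrow> g \<in> carrier G \<Longrightarrow> h \<in> carrier G \<Longrightarrow> \<psi> (g \<otimes> h) = (\<psi> g + \<psi> h) mod int n"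
  by (simp add: H1_iff)

lemma H1_range: "\<psi> \<in> X \<Longrightarrow> g \<in> carrier G \<Longrightarrow> 0 \<le> \<psi> g \<and> \<psi> g < int n"
  by (simp add: H1_iff C1_iff)

lemma H1_locally_constant: "\<psi> \<in> X \<Longrightarrow> locally_constant T \<psi>"
  by (simp add: H1_iff C1_iff)

lemma H1_mod [simp]: "\<psi> \<in> X \<Longrightarrow> g \<in> carrier G \<Longrightarrow> \<psi> g mod int n = \<psi> g"
  using H1_range by simp

lemma H1_group_hom: "\<psi> \<in> X \<Longrightarrow> group_hom G (integer_mod_group n) \<psi>"
  by (intro group_hom.intro group_hom_axioms.intro is_group group_integer_mod_group)
    (simp add: H1_def)

lemma H1_one_arg [simp]: "\<psi> \<in> X \<Longrightarrow> \<psi> \<one> = 0"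
  using group_hom.hom_one[OF H1_group_hom] by simp

lemma H1_inv: "\<psi> \<in> X \<Longrightarrow> g \<in> carrier G \<Longrightarrow> \<psi> (inv g) = (- \<psi> g) mod int n"
  using group_hom.hom_inv[OF H1_group_hom, of \<psi> g] H1_range[of \<psi> g] n_pos
    inv_integer_mod_group[of "\<psi> g" n]
  by (simp add: carrier_integer_mod_group)

lemma H1_pow: "\<psi> \<in> X \<Longrightarrow> g \<in> carrier G \<Longrightarrow> \<psi> (g [^] (k::nat)) = (int k * \<psi> g) mod int n"
  using group_hom.hom_nat_pow[OF H1_group_hom, of \<psi> g k] H1_range[of \<psi> g] n_pos by simp

lemma C1_restrict_mod:
  "locally_constant T f \<Longrightarrow> (\<lambda>x\<in>carrier G. f x mod int n) \<in> C1"
  using cont_fun_restrict_mod[OF n_pos, of T f] by (simp add: topspace_eq)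

lemma H1_restrict_mod:
  assumes "locally_constant T f"
    and "\<And>g h. g \<in> carrier G \<Longrightarrow> h \<in> carrier G \<Longrightarrow> f (g \<otimes> h) mod int n = (f g + f h) mod int n"
  shows "(\<lambda>x\<in>carrier G. f x mod int n) \<in> X"
  using C1_restrict_mod[OF assms(1)] assms(2) by (simp add: H1_iff mod_simps)

lemma H1_lincomb:
  assumes "\<psi> \<in> X" and "\<psi>' \<in> X"
  shows "(\<lambda>x\<in>carrier G. (a * \<psi> x + b * \<psi>' x) mod int n) \<in> X"
proof (rule H1_restrict_mod)
  show "locally_constant T (\<lambda>x. a * \<psi> x + b * \<psi>' x)"
    by (rule locally_constant_comp2[of T \<psi> \<psi>' "\<lambda>u v. a * u + b * v"])
      (simp_all add: assms H1_locally_constant)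
  fix g h assume gh: "g \<in> carrier G" "h \<in> carrier G"
  have "(a * \<psi> (g \<otimes> h) + b * \<psi>' (g \<otimes> h)) mod int n =
      (a * (\<psi> g + \<psi> h) + b * (\<psi>' g + \<psi>' h)) mod int n"
    by (intro mod_congs) (simp_all add: gh assms H1_hom)
  then show "(a * \<psi> (g \<otimes> h) + b * \<psi>' (g \<otimes> h)) mod int n =
      (a * \<psi> g + b * \<psi>' g + (a * \<psi> h + b * \<psi>' h)) mod int n"
    by (simp add: algebra_simps)
qed

lemma H1_zero: "(\<lambda>x\<in>carrier G. 0) \<in> X"
  using H1_restrict_mod[of "\<lambda>x. 0"] by simp

lemma comm_group_C1: "comm_group (cont_fun_group n T)"
proof -
  have "comm_group ((cont_fun_group n T)\<lparr>carrier := C1\<rparr>)"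
  proof (rule comm_group_cont_fun_subset[OF n_pos subset_refl])
    show "(\<lambda>x\<in>topspace T. 0) \<in> C1"
      using C1_restrict_mod[of "\<lambda>x. 0"] by (simp add: topspace_eq)
    show "(\<lambda>x\<in>topspace T. (f x + g x) mod int n) \<in> C1" if "f \<in> C1" "g \<in> C1" for f g
      using that locally_constant_comp2[of T f g "(+)"]
      by (simp add: topspace_eq C1_iff[of f] C1_iff[of g] C1_restrict_mod)
    show "(\<lambda>x\<in>topspace T. (- f x) mod int n) \<in> C1" if "f \<in> C1" for f
      using that locally_constant_comp[of T f "\<lambda>u. - u"]
      by (simp add: topspace_eq C1_iff[of f] C1_restrict_mod)
  qed
  then show ?thesis by simp
qed

lemma comm_group_H1: "comm_group (H1 n G T)"
  unfolding H1_def
proof (rule comm_group_cont_fun_subset[OF n_pos], goal_cases)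
  case 1
  show ?case by auto
next
  case 2
  show ?case using H1_zero by (simp add: H1_def topspace_eq)
next
  case (3 f g)
  then show ?case using H1_lincomb[of f g 1 1] by (simp add: H1_def topspace_eq)
next
  case (4 f)
  then show ?case using H1_lincomb[of f f 0 "-1"] by (simp add: H1_def topspace_eq)
qed

lemma group_H1: "group (H1 n G T)"
  using comm_group_H1 comm_group.axioms by blast


subsection \<open>Two-cocycles\<close>

lemma Z2_iff:
  "f \<in> carrier (Z2 n G T) \<longleftrightarrow>
    f \<in> extensional (carrier G \<times> carrier G) \<and>
    (\<forall>g\<in>carrier G. \<forall>h\<in>carrier G. 0 \<le> f (g, h) \<and> f (g, h) < int n) \<and>
    locally_constant (prod_topology T T) f \<and>
    (\<forall>g\<in>carrier G. \<forall>h\<in>carrier G. \<forall>k\<in>carrier G.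
      (f (h, k) - f (g \<otimes> h, k) + f (g, h \<otimes> k) - f (g, h)) mod int n = 0)"
  by (auto simp: Z2_def cont_fun_group_carrier_iff[OF n_pos] topspace_eq)

lemma Z2_eqI:
  assumes "f \<in> carrier (Z2 n G T)" "f' \<in> carrier (Z2 n G T)"
    and "\<And>g h. g \<in> carrier G \<Longrightarrow> h \<in> carrier G \<Longrightarrow> f (g, h) mod int n = f' (g, h) mod int n"
  shows "f = f'"
proof (rule extensionalityI)
  show "f \<in> extensional (carrier G \<times> carrier G)" "f' \<in> extensional (carrier G \<times> carrier G)"
    using assms by (simp_all add: Z2_iff)
  fix x assume "x \<in> carrier G \<times> carrier G"
  then show "f x = f' x"
    using assms by (auto simp: Z2_iff)
qed

lemma Z2_mult [simp]:
  "f \<otimes>\<^bsub>Z2 n G T\<^esub> f' = (\<lambda>z\<in>carrier G \<times> carrier G. (f z + f' z) mod int n)"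
  by (simp add: Z2_def topspace_eq)

lemma Z2_one [simp]: "\<one>\<^bsub>Z2 n G T\<^esub> = (\<lambda>z\<in>carrier G \<times> carrier G. 0)"
  by (simp add: Z2_def topspace_eq)

lemma Z2_restrict_mod:
  assumes lc: "locally_constant (prod_topology T T) (\<lambda>z. f (fst z) (snd z))"
    and coc: "\<And>g h k. \<lbrakk>g \<in> carrier G; h \<in> carrier G; k \<in> carrier G\<rbrakk> \<Longrightarrow>
      (f h k - f (g \<otimes> h) k + f g (h \<otimes> k) - f g h) mod int n = 0"
  shows "(\<lambda>(g, h)\<in>carrier G \<times> carrier G. f g h mod int n) \<in> carrier (Z2 n G T)"
proof -
  have "(\<lambda>z\<in>topspace (prod_topology T T). f (fst z) (snd z) mod int n) \<in>
      carrier (cont_fun_group n (prod_topology T T))"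
    by (rule cont_fun_restrict_mod[OF n_pos lc])
  then show ?thesis
    unfolding Z2_iff
    using n_pos coc
    by (auto simp: cont_fun_group_carrier_iff topspace_eq split_beta' mod_eq_0_iff_dvd[symmetric]
        intro!: trans[OF _ coc] mod_congs)
qed

lemma comm_group_Z2: "comm_group (Z2 n G T)"
  unfolding Z2_def
proof (rule comm_group_cont_fun_subset[OF n_pos], goal_cases)
  case 1
  show ?case by auto
next
  case 2
  show ?case using Z2_restrict_mod[of "\<lambda>g h. 0"] by (simp add: Z2_def topspace_eq split_beta')
next
  case (3 f f')
  then have ff: "f \<in> carrier (Z2 n G T)" "f' \<in> carrier (Z2 n G T)" by (simp_all add: Z2_def)
  have "(\<lambda>(g, h)\<in>carrier G \<times> carrier G. (f (g, h) + f' (g, h)) mod int n) \<in> carrier (Z2 n G T)"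
  proof (rule Z2_restrict_mod)
    show "locally_constant (prod_topology T T) (\<lambda>z. f (fst z, snd z) + f' (fst z, snd z))"
      using ff locally_constant_comp2[of "prod_topology T T" f f' "(+)"] by (simp add: Z2_iff)
    fix g h k assume "g \<in> carrier G" "h \<in> carrier G" "k \<in> carrier G"
    then have "(f (h, k) - f (g \<otimes> h, k) + f (g, h \<otimes> k) - f (g, h)) mod int n = 0"
      and "(f' (h, k) - f' (g \<otimes> h, k) + f' (g, h \<otimes> k) - f' (g, h)) mod int n = 0"
      using ff by (simp_all add: Z2_iff)
    then have "(f (h, k) - f (g \<otimes> h, k) + f (g, h \<otimes> k) - f (g, h) +
        (f' (h, k) - f' (g \<otimes> h, k) + f' (g, h \<otimes> k) - f' (g, h))) mod int n = 0"
      by (metis add.right_neutral mod_add_right_eq)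
    then show "(f (h, k) + f' (h, k) - (f (g \<otimes> h, k) + f' (g \<otimes> h, k)) +
        (f (g, h \<otimes> k) + f' (g, h \<otimes> k)) - (f (g, h) + f' (g, h))) mod int n = 0"
      by (simp add: algebra_simps)
  qed
  then show ?case by (simp add: Z2_def topspace_eq split_beta')
next
  case (4 f)
  then have ff: "f \<in> carrier (Z2 n G T)" by (simp add: Z2_def)
  have "(\<lambda>(g, h)\<in>carrier G \<times> carrier G. (- f (g, h)) mod int n) \<in> carrier (Z2 n G T)"
  proof (rule Z2_restrict_mod)
    show "locally_constant (prod_topology T T) (\<lambda>z. - f (fst z, snd z))"
      using ff locally_constant_comp[of "prod_topology T T" f "\<lambda>u. - u"] by (simp add: Z2_iff)
    fix g h k assume "g \<in> carrier G" "h \<in> carrier G" "k \<in> carrier G"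
    then have "int n dvd f (h, k) - f (g \<otimes> h, k) + f (g, h \<otimes> k) - f (g, h)"
      using ff by (simp add: Z2_iff dvd_eq_mod_eq_0)
    then have "int n dvd - (f (h, k) - f (g \<otimes> h, k) + f (g, h \<otimes> k) - f (g, h))"
      by (simp only: dvd_minus_iff)
    then show "(- f (h, k) - - f (g \<otimes> h, k) + - f (g, h \<otimes> k) - - f (g, h)) mod int n = 0"
      by (simp add: dvd_eq_mod_eq_0 algebra_simps)
  qed
  then show ?case by (simp add: Z2_def topspace_eq split_beta')
qed

lemma Z2_inv:
  assumes "f \<in> carrier (Z2 n G T)"
  shows "inv\<^bsub>Z2 n G T\<^esub> f = (\<lambda>z\<in>carrier G \<times> carrier G. (- f z) mod int n)"
proof -
  interpret Z: comm_group "Z2 n G T" by (rule comm_group_Z2)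
  have "inv\<^bsub>Z2 n G T\<^esub> f \<in> carrier (Z2 n G T)" using assms by simp
  moreover have "f \<otimes>\<^bsub>Z2 n G T\<^esub> inv\<^bsub>Z2 n G T\<^esub> f = \<one>\<^bsub>Z2 n G T\<^esub>" using assms by (rule Z.r_inv)
  ultimately have "(inv\<^bsub>Z2 n G T\<^esub> f) z = (- f z) mod int n" if "z \<in> carrier G \<times> carrier G" for z
  proof -
    assume a: "inv\<^bsub>Z2 n G T\<^esub> f \<in> carrier (Z2 n G T)" "f \<otimes>\<^bsub>Z2 n G T\<^esub> inv\<^bsub>Z2 n G T\<^esub> f = \<one>\<^bsub>Z2 n G T\<^esub>"
    from fun_cong[OF a(2), of z] that have "(f z + (inv\<^bsub>Z2 n G T\<^esub> f) z) mod int n = 0" by simp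
    then have "(inv\<^bsub>Z2 n G T\<^esub> f) z mod int n = (- f z) mod int n"
      by (metis add.commute add_diff_cancel_left' diff_0 mod_diff_left_eq)
    moreover have "(inv\<^bsub>Z2 n G T\<^esub> f) z mod int n = (inv\<^bsub>Z2 n G T\<^esub> f) z"
      using a(1) that by (auto simp: Z2_iff)
    ultimately show ?thesis by simp
  qed
  then show ?thesis
    using \<open>inv\<^bsub>Z2 n G T\<^esub> f \<in> carrier (Z2 n G T)\<close>
    by (intro extensionalityI[of _ "carrier G \<times> carrier G"]) (auto simp: Z2_iff)
qed

lemma coboundary_apply:
  "g \<in> carrier G \<Longrightarrow> h \<in> carrier G \<Longrightarrow> coboundary n G y (g, h) = (y h - y (g \<otimes> h) + y g) mod int n"
  by (simp add: coboundary_def)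

lemma coboundary_Z2:
  assumes "locally_constant T y"
  shows "coboundary n G y \<in> carrier (Z2 n G T)"
  unfolding coboundary_def
proof (rule Z2_restrict_mod)
  show "locally_constant (prod_topology T T) (\<lambda>z. y (snd z) - y (fst z \<otimes> snd z) + y (fst z))"
    by (rule locally_constant_comp2[where F = "(+)"], rule locally_constant_comp2[where F = "(-)"])
      (simp_all add: assms locally_constant_fst locally_constant_snd locally_constant_mult)
qed (simp add: m_assoc)

lemma B2_iff: "b \<in> B2 n G T \<longleftrightarrow> (\<exists>y\<in>C1. b = coboundary n G y)"
  by (auto simp: B2_def)

lemma subgroup_B2: "subgroup (B2 n G T) (Z2 n G T)"
proof -
  interpret Z: comm_group "Z2 n G T" by (rule comm_group_Z2)
  interpret C: comm_group "cont_fun_group n T" by (rule comm_group_C1)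
  have "coboundary n G \<in> hom (cont_fun_group n T) (Z2 n G T)"
  proof (rule homI)
    fix y y' assume y: "y \<in> C1" "y' \<in> C1"
    then show c: "coboundary n G y \<in> carrier (Z2 n G T)"
      by (simp add: coboundary_Z2 C1_iff)
    have m: "y \<otimes>\<^bsub>cont_fun_group n T\<^esub> y' \<in> C1" using y by (rule C.m_closed)
    show "coboundary n G (y \<otimes>\<^bsub>cont_fun_group n T\<^esub> y') =
        coboundary n G y \<otimes>\<^bsub>Z2 n G T\<^esub> coboundary n G y'"
    proof (rule Z2_eqI)
      show "coboundary n G (y \<otimes>\<^bsub>cont_fun_group n T\<^esub> y') \<in> carrier (Z2 n G T)"
        using m by (simp add: coboundary_Z2 C1_iff del: cont_fun_group_mult)
      show "coboundary n G y \<otimes>\<^bsub>Z2 n G T\<^esub> coboundary n G y' \<in> carrier (Z2 n G T)"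
        using y by (simp add: coboundary_Z2 C1_iff del: Z2_mult)
      fix g h assume gh: "g \<in> carrier G" "h \<in> carrier G"
      have "coboundary n G (y \<otimes>\<^bsub>cont_fun_group n T\<^esub> y') (g, h) mod int n =
          ((y h + y' h) - (y (g \<otimes> h) + y' (g \<otimes> h)) + (y g + y' g)) mod int n"
        using gh by (simp add: coboundary_apply topspace_eq) (intro mod_congs; simp)
      also have "\<dots> = ((y h - y (g \<otimes> h) + y g) + (y' h - y' (g \<otimes> h) + y' g)) mod int n"
        by (simp add: algebra_simps)
      also have "\<dots> = (coboundary n G y \<otimes>\<^bsub>Z2 n G T\<^esub> coboundary n G y') (g, h) mod int n"
        using gh by (simp add: coboundary_apply mod_simps)
      finally show "coboundary n G (y \<otimes>\<^bsub>cont_fun_group n T\<^esub> y') (g, h) mod int n =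
          (coboundary n G y \<otimes>\<^bsub>Z2 n G T\<^esub> coboundary n G y') (g, h) mod int n" .
    qed
  qed
  then interpret d: group_hom "cont_fun_group n T" "Z2 n G T" "coboundary n G"
    by unfold_locales
  show ?thesis
    unfolding B2_def by (rule d.img_is_subgroup)
qed

lemma normal_B2: "B2 n G T \<lhd> Z2 n G T"
  using comm_group.normal_iff_subgroup[OF comm_group_Z2] subgroup_B2 by blast

lemma comm_group_H2: "comm_group (H2 n G T)"
  unfolding H2_def by (rule comm_group.abelian_FactGroup[OF comm_group_Z2 subgroup_B2])

lemma H2_one: "\<one>\<^bsub>H2 n G T\<^esub> = B2 n G T"
  by (simp add: H2_def)

lemma H2_class_hom: "H2_class n G T \<in> hom (Z2 n G T) (H2 n G T)"
  using normal.r_coset_hom_Mod[OF normal_B2] by (simp add: H2_class_def[abs_def] H2_def)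

lemma H2_class_mult:
  "f \<in> carrier (Z2 n G T) \<Longrightarrow> f' \<in> carrier (Z2 n G T) \<Longrightarrow>
    H2_class n G T (f \<otimes>\<^bsub>Z2 n G T\<^esub> f') = H2_class n G T f \<otimes>\<^bsub>H2 n G T\<^esub> H2_class n G T f'"
  using H2_class_hom by (auto simp: hom_def)

lemma H2_class_eqI:
  assumes f: "f \<in> carrier (Z2 n G T)" and f': "f' \<in> carrier (Z2 n G T)" and y: "locally_constant T y"
    and eq: "\<And>g h. g \<in> carrier G \<Longrightarrow> h \<in> carrier G \<Longrightarrow>
      (f (g, h) - f' (g, h)) mod int n = (y h - y (g \<otimes> h) + y g) mod int n"
  shows "H2_class n G T f = H2_class n G T f'"
proof -
  interpret Z: comm_group "Z2 n G T" by (rule comm_group_Z2)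
  let ?y = "\<lambda>x\<in>carrier G. y x mod int n"
  have y1: "?y \<in> C1" by (rule C1_restrict_mod[OF y])
  then have b: "coboundary n G ?y \<in> B2 n G T" by (auto simp: B2_iff)
  have bz: "coboundary n G ?y \<in> carrier (Z2 n G T)"
    using y1 by (simp add: coboundary_Z2 C1_iff)
  have "f = coboundary n G ?y \<otimes>\<^bsub>Z2 n G T\<^esub> f'"
  proof (rule Z2_eqI[OF f])
    show "coboundary n G ?y \<otimes>\<^bsub>Z2 n G T\<^esub> f' \<in> carrier (Z2 n G T)"
      using bz f' by (simp del: Z2_mult)
    fix g h assume gh: "g \<in> carrier G" "h \<in> carrier G"
    have "(coboundary n G ?y \<otimes>\<^bsub>Z2 n G T\<^esub> f') (g, h) mod int n = ((y h - y (g \<otimes> h) + y g) + f' (g, h)) mod int n"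
      using gh by (simp add: coboundary_apply mod_simps del: mod_diff_left_eq mod_diff_right_eq)
        (intro mod_congs; simp)
    also have "\<dots> = (f (g, h) - f' (g, h) + f' (g, h)) mod int n"
      using eq[OF gh] by (metis mod_add_left_eq)
    finally show "f (g, h) mod int n = (coboundary n G ?y \<otimes>\<^bsub>Z2 n G T\<^esub> f') (g, h) mod int n" by simp
  qed
  then have "f \<in> B2 n G T #>\<^bsub>Z2 n G T\<^esub> f'"
    using b unfolding r_coset_def by blast
  then show ?thesis
    unfolding H2_class_def by (rule Z.repr_independence[OF _ f' subgroup_B2, symmetric])
qed

text \<open>Congruences are easier to combine than equations between reduced representatives.\<close>

definition has_coboundary :: "('a \<Rightarrow> int) \<Rightarrow> ('a \<Rightarrow> 'a \<Rightarrow> int) \<Rightarrow> bool" where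
  "has_coboundary y f \<longleftrightarrow>
     (\<forall>g\<in>carrier G. \<forall>h\<in>carrier G. [y h - y (g \<otimes> h) + y g = f g h] (mod int n))"

lemma has_coboundaryI:
  "(\<And>g h. g \<in> carrier G \<Longrightarrow> h \<in> carrier G \<Longrightarrow> [y h - y (g \<otimes> h) + y g = f g h] (mod int n)) \<Longrightarrow>
    has_coboundary y f"
  by (simp add: has_coboundary_def)

lemma has_coboundaryD:
  "has_coboundary y f \<Longrightarrow> g \<in> carrier G \<Longrightarrow> h \<in> carrier G \<Longrightarrow>
    [y h - y (g \<otimes> h) + y g = f g h] (mod int n)"
  by (simp add: has_coboundary_def)

lemma has_coboundary_cong:
  assumes "has_coboundary y f"
    and "\<And>g h. g \<in> carrier G \<Longrightarrow> h \<in> carrier G \<Longrightarrow> [f g h = f' g h] (mod int n)"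
  shows "has_coboundary y f'"
  by (intro has_coboundaryI cong_trans[OF has_coboundaryD[OF assms(1)] assms(2)])

lemma C1_zero: "w \<in> C1 \<Longrightarrow> x \<in> carrier G \<Longrightarrow> [w x = 0] (mod int n) \<Longrightarrow> w x = 0"
  by (simp add: C1_iff cong_def)

lemma has_coboundary_lincomb:
  assumes u: "u \<in> C1" "has_coboundary u f" and v: "v \<in> C1" "has_coboundary v f'"
  obtains w where "w \<in> C1" and "has_coboundary w (\<lambda>g h. a * f g h + b * f' g h)"
    and "\<And>x. x \<in> carrier G \<Longrightarrow> [w x = a * u x + b * v x] (mod int n)"
proof
  let ?w = "\<lambda>g\<in>carrier G. (a * u g + b * v g) mod int n"
  have "locally_constant T (\<lambda>g. a * u g + b * v g)"
    using u(1) v(1)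
    by (intro locally_constant_comp2[where F = "\<lambda>r s. a * r + b * s"]) (simp_all add: C1_iff)
  then show "?w \<in> C1" by (rule C1_restrict_mod)
  show "[?w x = a * u x + b * v x] (mod int n)" if "x \<in> carrier G" for x
    using that by (simp add: cong_def)
  show "has_coboundary ?w (\<lambda>g h. a * f g h + b * f' g h)"
  proof (rule has_coboundaryI)
    fix g h assume gh: "g \<in> carrier G" "h \<in> carrier G"
    have "[?w h - ?w (g \<otimes> h) + ?w g = (a * u h + b * v h) - (a * u (g \<otimes> h) + b * v (g \<otimes> h)) +
        (a * u g + b * v g)] (mod int n)"
      by (intro cong_add cong_diff) (simp_all add: gh cong_def)
    also have "(a * u h + b * v h) - (a * u (g \<otimes> h) + b * v (g \<otimes> h)) + (a * u g + b * v g) =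
        a * (u h - u (g \<otimes> h) + u g) + b * (v h - v (g \<otimes> h) + v g)"
      by (simp add: algebra_simps)
    also have "[\<dots> = a * f g h + b * f' g h] (mod int n)"
      by (intro cong_add cong_mult cong_refl has_coboundaryD[OF u(2) gh] has_coboundaryD[OF v(2) gh])
    finally show "[?w h - ?w (g \<otimes> h) + ?w g = a * f g h + b * f' g h] (mod int n)" .
  qed
qed

lemma coboundary_eq_iff:
  assumes "f \<in> carrier (Z2 n G T)"
  shows "f = coboundary n G y \<longleftrightarrow> has_coboundary y (\<lambda>g h. f (g, h))" (is "?l \<longleftrightarrow> ?r")
proof
  assume ?l
  then show ?r by (simp add: has_coboundary_def coboundary_apply cong_def)
next
  assume r: ?r
  show ?l
  proof (rule extensionalityI)
    show "f \<in> extensional (carrier G \<times> carrier G)" using assms by (simp add: Z2_iff)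
    show "coboundary n G y \<in> extensional (carrier G \<times> carrier G)" by (simp add: coboundary_def)
    fix z assume "z \<in> carrier G \<times> carrier G"
    then show "f z = coboundary n G y z"
      using r assms by (auto simp: has_coboundary_def coboundary_apply cong_def Z2_iff)
  qed
qed

lemma H2_class_eq_one_iff:
  assumes f: "f \<in> carrier (Z2 n G T)"
  shows "H2_class n G T f = \<one>\<^bsub>H2 n G T\<^esub> \<longleftrightarrow> (\<exists>y\<in>C1. has_coboundary y (\<lambda>g h. f (g, h)))"
proof -
  interpret Z: comm_group "Z2 n G T" by (rule comm_group_Z2)
  have "H2_class n G T f = \<one>\<^bsub>H2 n G T\<^esub> \<longleftrightarrow> f \<in> B2 n G T"
    using Z.coset_join1[OF _ f subgroup_B2] Z.coset_join2[OF f subgroup_B2]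
    unfolding H2_class_def H2_one by blast
  also have "\<dots> \<longleftrightarrow> (\<exists>y\<in>C1. has_coboundary y (\<lambda>g h. f (g, h)))"
    unfolding B2_iff coboundary_eq_iff[OF f] by (rule refl)
  finally show ?thesis .
qed

lemma H1_of_zero_coboundary:
  assumes "y \<in> C1" and "has_coboundary y (\<lambda>g h. 0)"
  shows "y \<in> X"
  unfolding H1_iff
proof (intro conjI ballI assms(1))
  fix g h assume gh: "g \<in> carrier G" "h \<in> carrier G"
  have "[y h - y (g \<otimes> h) + y g + y (g \<otimes> h) = 0 + y (g \<otimes> h)] (mod int n)"
    by (intro cong_add cong_refl has_coboundaryD[OF assms(2) gh])
  then have "(y g + y h) mod int n = y (g \<otimes> h) mod int n"
    by (simp add: cong_def algebra_simps)
  then show "y (g \<otimes> h) = (y g + y h) mod int n" using assms(1) gh by (simp add: C1_iff)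
qed

end

section \<open>Cup products and Bocksteins on cochains\<close>

definition cup_cochain ::
  "nat \<Rightarrow> ('a, 'm) monoid_scheme \<Rightarrow> ('a \<Rightarrow> int) \<Rightarrow> ('a \<Rightarrow> int) \<Rightarrow> 'a \<times> 'a \<Rightarrow> int" where
  "cup_cochain n G \<psi> \<psi>' = (\<lambda>(g, h)\<in>carrier G \<times> carrier G. (\<psi> g * \<psi>' h) mod int n)"

text \<open>The cocycle of the extension of \<open>\<int>/n\<close> by \<open>\<int>/n\<close> with total group \<open>\<int>/n\<^sup>2\<close>, pulled back
  along \<open>\<psi>\<close>.\<close>

definition carry_cochain ::
  "nat \<Rightarrow> ('a, 'm) monoid_scheme \<Rightarrow> ('a \<Rightarrow> int) \<Rightarrow> 'a \<times> 'a \<Rightarrow> int" where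
  "carry_cochain n G \<psi> = (\<lambda>(g, h)\<in>carrier G \<times> carrier G. (\<psi> g + \<psi> h) div int n)"

text \<open>The cocycle whose class is the value of \<open>\<Lambda>\<close> at the element of simple type given by \<open>\<psi>\<close> and
  \<open>\<psi>'\<close>.\<close>

definition simple_cochain ::
  "nat \<Rightarrow> ('a, 'm) monoid_scheme \<Rightarrow> ('a \<Rightarrow> int) \<Rightarrow> ('a \<Rightarrow> int) \<Rightarrow> 'a \<times> 'a \<Rightarrow> int" where
  "simple_cochain n G \<psi> \<psi>' = (\<lambda>(g, h)\<in>carrier G \<times> carrier G.
     (\<psi> g * \<psi>' h + (if n = 2 then 0 else (\<psi> g + \<psi> h) div int n)) mod int n)"

context coefficient_setting
begin

lemma cup_cochain_Z2:
  assumes "\<psi> \<in> X" and "\<psi>' \<in> X"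
  shows "cup_cochain n G \<psi> \<psi>' \<in> carrier (Z2 n G T)"
  unfolding cup_cochain_def
proof (rule Z2_restrict_mod)
  show "locally_constant (prod_topology T T) (\<lambda>z. \<psi> (fst z) * \<psi>' (snd z))"
    by (rule locally_constant_comp2[where F = "(*)"])
      (simp_all add: assms H1_locally_constant locally_constant_fst locally_constant_snd)
  fix g h k assume ghk: "g \<in> carrier G" "h \<in> carrier G" "k \<in> carrier G"
  have "(\<psi> h * \<psi>' k - \<psi> (g \<otimes> h) * \<psi>' k + \<psi> g * \<psi>' (h \<otimes> k) - \<psi> g * \<psi>' h) mod int n =
      (\<psi> h * \<psi>' k - (\<psi> g + \<psi> h) * \<psi>' k + \<psi> g * (\<psi>' h + \<psi>' k) - \<psi> g * \<psi>' h) mod int n"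
    by (intro mod_congs) (simp_all add: ghk assms H1_hom)
  then show "(\<psi> h * \<psi>' k - \<psi> (g \<otimes> h) * \<psi>' k + \<psi> g * \<psi>' (h \<otimes> k) - \<psi> g * \<psi>' h) mod int n = 0"
    by (simp add: algebra_simps)
qed

text \<open>Multiplied by \<open>n\<close> the carry becomes an integral coboundary, whence the cocycle identity.\<close>

lemma carry_identity:
  assumes "\<psi> \<in> X" and "g \<in> carrier G" and "h \<in> carrier G"
  shows "int n * ((\<psi> g + \<psi> h) div int n) = \<psi> h - \<psi> (g \<otimes> h) + \<psi> g"
  unfolding H1_hom[OF assms] using minus_mod_eq_mult_div[of "\<psi> g + \<psi> h" "int n"] by linarith

lemma carry_range:
  assumes "\<psi> \<in> X" and "g \<in> carrier G" and "h \<in> carrier G"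
  shows "0 \<le> (\<psi> g + \<psi> h) div int n" and "(\<psi> g + \<psi> h) div int n < int n"
proof -
  note r = H1_range[OF assms(1,2)] H1_range[OF assms(1,3)]
  then show "0 \<le> (\<psi> g + \<psi> h) div int n"
    using n_pos by (simp add: pos_imp_zdiv_nonneg_iff)
  show "(\<psi> g + \<psi> h) div int n < int n"
  proof (cases "n = 1")
    case True
    then show ?thesis using r by simp
  next
    case False
    then have "int n * 2 \<le> int n * int n" using n_pos by (intro mult_left_mono) auto
    moreover have "int n * ((\<psi> g + \<psi> h) div int n) \<le> \<psi> g + \<psi> h"
      using minus_mod_eq_mult_div[of "\<psi> g + \<psi> h" "int n"] n_pos
        pos_mod_sign[of "int n" "\<psi> g + \<psi> h"] by linarith
    ultimately have "int n * ((\<psi> g + \<psi> h) div int n) < int n * int n" using r by linarith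
    then show ?thesis
      using n_pos by (simp only: mult_less_cancel_left_pos of_nat_0_less_iff)
  qed
qed

lemma carry_cochain_Z2:
  assumes "\<psi> \<in> X"
  shows "carry_cochain n G \<psi> \<in> carrier (Z2 n G T)"
proof -
  have "(\<lambda>(g, h)\<in>carrier G \<times> carrier G. ((\<psi> g + \<psi> h) div int n) mod int n) \<in> carrier (Z2 n G T)"
  proof (rule Z2_restrict_mod)
    show "locally_constant (prod_topology T T) (\<lambda>z. (\<psi> (fst z) + \<psi> (snd z)) div int n)"
      by (rule locally_constant_comp2[where F = "\<lambda>u v. (u + v) div int n"])
        (simp_all add: assms H1_locally_constant locally_constant_fst locally_constant_snd)
    fix g h k assume ghk: "g \<in> carrier G" "h \<in> carrier G" "k \<in> carrier G"
    let ?c = "\<lambda>g h. (\<psi> g + \<psi> h) div int n"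
    have "int n * (?c h k - ?c (g \<otimes> h) k + ?c g (h \<otimes> k) - ?c g h) = 0"
      using ghk by (simp add: right_diff_distrib distrib_left carry_identity[OF assms] m_assoc)
    then show "(?c h k - ?c (g \<otimes> h) k + ?c g (h \<otimes> k) - ?c g h) mod int n = 0"
      using n_pos by simp
  qed
  moreover have "(\<lambda>(g, h)\<in>carrier G \<times> carrier G. ((\<psi> g + \<psi> h) div int n) mod int n) =
      carry_cochain n G \<psi>"
    unfolding carry_cochain_def
    by (rule restrict_ext) (auto simp: carry_range[OF assms])
  ultimately show ?thesis by simp
qed

lemma cup_eq: "cup n G T \<psi> \<psi>' = H2_class n G T (cup_cochain n G \<psi> \<psi>')"
  by (simp add: cup_def cup_cochain_def)

text \<open>The obvious lift of \<open>\<psi>\<close> to \<open>\<int>/q\<^sup>2\<close> has the carry as its coboundary divided by \<open>q\<close>;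
  two lifts differ by \<open>q\<close> times a cochain, hence give cohomologous cocycles.\<close>

lemma bockstein_eq:
  assumes \<psi>: "\<psi> \<in> X"
  shows "bockstein n G T \<psi> = H2_class n G T (carry_cochain n G \<psi>)"
  unfolding bockstein_def
proof (rule the_equality)
  have n2: "n\<^sup>2 > 0" using n_pos by simp
  have nn: "int (n\<^sup>2) = int n * int n" by (simp add: power2_eq_square)
  have "int n * 1 \<le> int n * int n" using n_pos by (intro mult_left_mono) auto
  then have "0 \<le> \<psi> g \<and> \<psi> g < int (n\<^sup>2)" if "g \<in> carrier G" for g
    using H1_range[OF \<psi> that] unfolding nn by linarith
  then have "\<psi> \<in> carrier (cont_fun_group (n\<^sup>2) T)"
    using \<psi> unfolding H1_iff C1_iff cont_fun_group_carrier_iff[OF n2] topspace_eq by blast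
  moreover have "coboundary (n\<^sup>2) G \<psi> (g, h) = int n * carry_cochain n G \<psi> (g, h)"
    if gh: "g \<in> carrier G" "h \<in> carrier G" for g h
  proof -
    let ?c = "(\<psi> g + \<psi> h) div int n"
    have "0 \<le> int n * ?c" "int n * ?c < int n * int n"
      using carry_range[OF \<psi> gh] n_pos by auto
    then have mod: "(int n * ?c) mod (int n * int n) = int n * ?c" by (rule mod_pos_pos_trivial)
    have "coboundary (n\<^sup>2) G \<psi> (g, h) = (int n * ?c) mod (int n * int n)"
      unfolding carry_identity[OF \<psi> gh] using gh by (simp add: coboundary_def power2_eq_square)
    then show ?thesis
      using gh by (simp add: mod carry_cochain_def)
  qed
  ultimately show "\<exists>y\<in>carrier (cont_fun_group (n\<^sup>2) T). \<exists>f\<in>carrier (Z2 n G T).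
        (\<forall>g\<in>carrier G. y g mod int n = \<psi> g) \<and>
        (\<forall>g\<in>carrier G. \<forall>h\<in>carrier G. coboundary (n\<^sup>2) G y (g, h) = int n * f (g, h)) \<and>
        H2_class n G T (carry_cochain n G \<psi>) = H2_class n G T f"
    using carry_cochain_Z2[OF \<psi>] \<psi> by (intro bexI[of _ \<psi>] bexI[of _ "carry_cochain n G \<psi>"]) auto
  fix c
  assume "\<exists>y\<in>carrier (cont_fun_group (n\<^sup>2) T). \<exists>f\<in>carrier (Z2 n G T).
        (\<forall>g\<in>carrier G. y g mod int n = \<psi> g) \<and>
        (\<forall>g\<in>carrier G. \<forall>h\<in>carrier G. coboundary (n\<^sup>2) G y (g, h) = int n * f (g, h)) \<and>
        c = H2_class n G T f"
  then obtain y f where y: "y \<in> carrier (cont_fun_group (n\<^sup>2) T)" and f: "f \<in> carrier (Z2 n G T)"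
    and lift: "\<And>g. g \<in> carrier G \<Longrightarrow> y g mod int n = \<psi> g"
    and cob: "\<And>g h. g \<in> carrier G \<Longrightarrow> h \<in> carrier G \<Longrightarrow>
      coboundary (n\<^sup>2) G y (g, h) = int n * f (g, h)"
    and c: "c = H2_class n G T f"
    by blast
  define z where "z = (\<lambda>g. y g div int n)"
  have "H2_class n G T f = H2_class n G T (carry_cochain n G \<psi>)"
  proof (rule H2_class_eqI[OF f carry_cochain_Z2[OF \<psi>]])
    show "locally_constant T z"
      unfolding z_def using y cont_fun_group_carrier_iff[OF n2, of y T]
      by (intro locally_constant_comp[where F = "\<lambda>u. u div int n"]) simp
    fix g h assume gh: "g \<in> carrier G" "h \<in> carrier G"
    have yz: "y x = \<psi> x + int n * z x" if "x \<in> carrier G" for x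
      using lift[OF that] mult_div_mod_eq[of "int n" "y x"] by (simp add: z_def)
    let ?c = "(\<psi> g + \<psi> h) div int n"
    have "y h - y (g \<otimes> h) + y g = int n * (?c + (z h - z (g \<otimes> h) + z g))"
      using gh yz carry_identity[OF \<psi> gh] by (simp add: algebra_simps)
    moreover have "(y h - y (g \<otimes> h) + y g) mod (int n * int n) = int n * f (g, h)"
      using cob[OF gh] gh by (simp add: coboundary_def power2_eq_square)
    ultimately have "int n * ((?c + (z h - z (g \<otimes> h) + z g)) mod int n) = int n * f (g, h)"
      by (simp only: mult_mod_right)
    then have "f (g, h) = (?c + (z h - z (g \<otimes> h) + z g)) mod int n"
      using n_pos by simp
    then show "(f (g, h) - carry_cochain n G \<psi> (g, h)) mod int n = (z h - z (g \<otimes> h) + z g) mod int n"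
      using gh by (simp add: carry_cochain_def mod_simps)
  qed
  then show "c = H2_class n G T (carry_cochain n G \<psi>)" by (simp add: c)
qed

text \<open>Already on cochains the cup product is bilinear, so it factors through the tensor product
  before one passes to cohomology.\<close>

definition tensor_cochain :: "(('a \<Rightarrow> int) \<times> ('a \<Rightarrow> int) \<Rightarrow>\<^sub>0 int) set \<Rightarrow> 'a \<times> 'a \<Rightarrow> int" where
  "tensor_cochain = tensor_lift (H1 n G T) (H1 n G T) (Z2 n G T) (cup_cochain n G)"

lemma tensor_cochain:
  shows tensor_cochain_hom: "tensor_cochain \<in> hom (H1_tensor_H1 n G T) (Z2 n G T)"
    and tensor_cochain_pure: "\<And>\<psi> \<psi>'. \<psi> \<in> X \<Longrightarrow> \<psi>' \<in> X \<Longrightarrow>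
      tensor_cochain (pure_tensor (H1 n G T) (H1 n G T) \<psi> \<psi>') = cup_cochain n G \<psi> \<psi>'"
    and cup_hom_eq: "\<And>t. t \<in> carrier (H1_tensor_H1 n G T) \<Longrightarrow>
      cup_hom n G T t = H2_class n G T (tensor_cochain t)"
proof -
  interpret Z: comm_group "Z2 n G T" by (rule comm_group_Z2)
  interpret H: comm_group "H2 n G T" by (rule comm_group_H2)
  interpret Te: comm_group "H1_tensor_H1 n G T" by (rule comm_group_tensor[OF group_H1 group_H1])
  have left: "cup_cochain n G (a \<otimes>\<^bsub>H1 n G T\<^esub> a') b =
      cup_cochain n G a b \<otimes>\<^bsub>Z2 n G T\<^esub> cup_cochain n G a' b" for a a' b
    by (auto simp: cup_cochain_def restrict_def fun_eq_iff mod_simps algebra_simps)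
  have right: "cup_cochain n G a (b \<otimes>\<^bsub>H1 n G T\<^esub> b') =
      cup_cochain n G a b \<otimes>\<^bsub>Z2 n G T\<^esub> cup_cochain n G a b'" for a b b'
    by (auto simp: cup_cochain_def restrict_def fun_eq_iff mod_simps algebra_simps)
  obtain \<kappa> where \<kappa>: "\<kappa> \<in> hom (H1_tensor_H1 n G T) (Z2 n G T)"
    and pure: "\<And>\<psi> \<psi>'. \<psi> \<in> X \<Longrightarrow> \<psi>' \<in> X \<Longrightarrow>
      \<kappa> (pure_tensor (H1 n G T) (H1 n G T) \<psi> \<psi>') = cup_cochain n G \<psi> \<psi>'"
    by (rule hom_tensor_exists[where f = "cup_cochain n G",
          OF group_H1 group_H1 comm_group_Z2 cup_cochain_Z2 left right]) (assumption | rule that)+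
  have eq: "tensor_cochain t = \<kappa> t" if "t \<in> carrier (H1_tensor_H1 n G T)" for t
    unfolding tensor_cochain_def
    by (intro tensor_lift_eq group_H1 Z.is_group \<kappa> that) (simp add: pure)
  show hom: "tensor_cochain \<in> hom (H1_tensor_H1 n G T) (Z2 n G T)"
    using \<kappa> by (auto simp: hom_def Pi_iff eq simp del: Z2_mult)
  show pure': "tensor_cochain (pure_tensor (H1 n G T) (H1 n G T) \<psi> \<psi>') = cup_cochain n G \<psi> \<psi>'"
    if "\<psi> \<in> X" "\<psi>' \<in> X" for \<psi> \<psi>'
    using that by (simp add: eq pure pure_tensor_closed)
  have "(\<lambda>t. H2_class n G T (tensor_cochain t)) \<in> hom (H1_tensor_H1 n G T) (H2 n G T)"
    using hom H2_class_hom by (auto simp: hom_def Pi_iff simp del: Z2_mult)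
  then show "cup_hom n G T t = H2_class n G T (tensor_cochain t)"
    if "t \<in> carrier (H1_tensor_H1 n G T)" for t
    unfolding cup_hom_def
    by (intro tensor_lift_eq group_H1 H.is_group that) (simp_all add: pure' cup_eq)
qed

lemma simple_cochain_eq:
  "simple_cochain n G \<psi> \<psi>' =
    (if n = 2 then cup_cochain n G \<psi> \<psi>'
     else cup_cochain n G \<psi> \<psi>' \<otimes>\<^bsub>Z2 n G T\<^esub> carry_cochain n G \<psi>)"
  by (auto simp: simple_cochain_def cup_cochain_def carry_cochain_def restrict_def fun_eq_iff mod_simps)

lemma simple_cochain_Z2:
  assumes "\<psi> \<in> X" and "\<psi>' \<in> X"
  shows "simple_cochain n G \<psi> \<psi>' \<in> carrier (Z2 n G T)"
proof -
  interpret Z: comm_group "Z2 n G T" by (rule comm_group_Z2)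
  show ?thesis
    unfolding simple_cochain_eq
    using cup_cochain_Z2[OF assms] carry_cochain_Z2[OF assms(1)] Z.m_closed by presburger
qed

lemma Lambda_simple_elt:
  assumes "\<psi> \<in> X" and "\<psi>' \<in> X"
  shows "Lambda n G T (simple_elt n G T \<psi> \<psi>') = H2_class n G T (simple_cochain n G \<psi> \<psi>')"
proof -
  have "cup_hom n G T (pure_tensor (H1 n G T) (H1 n G T) \<psi> \<psi>') =
      H2_class n G T (cup_cochain n G \<psi> \<psi>')"
    using assms by (simp add: cup_hom_eq tensor_cochain_pure pure_tensor_closed)
  then show ?thesis
    unfolding Lambda_def simple_elt_def simple_cochain_eq using assms
    by (cases "n = 2") (simp_all add: bockstein_eq H2_class_mult cup_cochain_Z2 carry_cochain_Z2
        del: Z2_mult)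
qed

lemma simple_elt_Omega:
  assumes "\<psi> \<in> X" and "\<psi>' \<in> X"
  shows "simple_elt n G T \<psi> \<psi>' \<in> Omega n G T"
  using assms by (cases "n = 2") (simp_all add: simple_elt_def Omega_def pure_tensor_closed)


section \<open>Transgression and distinguished subgroups\<close>

text \<open>The function on cosets induced by \<open>u\<close>, provided that \<open>u\<close> is constant on them.\<close>

definition coset_value :: "('a \<Rightarrow> 'v) \<Rightarrow> 'a set \<Rightarrow> 'v" where
  "coset_value u C = u (SOME g. g \<in> C)"

lemma coset_value:
  assumes M: "M \<lhd> G" and g: "g \<in> carrier G"
    and inv: "\<And>m g. m \<in> M \<Longrightarrow> g \<in> carrier G \<Longrightarrow> u (m \<otimes> g) = u g"
  shows "coset_value u (M #> g) = u g"
proof -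
  interpret M: normal M G by fact
  have "g \<in> M #> g" by (rule rcos_self[OF g M.subgroup_axioms])
  then have "(SOME x. x \<in> M #> g) \<in> M #> g" by (rule someI[of "\<lambda>x. x \<in> M #> g"])
  then obtain m where "m \<in> M" "(SOME x. x \<in> M #> g) = m \<otimes> g"
    unfolding r_coset_def by auto
  then show ?thesis
    using inv[OF _ g] by (simp add: coset_value_def)
qed

lemma coefficient_setting_quotient:
  assumes "M \<lhd> G"
  shows "coefficient_setting (G Mod M) (quotient_topology G M) n"
proof -
  interpret M: normal M G by fact
  interpret Q: group "G Mod M" by (rule M.factorgroup_is_group)
  have prod: "prod_topology (quotient_topology G M) (quotient_topology G M) =
      discrete_topology (carrier (G Mod M) \<times> carrier (G Mod M))"
    by (rule prod_topology_discrete_topology[symmetric])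
  show ?thesis
  proof
    show "continuous_map (prod_topology (quotient_topology G M) (quotient_topology G M))
        (quotient_topology G M) (\<lambda>(x, y). x \<otimes>\<^bsub>G Mod M\<^esub> y)"
      unfolding prod continuous_map_from_discrete_topology
      using Q.m_closed by (auto simp del: mult_FactGroup)
    show "continuous_map (quotient_topology G M) (quotient_topology G M) (\<lambda>x. inv\<^bsub>G Mod M\<^esub> x)"
      unfolding continuous_map_from_discrete_topology using Q.inv_closed by auto
  qed (simp_all add: n_pos)
qed

text \<open>Two choices of a cochain and a cocycle for the same \<open>\<phi>\<close> differ by a cochain that vanishes on
  \<open>M\<close> and is constant on the cosets of \<open>M\<close>, hence by a coboundary of \<open>G/M\<close>.\<close>

lemma transgression_eq:
  assumes M: "M \<lhd> G" and y: "y \<in> C1"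
    and f: "f \<in> carrier (Z2 n (G Mod M) (quotient_topology G M))"
    and ext: "\<And>m. m \<in> M \<Longrightarrow> y m = \<phi> m"
    and cob: "\<And>g h. g \<in> carrier G \<Longrightarrow> h \<in> carrier G \<Longrightarrow>
      coboundary n G y (g, h) = f (M #> g, M #> h)"
  shows "transgression n G T M \<phi> = H2_class n (G Mod M) (quotient_topology G M) f"
  unfolding transgression_def
proof (rule the_equality)
  show "\<exists>y\<in>C1. \<exists>f'\<in>carrier (Z2 n (G Mod M) (quotient_topology G M)).
        (\<forall>m\<in>M. y m = \<phi> m) \<and>
        (\<forall>g\<in>carrier G. \<forall>h\<in>carrier G. coboundary n G y (g, h) = f' (M #>\<^bsub>G\<^esub> g, M #>\<^bsub>G\<^esub> h)) \<and>
        H2_class n (G Mod M) (quotient_topology G M) f =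
        H2_class n (G Mod M) (quotient_topology G M) f'"
    using assms by blast
  fix c
  assume "\<exists>y\<in>C1. \<exists>f'\<in>carrier (Z2 n (G Mod M) (quotient_topology G M)).
        (\<forall>m\<in>M. y m = \<phi> m) \<and>
        (\<forall>g\<in>carrier G. \<forall>h\<in>carrier G. coboundary n G y (g, h) = f' (M #>\<^bsub>G\<^esub> g, M #>\<^bsub>G\<^esub> h)) \<and>
        c = H2_class n (G Mod M) (quotient_topology G M) f'"
  then obtain y' f' where y': "y' \<in> C1"
    and f': "f' \<in> carrier (Z2 n (G Mod M) (quotient_topology G M))"
    and ext': "\<And>m. m \<in> M \<Longrightarrow> y' m = \<phi> m"
    and cob': "\<And>g h. g \<in> carrier G \<Longrightarrow> h \<in> carrier G \<Longrightarrow>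
      coboundary n G y' (g, h) = f' (M #> g, M #> h)"
    and c: "c = H2_class n (G Mod M) (quotient_topology G M) f'"
    by blast
  interpret M: normal M G by fact
  interpret Q: coefficient_setting "G Mod M" "quotient_topology G M" n
    by (rule coefficient_setting_quotient[OF M])
  have coset_closed: "M #> g \<in> carrier (G Mod M)" if "g \<in> carrier G" for g
    using that by (auto simp: carrier_FactGroup)
  have coset_mult: "(M #> g) \<otimes>\<^bsub>G Mod M\<^esub> (M #> h) = M #> (g \<otimes> h)"
    if "g \<in> carrier G" "h \<in> carrier G" for g h
    using that by (simp add: M.rcos_sum)
  define z where "z = (\<lambda>g. (y' g - y g) mod int n)"
  have z0: "z m = 0" if "m \<in> M" for m using that by (simp add: z_def ext ext')
  have dz: "(z h - z (g \<otimes> h) + z g) mod int n = (f' (M #> g, M #> h) - f (M #> g, M #> h)) mod int n"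
    if "g \<in> carrier G" "h \<in> carrier G" for g h
  proof -
    have "(z h - z (g \<otimes> h) + z g) mod int n =
        ((y' h - y h) - (y' (g \<otimes> h) - y (g \<otimes> h)) + (y' g - y g)) mod int n"
      unfolding z_def by (intro mod_congs) simp_all
    also have "\<dots> = ((y' h - y' (g \<otimes> h) + y' g) - (y h - y (g \<otimes> h) + y g)) mod int n"
      by (simp add: algebra_simps)
    also have "\<dots> = (coboundary n G y' (g, h) - coboundary n G y (g, h)) mod int n"
      using that by (simp add: coboundary_apply mod_simps)
    finally show ?thesis using that by (simp add: cob cob')
  qed
  \<comment> \<open>A cocycle \<open>F\<close> satisfies \<open>F(1, D) = F(1, 1)\<close>, and the coboundary of \<open>z\<close> vanishes at
    \<open>(1, 1)\<close>; hence \<open>z\<close> is constant on the cosets of \<open>M\<close>.\<close>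
  have first: "F (M, M #> g) mod int n = F (M, M) mod int n"
    if "F \<in> carrier (Z2 n (G Mod M) (quotient_topology G M))" "g \<in> carrier G" for F g
  proof -
    have "(F (M, M #> g) - F (M \<otimes>\<^bsub>G Mod M\<^esub> M, M #> g) + F (M, M \<otimes>\<^bsub>G Mod M\<^esub> (M #> g)) - F (M, M))
        mod int n = 0"
      using that(1) Q.one_closed coset_closed[OF that(2)] unfolding Q.Z2_iff one_FactGroup by blast
    moreover have "M \<otimes>\<^bsub>G Mod M\<^esub> M = M" "M \<otimes>\<^bsub>G Mod M\<^esub> (M #> g) = M #> g"
      using Q.l_one[OF Q.one_closed] Q.l_one[OF coset_closed[OF that(2)]] by simp_all
    ultimately show ?thesis by (simp add: mod_eq_dvd_iff dvd_eq_mod_eq_0)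
  qed
  have coset_M: "M #> m = M" if "m \<in> M" for m
    using that M.rcos_const[OF is_group] by simp
  have z_const: "z (m \<otimes> g) = z g" if m: "m \<in> M" and g: "g \<in> carrier G" for m g
  proof -
    have "m \<in> carrier G" using m M.subset by blast
    have "(f' (M, M #> g) - f (M, M #> g)) mod int n = (f' (M, M) - f (M, M)) mod int n"
      by (intro mod_congs first f f' g)
    also have "\<dots> = (z \<one> - z (\<one> \<otimes> \<one>) + z \<one>) mod int n"
      using dz[OF one_closed one_closed] coset_M[OF M.one_closed] by simp
    also have "\<dots> = 0" using z0[OF M.one_closed] by simp
    finally have "(z g - z (m \<otimes> g) + z m) mod int n = 0"
      using dz[OF \<open>m \<in> carrier G\<close> g] by (simp add: coset_M[OF m])
    then have "z g mod int n = z (m \<otimes> g) mod int n"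
      using z0[OF m] by (simp add: mod_eq_dvd_iff dvd_eq_mod_eq_0)
    then show ?thesis by (simp add: z_def)
  qed
  have "H2_class n (G Mod M) (quotient_topology G M) f' =
      H2_class n (G Mod M) (quotient_topology G M) f"
  proof (rule Q.H2_class_eqI[OF f' f, of "coset_value z"])
    fix C D assume "C \<in> carrier (G Mod M)" "D \<in> carrier (G Mod M)"
    then obtain g h where gh: "g \<in> carrier G" "h \<in> carrier G" "C = M #> g" "D = M #> h"
      by (auto simp: carrier_FactGroup)
    then show "(f' (C, D) - f (C, D)) mod int n =
        (coset_value z D - coset_value z (C \<otimes>\<^bsub>G Mod M\<^esub> D) + coset_value z C) mod int n"
      using dz[OF gh(1,2)] coset_mult[OF gh(1,2)]
      by (simp add: coset_value[OF M _ z_const] del: mult_FactGroup)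
  qed simp
  then show "c = H2_class n (G Mod M) (quotient_topology G M) f" by (simp add: c)
qed

lemma kernel_H1: "kernel G (integer_mod_group n) \<psi> = {g \<in> carrier G. \<psi> g = 0}"
  by (simp add: kernel_def)

lemma common_kernel_normal:
  assumes "\<psi> \<in> X" and "\<psi>' \<in> X"
  shows "{g \<in> carrier G. \<psi> g = 0 \<and> \<psi>' g = 0} \<lhd> G"
proof (rule normal_invI)
  show "subgroup {g \<in> carrier G. \<psi> g = 0 \<and> \<psi>' g = 0} G"
    by (rule subgroupI) (use assms in \<open>auto simp: H1_hom H1_inv intro!: exI[of _ \<one>]\<close>)
  fix x h assume xh: "x \<in> carrier G" "h \<in> {g \<in> carrier G. \<psi> g = 0 \<and> \<psi>' g = 0}"
  have "\<theta> (x \<otimes> h \<otimes> inv x) = 0" if "\<theta> \<in> X" "\<theta> h = 0" for \<theta>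
    using xh that by (simp add: H1_hom H1_inv mod_simps)
  then show "x \<otimes> h \<otimes> inv x \<in> {g \<in> carrier G. \<psi> g = 0 \<and> \<psi>' g = 0}"
    using xh assms by simp
qed

text \<open>A cochain \<open>y\<close> whose coboundary is the cocycle attached to an element of simple type restricts
  on the kernel \<open>M\<close> of that element to an invariant homomorphism, the transgression of which is the
  class of the same cocycle on \<open>G/M\<close>.\<close>

lemma distinguished_of_simple_coboundary:
  assumes \<psi>: "\<psi> \<in> X" and \<psi>': "\<psi>' \<in> X" and y: "y \<in> C1"
    and cob: "coboundary n G y = simple_cochain n G \<psi> \<psi>'"
  shows "distinguished n G T {m \<in> carrier G. \<psi> m = 0 \<and> \<psi>' m = 0 \<and> y m = 0}"
proof -
  define M where "M = {g \<in> carrier G. \<psi> g = 0 \<and> \<psi>' g = 0}"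
  have M: "M \<lhd> G" unfolding M_def by (rule common_kernel_normal[OF \<psi> \<psi>'])
  have M_open: "openin T M"
    using locally_constant_openin[OF locally_constant_comp2[of T \<psi> \<psi>' Pair], of "\<lambda>u. u = (0, 0)"]
    by (simp add: H1_locally_constant \<psi> \<psi>' M_def topspace_eq)
  have eq: "{m \<in> carrier G. \<psi> m = 0 \<and> \<psi>' m = 0 \<and> y m = 0} =
      kernel (G\<lparr>carrier := M\<rparr>) (integer_mod_group n) (restrict y M)"
    by (auto simp: kernel_def M_def)
  have M_I: "g \<in> M" if "g \<in> carrier G" "\<psi> g = 0" "\<psi>' g = 0" for g
    using that by (simp add: M_def)
  interpret M: normal M G by (rule M)
  have M_carrier: "m \<in> carrier G" and M_zero: "\<psi> m = 0" "\<psi>' m = 0" if "m \<in> M" for m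
    using that unfolding M_def by simp_all
  interpret Q: coefficient_setting "G Mod M" "quotient_topology G M" n
    by (rule coefficient_setting_quotient[OF M])
  have coset_mult: "(M #> g) \<otimes>\<^bsub>G Mod M\<^esub> (M #> h) = M #> (g \<otimes> h)"
    if "g \<in> carrier G" "h \<in> carrier G" for g h
    using that by (simp add: M.rcos_sum)
  have coset_closed: "M #> g \<in> carrier (G Mod M)" if "g \<in> carrier G" for g
    using that by (auto simp: carrier_FactGroup)
  let ?bar = "\<lambda>\<theta>. \<lambda>C\<in>carrier (G Mod M). coset_value \<theta> C"
  have bar: "?bar \<theta> (M #> g) = \<theta> g" if "\<theta> \<in> {\<psi>, \<psi>'}" "g \<in> carrier G" for \<theta> g
  proof -
    have "\<theta> (m \<otimes> g) = \<theta> g" if "m \<in> M" "g \<in> carrier G" for m g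
      using that \<open>\<theta> \<in> {\<psi>, \<psi>'}\<close> M_carrier[OF that(1)] M_zero[OF that(1)] \<psi> \<psi>' by (auto simp: H1_hom)
    then show ?thesis
      using that(2) coset_closed by (simp add: coset_value[OF M])
  qed
  have bar_H1: "?bar \<theta> \<in> Q.X" if "\<theta> \<in> {\<psi>, \<psi>'}" for \<theta>
    unfolding Q.H1_iff Q.C1_iff
  proof (intro conjI ballI)
    have \<theta>: "\<theta> \<in> X" using that \<psi> \<psi>' by auto
    fix C assume "C \<in> carrier (G Mod M)"
    then obtain g where g: "g \<in> carrier G" "C = M #> g" by (auto simp: carrier_FactGroup)
    then show "0 \<le> ?bar \<theta> C" "?bar \<theta> C < int n"
      using bar[OF that g(1)] H1_range[OF \<theta> g(1)] by auto
    fix D assume "D \<in> carrier (G Mod M)"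
    then obtain h where h: "h \<in> carrier G" "D = M #> h" by (auto simp: carrier_FactGroup)
    show "?bar \<theta> (C \<otimes>\<^bsub>G Mod M\<^esub> D) = (?bar \<theta> C + ?bar \<theta> D) mod int n"
      unfolding g(2) h(2) coset_mult[OF g(1) h(1)]
      using bar[OF that] g(1) h(1) H1_hom[OF \<theta>] by simp
  qed (simp_all only: restrict_extensional locally_constant_discrete)
  let ?f = "simple_cochain n (G Mod M) (?bar \<psi>) (?bar \<psi>')"
  let ?\<alpha> = "simple_elt n (G Mod M) (quotient_topology G M) (?bar \<psi>) (?bar \<psi>')"
  have bar_\<psi>: "?bar \<psi> \<in> Q.X" and bar_\<psi>': "?bar \<psi>' \<in> Q.X"
    by (rule bar_H1, simp)+
  have f: "?f \<in> carrier (Z2 n (G Mod M) (quotient_topology G M))"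
    by (rule Q.simple_cochain_Z2[OF bar_\<psi> bar_\<psi>'])
  have cob_f: "coboundary n G y (g, h) = ?f (M #> g, M #> h)"
    if "g \<in> carrier G" "h \<in> carrier G" for g h
    using that coset_closed bar[of \<psi>] bar[of \<psi>'] unfolding cob by (simp add: simple_cochain_def)
  have y_add: "(y h - y (g \<otimes> h) + y g) mod int n = 0"
    if "g \<in> carrier G" "h \<in> carrier G" "g \<in> M \<or> h \<in> M" for g h
  proof -
    have "(y h - y (g \<otimes> h) + y g) mod int n = simple_cochain n G \<psi> \<psi>' (g, h)"
      using that(1,2) by (simp add: coboundary_apply flip: cob)
    also have "\<dots> = 0"
      using that M_zero H1_range[OF \<psi>] by (auto simp: simple_cochain_def)
    finally show ?thesis .
  qed
  have y_mult: "y (g \<otimes> h) = (y g + y h) mod int n"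
    if "g \<in> carrier G" "h \<in> carrier G" "g \<in> M \<or> h \<in> M" for g h
  proof -
    have "(y g + y h) mod int n = y (g \<otimes> h) mod int n"
      using y_add[OF that] by (simp add: mod_eq_dvd_iff dvd_eq_mod_eq_0 algebra_simps)
    also have "\<dots> = y (g \<otimes> h)" using y that by (auto simp: C1_iff)
    finally show ?thesis by simp
  qed
  let ?\<phi> = "restrict y M"
  have top_M: "topspace (subtopology T M) = M"
    using M.subset topspace_eq by (simp add: inf.absorb2)
  have "?\<phi> \<in> carrier (H1 n (G\<lparr>carrier := M\<rparr>) (subtopology T M))"
  proof -
    have "locally_constant (subtopology T M) ?\<phi>"
      using locally_constant_cong[of "subtopology T M" ?\<phi> y] y
      by (simp add: top_M C1_iff locally_constant_subtopology)
    then have "?\<phi> \<in> carrier (cont_fun_group n (subtopology T M))"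
      using y M_carrier unfolding cont_fun_group_carrier_iff[OF n_pos] top_M
      by (simp add: cont_fun_group_carrier_iff[OF n_pos] topspace_eq)
    moreover have "?\<phi> \<in> hom (G\<lparr>carrier := M\<rparr>) (integer_mod_group n)"
    proof (rule homI)
      fix a b assume "a \<in> carrier (G\<lparr>carrier := M\<rparr>)" "b \<in> carrier (G\<lparr>carrier := M\<rparr>)"
      then show "?\<phi> (a \<otimes>\<^bsub>G\<lparr>carrier := M\<rparr>\<^esub> b) = ?\<phi> a \<otimes>\<^bsub>integer_mod_group n\<^esub> ?\<phi> b"
        by (simp add: y_mult M_carrier)
    qed (use y M_carrier n_pos in \<open>simp add: C1_iff carrier_integer_mod_group\<close>)
    ultimately show ?thesis by (simp add: H1_def)
  qed
  moreover have "?\<phi> (inv g \<otimes> m \<otimes> g) = ?\<phi> m" if "g \<in> carrier G" "m \<in> M" for g m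
  proof -
    have c: "inv g \<otimes> m \<otimes> g \<in> M" using M.inv_op_closed1 that by simp
    have "g \<otimes> (inv g \<otimes> m \<otimes> g) = m \<otimes> g"
      using that M_carrier by (simp add: m_assoc[symmetric])
    then have "(y g + y (inv g \<otimes> m \<otimes> g)) mod int n = (y m + y g) mod int n"
      using y_mult[of g "inv g \<otimes> m \<otimes> g"] y_mult[of m g] c that M_carrier by metis
    then have "y (inv g \<otimes> m \<otimes> g) mod int n = y m mod int n"
      by (simp add: mod_eq_dvd_iff)
    then show ?thesis
      using c that M_carrier y by (auto simp: C1_iff)
  qed
  ultimately have \<phi>: "?\<phi> \<in> H1_invariant n G T M"
    by (simp add: H1_invariant_def)
  have kernel: "{\<one>\<^bsub>G Mod M\<^esub>} = kernel (G Mod M) (integer_mod_group n) (?bar \<psi>) \<inter>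
      kernel (G Mod M) (integer_mod_group n) (?bar \<psi>')"
  proof -
    have "C = M" if C: "C \<in> carrier (G Mod M)" "?bar \<psi> C = 0" "?bar \<psi>' C = 0" for C
    proof -
      obtain g where g: "g \<in> carrier G" "C = M #> g" using C(1) by (auto simp: carrier_FactGroup)
      then have "g \<in> M" using M_I[OF g(1)] C bar[of \<psi> g] bar[of \<psi>' g] by simp
      then show ?thesis using g M.rcos_const[OF is_group] by simp
    qed
    moreover have "?bar \<psi> \<one>\<^bsub>G Mod M\<^esub> = 0" "?bar \<psi>' \<one>\<^bsub>G Mod M\<^esub> = 0"
      using Q.H1_one_arg[OF bar_\<psi>] Q.H1_one_arg[OF bar_\<psi>'] by simp_all
    ultimately show ?thesis
      using Q.one_closed unfolding Q.kernel_H1 one_FactGroup by blast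
  qed
  have Lambda: "Lambda n (G Mod M) (quotient_topology G M) ?\<alpha> = transgression n G T M ?\<phi>"
    using transgression_eq[OF M y f, of ?\<phi>] cob_f Q.Lambda_simple_elt[OF bar_\<psi> bar_\<psi>'] by simp
  have simple: "simple_type_with_kernel n (G Mod M) (quotient_topology G M) ?\<alpha> {\<one>\<^bsub>G Mod M\<^esub>}"
    unfolding simple_type_with_kernel_def using bar_\<psi> bar_\<psi>' kernel by blast
  show ?thesis
    unfolding distinguished_def eq
    using M M_open \<phi> Q.simple_elt_Omega[OF bar_\<psi> bar_\<psi>'] simple Lambda by blast
qed

lemma Delta_simple_coboundary:
  assumes "\<psi> \<in> X" and "\<psi>' \<in> X" and "y \<in> C1"
    and "coboundary n G y = simple_cochain n G \<psi> \<psi>'" and "x \<in> Delta n G T"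
  shows "y x = 0"
  using distinguished_of_simple_coboundary[OF assms(1-4)] assms(5) by (auto simp: Delta_def)

end

section \<open>Topological groups\<close>

context topological_group
begin

lemma continuous_map_group_mult:
  assumes "continuous_map Y T f" and "continuous_map Y T g"
  shows "continuous_map Y T (\<lambda>x. f x \<otimes> g x)"
proof -
  have "continuous_map Y (prod_topology T T) (\<lambda>x. (f x, g x))"
    using assms by (simp add: continuous_map_pairwise comp_def)
  from continuous_map_compose[OF this continuous_mult] show ?thesis
    by (simp add: comp_def)
qed

lemma continuous_map_translation:
  assumes "a \<in> carrier G"
  shows "continuous_map T T (\<lambda>x. a \<otimes> x)" and "continuous_map T T (\<lambda>x. x \<otimes> a)"
  using assms by (simp_all add: continuous_map_group_mult topspace_eq)

text \<open>The complement is a union of cosets.\<close>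

lemma closedin_open_subgroup:
  assumes H: "subgroup H G" and "openin T H"
  shows "closedin T H"
proof -
  interpret H: subgroup H G by fact
  have eq: "{x \<in> topspace T. inv g \<otimes> x \<in> H} \<inter> H = {}" if "g \<in> carrier G - H" for g
  proof -
    have False if "x \<in> H" "inv g \<otimes> x \<in> H" for x
    proof -
      have "x \<otimes> inv (inv g \<otimes> x) \<in> H" using that by simp
      moreover have "x \<otimes> inv (inv g \<otimes> x) = g"
        using that \<open>g \<in> carrier G - H\<close> H.mem_carrier by (simp add: inv_mult_group m_assoc[symmetric])
      ultimately show False using \<open>g \<in> carrier G - H\<close> by simp
    qed
    then show ?thesis by blast
  qed
  have "carrier G - H = (\<Union>g\<in>carrier G - H. {x \<in> topspace T. inv g \<otimes> x \<in> H})"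
  proof (intro equalityI subsetI)
    fix g assume g: "g \<in> carrier G - H"
    then have "inv g \<otimes> g \<in> H" by simp
    then show "g \<in> (\<Union>g\<in>carrier G - H. {x \<in> topspace T. inv g \<otimes> x \<in> H})"
      using g topspace_eq by blast
  next
    fix x assume "x \<in> (\<Union>g\<in>carrier G - H. {x \<in> topspace T. inv g \<otimes> x \<in> H})"
    then show "x \<in> carrier G - H" using eq topspace_eq by blast
  qed
  also have "openin T \<dots>"
    using assms(2) continuous_map_translation(1)
    by (intro openin_Union) (auto intro!: openin_continuous_map_preimage)
  finally show ?thesis using H.subset by (simp add: closedin_def topspace_eq)
qed

lemma openin_subgroup_superset:
  assumes W: "subgroup W G" and U: "subgroup U G" "openin T U" "U \<subseteq> W"
  shows "openin T W"
proof -
  interpret W: subgroup W G by fact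
  have "W = (\<Union>w\<in>W. {g \<in> topspace T. inv w \<otimes> g \<in> U})"
  proof (intro equalityI subsetI)
    fix w assume w: "w \<in> W"
    then have "inv w \<otimes> w \<in> U" using subgroup.one_closed[OF U(1)] by simp
    then show "w \<in> (\<Union>w\<in>W. {g \<in> topspace T. inv w \<otimes> g \<in> U})"
      using w W.mem_carrier[OF w] topspace_eq by blast
  next
    fix g assume "g \<in> (\<Union>w\<in>W. {g \<in> topspace T. inv w \<otimes> g \<in> U})"
    then obtain w where w: "w \<in> W" "g \<in> carrier G" "inv w \<otimes> g \<in> W"
      using U(3) topspace_eq by auto
    then have "w \<otimes> (inv w \<otimes> g) \<in> W" by blast
    then show "g \<in> W" using w by (simp add: m_assoc[symmetric])
  qed
  also have "openin T \<dots>"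
    using U(2) continuous_map_translation(1)
    by (intro openin_Union) (auto intro!: openin_continuous_map_preimage)
  finally show ?thesis .
qed

lemma subgroup_closure_of:
  assumes "subgroup H G"
  shows "subgroup (T closure_of H) G"
proof (rule subgroupI)
  interpret H: subgroup H G by fact
  show "T closure_of H \<subseteq> carrier G"
    using closure_of_subset_topspace[of T H] topspace_eq by simp
  have "H \<subseteq> T closure_of H" by (rule closure_of_subset) (use H.subset topspace_eq in simp)
  then show "T closure_of H \<noteq> {}" using H.one_closed by blast
  show "inv a \<in> T closure_of H" if "a \<in> T closure_of H" for a
  proof -
    have "(\<lambda>x. inv x) ` (T closure_of H) \<subseteq> T closure_of ((\<lambda>x. inv x) ` H)"
      by (rule continuous_map_image_closure_subset[OF continuous_inv])
    also have "\<dots> \<subseteq> T closure_of H" by (rule closure_of_mono) auto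
    finally show ?thesis using that by blast
  qed
  show "a \<otimes> b \<in> T closure_of H" if "a \<in> T closure_of H" "b \<in> T closure_of H" for a b
  proof -
    have "(\<lambda>(x, y). x \<otimes> y) ` (prod_topology T T closure_of (H \<times> H)) \<subseteq>
        T closure_of ((\<lambda>(x, y). x \<otimes> y) ` (H \<times> H))"
      by (rule continuous_map_image_closure_subset[OF continuous_mult])
    also have "\<dots> \<subseteq> T closure_of H" by (rule closure_of_mono) auto
    finally show ?thesis using that by (force simp: closure_of_Times)
  qed
qed

end

lemma (in topological_group) locally_constant_coset:
  assumes W: "subgroup W G" "openin T W"
  shows "locally_constant T (\<lambda>g. W #> g)"
  unfolding locally_constant_def
proof
  interpret W: subgroup W G by fact
  fix C
  show "openin T {x \<in> topspace T. W #> x = C}"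
  proof (cases "\<exists>g\<in>carrier G. W #> g = C")
    case True
    then obtain g where g: "g \<in> carrier G" "W #> g = C" by blast
    have "W #> x = C \<longleftrightarrow> x \<otimes> inv g \<in> W" if x: "x \<in> carrier G" for x
    proof
      assume "W #> x = C"
      then have "x \<in> W #> g" using rcos_self[OF x W(1)] g by simp
      then obtain w where "w \<in> W" "x = w \<otimes> g" by (auto simp: r_coset_def)
      then show "x \<otimes> inv g \<in> W" using g W.mem_carrier by (simp add: m_assoc)
    next
      assume "x \<otimes> inv g \<in> W"
      moreover have "x = (x \<otimes> inv g) \<otimes> g" using g x by (simp add: m_assoc)
      ultimately have "x \<in> W #> g" unfolding r_coset_def by blast
      then show "W #> x = C" using repr_independence[OF _ g(1) W(1)] g(2) by simp
    qed
    then have "{x \<in> topspace T. W #> x = C} = {x \<in> topspace T. x \<otimes> inv g \<in> W}"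
      using topspace_eq by auto
    then show ?thesis
      using W(2) g continuous_map_translation(2)[of "inv g"]
      by (simp add: openin_continuous_map_preimage)
  next
    case False
    then have "{x \<in> topspace T. W #> x = C} = {}" using topspace_eq by auto
    then show ?thesis by (simp only: openin_empty)
  qed
qed

section \<open>The third term of the central series lies in every distinguished subgroup\<close>

context coefficient_setting
begin

lemma closedin_kernel:
  assumes "locally_constant (subtopology T M) \<phi>" and "closedin T M"
  shows "closedin T {m \<in> M. \<phi> m = 0}"
proof -
  have "topspace (subtopology T M) = M"
    using closedin_subset[OF assms(2)] by (simp add: inf.absorb2)
  then have "closedin (subtopology T M) {m \<in> M. \<phi> m = 0}"
    using locally_constant_closedin[OF assms(1), of "\<lambda>u. u = 0"] by simp
  then show ?thesis using closedin_trans_full assms(2) by blast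
qed

lemma central_series_step:
  "central_series n G T (Suc (Suc i)) = T closure_of generate G
     ({h [^] n | h. h \<in> central_series n G T (Suc i)} \<union>
      {inv h \<otimes> inv g \<otimes> h \<otimes> g | h g. h \<in> central_series n G T (Suc i) \<and> g \<in> carrier G})"
  by simp

lemma central_series_step_subset:
  assumes N: "subgroup N G" "closedin T N"
    and "\<And>h. h \<in> central_series n G T (Suc i) \<Longrightarrow> h [^] n \<in> N"
    and "\<And>h g. h \<in> central_series n G T (Suc i) \<Longrightarrow> g \<in> carrier G \<Longrightarrow>
      inv h \<otimes> inv g \<otimes> h \<otimes> g \<in> N"
  shows "central_series n G T (Suc (Suc i)) \<subseteq> N"
  unfolding central_series_step
  using assms by (intro closure_of_minimal generate_subgroup_incl) auto

text \<open>The two characters of \<open>G/M\<close> that define the element of simple type kill \<open>q\<close>-th powers and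
  commutators; as their kernels intersect trivially, \<open>M\<close> contains \<open>G\<^sup>(\<^sup>2\<^sup>)\<close>.\<close>

lemma central_series_subset_Delta: "central_series n G T 3 \<subseteq> Delta n G T"
proof -
  have "central_series n G T 3 \<subseteq> N" and "N \<subseteq> carrier G" if dist: "distinguished n G T N" for N
  proof -
    obtain M \<phi> \<alpha> where M: "M \<lhd> G" "openin T M" and \<phi>: "\<phi> \<in> H1_invariant n G T M"
      and simple: "simple_type_with_kernel n (G Mod M) (quotient_topology G M) \<alpha> {\<one>\<^bsub>G Mod M\<^esub>}"
      and N: "N = kernel (G\<lparr>carrier := M\<rparr>) (integer_mod_group n) \<phi>"
      using dist unfolding distinguished_def by blast
    interpret M: normal M G by fact
    interpret Q: coefficient_setting "G Mod M" "quotient_topology G M" n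
      by (rule coefficient_setting_quotient[OF M(1)])
    have M_closed: "closedin T M"
      by (rule closedin_open_subgroup[OF M.subgroup_axioms M(2)])
    obtain \<psi> \<psi>' where \<psi>: "\<psi> \<in> Q.X" "\<psi>' \<in> Q.X"
      and ker: "{\<one>\<^bsub>G Mod M\<^esub>} = {C \<in> carrier (G Mod M). \<psi> C = 0} \<inter> {C \<in> carrier (G Mod M). \<psi>' C = 0}"
      using simple unfolding simple_type_with_kernel_def Q.kernel_H1 by blast
    have in_M: "g \<in> M" if g: "g \<in> carrier G" "\<psi> (M #> g) = 0" "\<psi>' (M #> g) = 0" for g
    proof -
      have "M #> g \<in> {\<one>\<^bsub>G Mod M\<^esub>}"
        using g unfolding ker by (auto simp: carrier_FactGroup)
      then show ?thesis
        using rcos_self[OF g(1) M.subgroup_axioms] by simp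
    qed
    have coset: "M #> g \<in> carrier (G Mod M)" if "g \<in> carrier G" for g
      using that by (auto simp: carrier_FactGroup)
    have \<theta>_mult: "\<theta> (M #> (g \<otimes> h)) = (\<theta> (M #> g) + \<theta> (M #> h)) mod int n"
      if "\<theta> \<in> Q.X" "g \<in> carrier G" "h \<in> carrier G" for \<theta> g h
      using Q.H1_hom[OF that(1) coset[OF that(2)] coset[OF that(3)]] that by (simp add: M.rcos_sum)
    have \<theta>_inv: "\<theta> (M #> inv g) = (- \<theta> (M #> g)) mod int n"
      if "\<theta> \<in> Q.X" "g \<in> carrier G" for \<theta> g
      using Q.H1_inv[OF that(1) coset[OF that(2)]] that coset[OF that(2)]
      by (simp add: M.inv_FactGroup M.rcos_inv)
    have \<theta>_pow: "\<theta> (M #> (g [^] n)) = 0" if "\<theta> \<in> Q.X" "g \<in> carrier G" for \<theta> g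
      using Q.H1_pow[OF that(1) coset[OF that(2)], of n] that by (simp add: M.FactGroup_pow)
    have \<theta>_comm: "\<theta> (M #> (inv h \<otimes> inv g \<otimes> h \<otimes> g)) = 0"
      if "\<theta> \<in> Q.X" "g \<in> carrier G" "h \<in> carrier G" for \<theta> g h
      using that by (simp add: \<theta>_mult \<theta>_inv mod_simps)
    have G2: "central_series n G T 2 \<subseteq> M"
      unfolding numeral_2_eq_2
      by (rule central_series_step_subset[OF M.subgroup_axioms M_closed])
        (use \<psi> in \<open>auto intro!: in_M simp: \<theta>_pow \<theta>_comm\<close>)
    have top_M: "topspace (subtopology T M) = M"
      using M.subset topspace_eq by (simp add: inf.absorb2)
    have \<phi>_hom: "\<phi> \<in> hom (G\<lparr>carrier := M\<rparr>) (integer_mod_group n)"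
      and \<phi>_lc: "locally_constant (subtopology T M) \<phi>"
      and \<phi>_inv: "\<And>g m. g \<in> carrier G \<Longrightarrow> m \<in> M \<Longrightarrow> \<phi> (inv g \<otimes> m \<otimes> g) = \<phi> m"
      using \<phi> by (auto simp: H1_invariant_def H1_def cont_fun_group_carrier_iff[OF n_pos])
    interpret GM: group "G\<lparr>carrier := M\<rparr>" by (rule subgroup_imp_group[OF M.subgroup_axioms])
    interpret \<phi>: group_hom "G\<lparr>carrier := M\<rparr>" "integer_mod_group n" \<phi>
      by (intro group_hom.intro group_hom_axioms.intro GM.is_group group_integer_mod_group \<phi>_hom)
    have N_eq: "N = {m \<in> M. \<phi> m = 0}" by (simp add: N kernel_def)
    have N_sub: "subgroup N G"
      using incl_subgroup[OF M.subgroup_axioms] \<phi>.subgroup_kernel by (simp add: N)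
    then show "N \<subseteq> carrier G" by (rule subgroup.subset)
    have N_closed: "closedin T N"
      unfolding N_eq by (rule closedin_kernel[OF \<phi>_lc M_closed])
    have pow: "h [^] n \<in> N" if h: "h \<in> M" for h
    proof -
      have "\<phi> (h [^]\<^bsub>G\<lparr>carrier := M\<rparr>\<^esub> n) = \<phi> h [^]\<^bsub>integer_mod_group n\<^esub> n"
        using h by (intro \<phi>.hom_nat_pow) simp
      moreover have "h [^]\<^bsub>G\<lparr>carrier := M\<rparr>\<^esub> n = h [^] n" by (simp add: nat_pow_def)
      moreover have "h [^] n \<in> M"
        using GM.nat_pow_closed[of h n] h by (simp add: nat_pow_def)
      ultimately show ?thesis by (simp add: N_eq)
    qed
    have comm: "inv h \<otimes> inv g \<otimes> h \<otimes> g \<in> N" if h: "h \<in> M" and g: "g \<in> carrier G" for h g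
    proof -
      have hg: "inv g \<otimes> h \<otimes> g \<in> M" using M.inv_op_closed1 h g by simp
      have hc: "h \<in> carrier G" using h by (rule M.mem_carrier)
      have eq: "inv h \<otimes> inv g \<otimes> h \<otimes> g = inv h \<otimes> (inv g \<otimes> h \<otimes> g)"
        using hc g by (simp add: m_assoc)
      have "\<phi> (inv h \<otimes> (inv g \<otimes> h \<otimes> g)) = (\<phi> (inv h) + \<phi> (inv g \<otimes> h \<otimes> g)) mod int n"
        using \<phi>.hom_mult[of "inv h" "inv g \<otimes> h \<otimes> g"] h hg by simp
      also have "\<dots> = (- \<phi> h mod int n + \<phi> h) mod int n"
        using \<phi>.hom_inv[of h] m_inv_consistent[OF M.subgroup_axioms h] h g
          \<phi>.hom_closed[of h] inv_integer_mod_group[of "\<phi> h" n] by (simp add: \<phi>_inv)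
      also have "\<dots> = 0" by (simp add: mod_simps)
      finally show ?thesis using h hg by (simp add: N_eq eq)
    qed
    show "central_series n G T 3 \<subseteq> N"
      unfolding numeral_3_eq_3
      by (rule central_series_step_subset[OF N_sub N_closed])
        (use G2 pow comm in \<open>auto simp: numeral_2_eq_2 simp del: central_series.simps\<close>)
  qed
  moreover have "central_series n G T 3 \<subseteq> carrier G"
    using closure_of_subset_topspace[of T] by (simp add: numeral_3_eq_3 topspace_eq)
  ultimately show ?thesis unfolding Delta_def by blast
qed

end

section \<open>Open normal subgroups of profinite groups\<close>

text \<open>Between \<open>1\<close> and a neighbourhood of it there is a clopen set \<open>C\<close>.  The elements \<open>g\<close> such that
  inserting \<open>g\<close> into any product does not affect membership in \<open>C\<close> form a normal subgroup, and by
  compactness of \<open>G \<times> G\<close> it is open.\<close>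

lemma (in profinite_group) open_normal_subgroup_in_neighbourhood:
  assumes "openin T V" and "\<one> \<in> V"
  obtains U where "U \<lhd> G" and "openin T U" and "U \<subseteq> V"
proof -
  have "{\<one>} \<in> connected_components_of T"
    using totally_disconnected[OF one_closed] unfolding connected_components_of_def
    by (metis imageI one_closed topspace_eq)
  then obtain C D where C: "openin T C" "openin T D" "disjnt C D" "C \<union> D = topspace T"
    and "\<one> \<in> C" "C \<subseteq> V"
    using wilder_locally_compact_component_thm[of T "{\<one>}" V] assms
      compact_imp_locally_compact_space[OF compact] Hausdorff topspace_eq
    by (metis finite.emptyI finite_imp_compactin finite_insert insert_subset one_closed
        empty_subsetI)
  have D_eq: "{x \<in> topspace T. x \<in> C} = C" "{x \<in> topspace T. x \<notin> C} = D"
    using C(3,4) unfolding disjnt_def by blast+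
  have lc: "locally_constant T (\<lambda>x. x \<in> C)"
    unfolding locally_constant_def
  proof
    fix v :: bool
    show "openin T {x \<in> topspace T. (x \<in> C) = v}"
      using C(1,2) D_eq by (cases v) simp_all
  qed
  define U where
    "U = {g \<in> carrier G. \<forall>a\<in>carrier G. \<forall>b\<in>carrier G. a \<otimes> b \<in> C \<longleftrightarrow> a \<otimes> g \<otimes> b \<in> C}"
  have U_I: "g \<in> U" if "g \<in> carrier G"
    "\<And>a b. a \<in> carrier G \<Longrightarrow> b \<in> carrier G \<Longrightarrow> a \<otimes> b \<in> C \<longleftrightarrow> a \<otimes> g \<otimes> b \<in> C" for g
    using that by (simp add: U_def)
  have U_D: "g \<in> carrier G" and U_C: "\<And>a b. a \<in> carrier G \<Longrightarrow> b \<in> carrier G \<Longrightarrow>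
      a \<otimes> b \<in> C \<longleftrightarrow> a \<otimes> g \<otimes> b \<in> C" if "g \<in> U" for g
    using that by (simp_all add: U_def)
  have "U \<lhd> G"
  proof (rule normal_invI)
    show "subgroup U G"
    proof (rule subgroupI)
      show "U \<subseteq> carrier G" using U_D by blast
      have "\<one> \<in> U" by (rule U_I) simp_all
      then show "U \<noteq> {}" by blast
      show "inv g \<in> U" if g: "g \<in> U" for g
      proof (rule U_I)
        fix a b assume "a \<in> carrier G" "b \<in> carrier G"
        then show "a \<otimes> b \<in> C \<longleftrightarrow> a \<otimes> inv g \<otimes> b \<in> C"
          using U_C[OF g, of "a \<otimes> inv g" b] U_D[OF g] by (simp add: m_assoc)
      qed (simp add: U_D[OF g])
      show "g \<otimes> h \<in> U" if g: "g \<in> U" and h: "h \<in> U" for g h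
      proof (rule U_I)
        fix a b assume "a \<in> carrier G" "b \<in> carrier G"
        then show "a \<otimes> b \<in> C \<longleftrightarrow> a \<otimes> (g \<otimes> h) \<otimes> b \<in> C"
          using U_C[OF g, of a b] U_C[OF h, of "a \<otimes> g" b] U_D[OF g] U_D[OF h] by (simp add: m_assoc)
      qed (simp add: U_D g h)
    qed
    fix x g assume x: "x \<in> carrier G" and g: "g \<in> U"
    show "x \<otimes> g \<otimes> inv x \<in> U"
    proof (rule U_I)
      fix a b assume ab: "a \<in> carrier G" "b \<in> carrier G"
      have "a \<otimes> x \<otimes> (inv x \<otimes> b) = a \<otimes> b"
        using x ab by (metis inv_closed m_assoc m_closed r_inv r_one)
      then show "a \<otimes> b \<in> C \<longleftrightarrow> a \<otimes> (x \<otimes> g \<otimes> inv x) \<otimes> b \<in> C"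
        using U_C[OF g, of "a \<otimes> x" "inv x \<otimes> b"] x ab U_D[OF g] by (simp add: m_assoc)
    qed (simp add: x U_D[OF g])
  qed
  moreover have "openin T U"
  proof -
    let ?P = "prod_topology T (prod_topology T T)"
    have a: "continuous_map ?P T (\<lambda>z. fst (snd z))" and b: "continuous_map ?P T (\<lambda>z. snd (snd z))"
      using continuous_map_compose[OF continuous_map_snd continuous_map_fst, of T T T]
        continuous_map_compose[OF continuous_map_snd continuous_map_snd, of T T T]
      by (simp_all add: comp_def)
    have "locally_constant ?P (\<lambda>z. fst (snd z) \<otimes> snd (snd z) \<in> C)"
      by (rule locally_constant_pullback[OF _ lc]) (intro continuous_map_group_mult a b)
    moreover have "locally_constant ?P (\<lambda>z. fst (snd z) \<otimes> fst z \<otimes> snd (snd z) \<in> C)"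
      by (rule locally_constant_pullback[OF _ lc])
        (intro continuous_map_group_mult a b continuous_map_fst)
    ultimately have "locally_constant ?P (\<lambda>z. (fst (snd z) \<otimes> snd (snd z) \<in> C) =
        (fst (snd z) \<otimes> fst z \<otimes> snd (snd z) \<in> C))"
      by (rule locally_constant_comp2)
    then have "closedin ?P {z \<in> topspace ?P. (fst (snd z) \<otimes> snd (snd z) \<in> C) \<noteq>
        (fst (snd z) \<otimes> fst z \<otimes> snd (snd z) \<in> C)}" (is "closedin ?P ?E")
      by (rule locally_constant_closedin[where P = "\<lambda>u. \<not> u"])
    moreover have "closed_map ?P T fst"
      by (rule closed_map_fst) (simp add: compact_space_prod_topology compact)
    ultimately have "closedin T (fst ` ?E)"
      unfolding closed_map_def by blast
    moreover have "U = topspace T - fst ` ?E"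
    proof (intro equalityI subsetI)
      fix g assume g: "g \<in> U"
      then have "g \<notin> fst ` ?E" using U_C[OF g] by (auto simp: topspace_eq)
      then show "g \<in> topspace T - fst ` ?E" using U_D[OF g] by (simp add: topspace_eq)
    next
      fix g assume g: "g \<in> topspace T - fst ` ?E"
      show "g \<in> U"
      proof (rule U_I)
        fix a b assume "a \<in> carrier G" "b \<in> carrier G"
        then show "a \<otimes> b \<in> C \<longleftrightarrow> a \<otimes> g \<otimes> b \<in> C"
          using g by (auto simp: topspace_eq image_iff)
      qed (use g in \<open>simp add: topspace_eq\<close>)
    qed
    ultimately show ?thesis by (simp add: closedin_def)
  qed
  moreover have "U \<subseteq> V"
  proof
    fix g assume "g \<in> U"
    then show "g \<in> V"
      using U_C[of g \<one> \<one>] U_D[of g] \<open>\<one> \<in> C\<close> \<open>C \<subseteq> V\<close> by auto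
  qed
  ultimately show thesis by (rule that)
qed

text \<open>If \<open>x U\<close> misses \<open>K\<close> for an open normal subgroup \<open>U\<close>, then \<open>K U\<close> does not contain \<open>x\<close>.\<close>

lemma (in profinite_group) closed_normal_subgroup_separation:
  assumes K: "K \<lhd> G" "closedin T K" and x: "x \<in> carrier G" "x \<notin> K"
  obtains W where "W \<lhd> G" and "openin T W" and "K \<subseteq> W" and "x \<notin> W"
proof -
  interpret K: normal K G by fact
  let ?V = "{u \<in> topspace T. x \<otimes> u \<in> topspace T - K}"
  have "openin T ?V"
    using K(2) by (intro openin_continuous_map_preimage[OF continuous_map_translation(1)[OF x(1)]])
      (auto simp: closedin_def)
  moreover have "\<one> \<in> ?V" using x by (simp add: topspace_eq)
  ultimately obtain U where U: "U \<lhd> G" "openin T U" "U \<subseteq> ?V"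
    by (rule open_normal_subgroup_in_neighbourhood)
  interpret U: normal U G by fact
  let ?W = "K <#> U"
  have W_normal: "?W \<lhd> G"
    by (rule normal_subgroup_set_mult_closed[OF K(1) U(1)])
  then have W: "subgroup ?W G" by (rule normal_imp_subgroup)
  have KW: "K \<subseteq> ?W"
  proof
    fix k assume "k \<in> K"
    then have "k = k \<otimes> \<one>" by simp
    then show "k \<in> ?W" using \<open>k \<in> K\<close> U.one_closed unfolding set_mult_def by blast
  qed
  have UW: "U \<subseteq> ?W"
  proof
    fix u assume "u \<in> U"
    then have "u = \<one> \<otimes> u" by simp
    then show "u \<in> ?W" using \<open>u \<in> U\<close> K.one_closed unfolding set_mult_def by blast
  qed
  have W_open: "openin T ?W"
    by (rule openin_subgroup_superset[OF W U.subgroup_axioms U(2) UW])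
  have "x \<notin> ?W"
  proof
    assume "x \<in> ?W"
    then obtain k u where ku: "k \<in> K" "u \<in> U" "x = k \<otimes> u" by (auto simp: set_mult_def)
    then have "x \<otimes> inv u = k" using K.mem_carrier U.mem_carrier by (simp add: m_assoc)
    moreover have "inv u \<in> ?V" using U(3) ku(2) by auto
    ultimately show False using ku(1) by simp
  qed
  then show thesis using W_normal W_open KW that by blast
qed

lemma locally_constant_finite_image:
  assumes "compact_space X" and "locally_constant X f"
  shows "finite (f ` topspace X)"
proof -
  let ?U = "\<lambda>v. {x \<in> topspace X. f x = v}"
  have "\<forall>C\<in>?U ` (f ` topspace X). openin X C" using assms(2) by (auto simp: locally_constant_def)
  moreover have "topspace X \<subseteq> \<Union>(?U ` (f ` topspace X))" by blast
  ultimately obtain F where "finite F" "F \<subseteq> ?U ` (f ` topspace X)" "topspace X \<subseteq> \<Union>F"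
    using assms(1) unfolding compact_space_def compactin_def by meson
  then obtain V where "finite V" "F = ?U ` V"
    by (meson finite_subset_image)
  then have "f ` topspace X \<subseteq> V" using \<open>topspace X \<subseteq> \<Union>F\<close> by auto
  then show ?thesis using \<open>finite V\<close> by (rule finite_subset)
qed

lemma (in profinite_group) finite_quotient:
  assumes W: "W \<lhd> G" "openin T W"
  shows "finite (carrier (G Mod W))"
  using locally_constant_finite_image[OF compact locally_constant_coset[OF normal_imp_subgroup[OF W(1)] W(2)]]
  by (simp add: carrier_FactGroup topspace_eq)


section \<open>Characters of finite abelian groups of bounded exponent\<close>

lemma (in group) cong_additive_pow:
  fixes \<theta> :: "'a \<Rightarrow> int" and m :: nat
  assumes B: "subgroup B G" and u: "u \<in> B"
    and \<theta>: "\<And>u v. u \<in> B \<Longrightarrow> v \<in> B \<Longrightarrow> [\<theta> (u \<otimes> v) = \<theta> u + \<theta> v] (mod q)"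
  shows "u [^] m \<in> B" and "[\<theta> (u [^] m) = int m * \<theta> u] (mod q)"
proof -
  interpret B: subgroup B G by fact
  have "u [^] m \<in> B \<and> [\<theta> (u [^] m) = int m * \<theta> u] (mod q)"
  proof (induction m)
    case 0
    have "[\<theta> \<one> = 0] (mod q)"
      using cong_sym[OF \<theta>[OF B.one_closed B.one_closed]]
      by (simp only: l_one one_closed cong_add_lcancel_0)
    then show ?case by simp
  next
    case (Suc m)
    have "[\<theta> (u [^] m \<otimes> u) = \<theta> (u [^] m) + \<theta> u] (mod q)" using Suc u by (intro \<theta>) simp_all
    also have "[\<theta> (u [^] m) + \<theta> u = int m * \<theta> u + \<theta> u] (mod q)"
      using Suc by (intro cong_add cong_refl) simp
    finally show ?case using Suc u by (simp add: algebra_simps)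
  qed
  then show "u [^] m \<in> B" and "[\<theta> (u [^] m) = int m * \<theta> u] (mod q)" by simp_all
qed

text \<open>A character on \<open>B\<close> extends to \<open>\<langle>B, b\<rangle>\<close> with value \<open>c\<close> at \<open>b\<close> if \<open>c\<close> is compatible with the first
  power \<open>b\<^sup>r\<close> that lies in \<open>B\<close>.\<close>

lemma (in comm_group) character_extension:
  fixes q r :: nat and \<theta> :: "'a \<Rightarrow> int"
  assumes B: "subgroup B G" and b: "b \<in> carrier G" and q: "q > 0" "b [^] q = \<one>"
    and \<theta>: "\<And>u v. u \<in> B \<Longrightarrow> v \<in> B \<Longrightarrow> [\<theta> (u \<otimes> v) = \<theta> u + \<theta> v] (mod int q)"
    and r: "\<And>k. b [^] (k::nat) \<in> B \<longleftrightarrow> r dvd k" and c: "[int r * c = \<theta> (b [^] r)] (mod int q)"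
  obtains B' \<theta>' where "subgroup B' G" and "B \<subseteq> B'" and "b \<in> B'"
    and "\<And>u v. u \<in> B' \<Longrightarrow> v \<in> B' \<Longrightarrow> [\<theta>' (u \<otimes> v) = \<theta>' u + \<theta>' v] (mod int q)"
    and "\<And>u. u \<in> B \<Longrightarrow> [\<theta>' u = \<theta> u] (mod int q)" and "[\<theta>' b = c] (mod int q)"
proof -
  interpret B: subgroup B G by fact
  define B' where "B' = {u \<otimes> b [^] k | u (k::nat). u \<in> B}"
  have br: "b [^] r \<in> B" by (simp add: r)
  have one: "[\<theta> \<one> = 0] (mod int q)"
    using cong_additive_pow(2)[OF B br \<theta>, of 0] by simp
  have multiple: "[\<theta> (b [^] (r * m)) = int m * (int r * c)] (mod int q)" for m :: nat
  proof -
    have "[\<theta> ((b [^] r) [^] m) = int m * \<theta> (b [^] r)] (mod int q)"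
      by (rule cong_additive_pow(2)[OF B br \<theta>])
    also have "[int m * \<theta> (b [^] r) = int m * (int r * c)] (mod int q)"
      by (intro cong_mult cong_refl cong_sym[OF c])
    finally show ?thesis using b by (simp add: nat_pow_pow)
  qed
  have well_defined_le: "[\<theta> u + int k * c = \<theta> v + int l * c] (mod int q)"
    if u: "u \<in> B" and v: "v \<in> B" and eq: "u \<otimes> b [^] k = v \<otimes> b [^] l" and "k \<le> l" for u v and k l :: nat
  proof -
    have bl: "b [^] l = b [^] (l - k) \<otimes> b [^] k" using b \<open>k \<le> l\<close> by (simp add: nat_pow_mult)
    then have "u \<otimes> b [^] k = (v \<otimes> b [^] (l - k)) \<otimes> b [^] k"
      using eq u v b by (simp add: m_assoc)
    then have u_eq: "u = v \<otimes> b [^] (l - k)" using u v b by simp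
    then have "b [^] (l - k) = inv v \<otimes> u" using u v b by (simp add: m_assoc[symmetric])
    then have mem: "b [^] (l - k) \<in> B" using u v by simp
    then obtain m where m: "l - k = r * m" using r by auto
    have "[\<theta> u = \<theta> v + \<theta> (b [^] (l - k))] (mod int q)"
      unfolding u_eq by (rule \<theta>[OF v mem])
    also have "[\<theta> v + \<theta> (b [^] (l - k)) = \<theta> v + int m * (int r * c)] (mod int q)"
      unfolding m by (intro cong_add multiple cong_refl)
    finally have "[\<theta> u + int k * c = \<theta> v + int m * (int r * c) + int k * c] (mod int q)"
      by (intro cong_add cong_refl)
    moreover have "int l = int r * int m + int k"
      using m \<open>k \<le> l\<close> by (metis le_add_diff_inverse2 of_nat_add of_nat_mult)
    ultimately show ?thesis by (simp add: algebra_simps)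
  qed
  have well_defined: "[\<theta> u + int k * c = \<theta> v + int l * c] (mod int q)"
    if "u \<in> B" "v \<in> B" "u \<otimes> b [^] k = v \<otimes> b [^] l" for u v and k l :: nat
    using well_defined_le[OF that(1,2,3)] well_defined_le[OF that(2,1) that(3)[symmetric]]
    by (cases "k \<le> l") (auto intro: cong_sym)
  define \<theta>' where "\<theta>' g = (SOME t. \<exists>u k. u \<in> B \<and> g = u \<otimes> b [^] (k::nat) \<and> t = \<theta> u + int k * c)" for g
  have \<theta>': "[\<theta>' (u \<otimes> b [^] k) = \<theta> u + int k * c] (mod int q)" if "u \<in> B" for u and k :: nat
  proof -
    have "\<exists>v l. v \<in> B \<and> u \<otimes> b [^] k = v \<otimes> b [^] (l::nat) \<and> \<theta>' (u \<otimes> b [^] k) = \<theta> v + int l * c"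
      unfolding \<theta>'_def by (rule someI_ex) (use that in blast)
    then show ?thesis using well_defined[OF _ that] by (metis cong_sym)
  qed
  show thesis
  proof
    show "subgroup B' G"
    proof (rule subgroupI)
      show "B' \<subseteq> carrier G" using b by (auto simp: B'_def)
      show "B' \<noteq> {}" using B.one_closed unfolding B'_def by blast
      show "inv g \<in> B'" if "g \<in> B'" for g
      proof -
        obtain u k where uk: "u \<in> B" "g = u \<otimes> b [^] (k::nat)" using \<open>g \<in> B'\<close> by (auto simp: B'_def)
        have "k * (q - 1) + k = k * q" using q(1) by (cases q) simp_all
        then have "b [^] (k * (q - 1)) \<otimes> b [^] k = (b [^] q) [^] k"
          using b by (simp add: nat_pow_mult nat_pow_pow mult.commute)
        then have "inv (b [^] k) = b [^] (k * (q - 1))"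
          using b q(2) by (intro inv_equality) simp_all
        then have "inv g = inv u \<otimes> b [^] (k * (q - 1))"
          using uk b by (simp add: inv_mult)
        then show ?thesis using uk(1) by (auto simp: B'_def)
      qed
      show "g \<otimes> h \<in> B'" if gh: "g \<in> B'" "h \<in> B'" for g h
      proof -
        obtain u k v l where uk: "u \<in> B" "g = u \<otimes> b [^] (k::nat)" "v \<in> B" "h = v \<otimes> b [^] (l::nat)"
          using gh by (auto simp: B'_def)
        then have "g \<otimes> h = (u \<otimes> v) \<otimes> b [^] (k + l)"
          using b by (simp add: m_ac nat_pow_mult[symmetric])
        then show ?thesis using uk by (auto simp: B'_def)
      qed
    qed
    show "B \<subseteq> B'"
    proof
      fix u assume "u \<in> B"
      then have "u = u \<otimes> b [^] (0::nat)" by simp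
      then show "u \<in> B'" using \<open>u \<in> B\<close> unfolding B'_def by blast
    qed
    have "b = \<one> \<otimes> b [^] (1::nat)" using b by simp
    then show "b \<in> B'" using B.one_closed unfolding B'_def by blast
    show "[\<theta>' u = \<theta> u] (mod int q)" if "u \<in> B" for u
      using \<theta>'[OF that, of 0] that by simp
    have "[\<theta> \<one> + c = 0 + c] (mod int q)" by (intro cong_add one cong_refl)
    then show "[\<theta>' b = c] (mod int q)"
      using \<theta>'[OF B.one_closed, of 1] b by simp (metis cong_trans)
    show "[\<theta>' (g \<otimes> h) = \<theta>' g + \<theta>' h] (mod int q)" if gh: "g \<in> B'" "h \<in> B'" for g h
    proof -
      obtain u k v l where uk: "u \<in> B" "g = u \<otimes> b [^] (k::nat)" "v \<in> B" "h = v \<otimes> b [^] (l::nat)"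
        using gh by (auto simp: B'_def)
      then have eq: "g \<otimes> h = (u \<otimes> v) \<otimes> b [^] (k + l)"
        using b by (simp add: m_ac nat_pow_mult[symmetric])
      have "[\<theta>' (g \<otimes> h) = \<theta> (u \<otimes> v) + int (k + l) * c] (mod int q)"
        unfolding eq by (rule \<theta>') (simp add: uk)
      also have "[\<theta> (u \<otimes> v) + int (k + l) * c = (\<theta> u + \<theta> v) + int (k + l) * c] (mod int q)"
        by (intro cong_add \<theta> uk cong_refl)
      also have "(\<theta> u + \<theta> v) + int (k + l) * c = (\<theta> u + int k * c) + (\<theta> v + int l * c)"
        by (simp add: algebra_simps)
      also have "[\<dots> = \<theta>' g + \<theta>' h] (mod int q)"
        unfolding uk(2,4) by (intro cong_add cong_sym[OF \<theta>'] uk)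
      finally show ?thesis .
    qed
  qed
qed

lemma (in group) relative_order:
  assumes B: "subgroup B G" and b: "b \<in> carrier G" and q: "q > 0" "b [^] (q::nat) = \<one>"
  obtains r where "r dvd q" and "\<And>k. b [^] (k::nat) \<in> B \<longleftrightarrow> r dvd k"
proof -
  interpret B: subgroup B G by fact
  define r where "r = (LEAST k. 0 < k \<and> b [^] (k::nat) \<in> B)"
  have "0 < r \<and> b [^] r \<in> B"
    unfolding r_def by (rule LeastI[of _ q]) (simp add: q)
  then have r: "0 < r" "b [^] r \<in> B" by auto
  have least: "r \<le> k" if "0 < k" "b [^] k \<in> B" for k :: nat
    unfolding r_def by (rule Least_le) (simp add: that)
  have mult: "b [^] (r * m) \<in> B" for m :: nat
    using cong_additive_pow(1)[OF B r(2), of "\<lambda>_. 0"] b by (simp add: nat_pow_pow)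
  have iff: "b [^] k \<in> B \<longleftrightarrow> r dvd k" for k :: nat
  proof
    assume "r dvd k" then show "b [^] k \<in> B" using mult by auto
  next
    assume k: "b [^] k \<in> B"
    have "b [^] k = b [^] (r * (k div r)) \<otimes> b [^] (k mod r)" using b by (simp add: nat_pow_mult)
    then have "b [^] (k mod r) = inv (b [^] (r * (k div r))) \<otimes> b [^] k"
      using b by (simp add: m_assoc[symmetric])
    then have "b [^] (k mod r) \<in> B" using mult k by simp
    then have "k mod r = 0" using least[of "k mod r"] r(1) by (meson mod_less_divisor leD not_gr0)
    then show "r dvd k" by auto
  qed
  have "r dvd q" using iff[of q] q(2) by simp
  then show thesis using iff by (rule that)
qed

text \<open>Extend a character of \<open>\<langle>x\<rangle>\<close> to a subgroup \<open>B\<close> as large as possible.  The compatible value \<open>c\<close> at a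
  further element \<open>b\<close> exists because \<open>q/r\<close> times the value at \<open>b\<^sup>r\<close> is the value at \<open>b\<^sup>q = 1\<close>.\<close>

lemma (in comm_group) character_separates:
  fixes q :: nat
  assumes fin: "finite (carrier G)" and q: "q > 0" "\<And>a. a \<in> carrier G \<Longrightarrow> a [^] q = \<one>"
    and x: "x \<in> carrier G" "x \<noteq> \<one>"
  obtains \<theta> :: "'a \<Rightarrow> int"
  where "\<And>u v. u \<in> carrier G \<Longrightarrow> v \<in> carrier G \<Longrightarrow> [\<theta> (u \<otimes> v) = \<theta> u + \<theta> v] (mod int q)"
    and "\<not> [\<theta> x = 0] (mod int q)"
proof -
  define P where "P B \<longleftrightarrow> subgroup B G \<and> x \<in> B \<and> (\<exists>\<theta>::'a \<Rightarrow> int.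
    (\<forall>u\<in>B. \<forall>v\<in>B. [\<theta> (u \<otimes> v) = \<theta> u + \<theta> v] (mod int q)) \<and> \<not> [\<theta> x = 0] (mod int q))" for B
  have "\<exists>B. P B"
  proof -
    have one: "subgroup {\<one>} G" by (rule triv_subgroup)
    obtain r where r: "r dvd q" "\<And>k. x [^] (k::nat) \<in> {\<one>} \<longleftrightarrow> r dvd k"
      using relative_order[OF one x(1) q(1) q(2)[OF x(1)]] by blast
    have "r \<noteq> 1" using r(2)[of 1] x by auto
    obtain s where s: "q = r * s" using r(1) by auto
    have s_nz: "\<not> [int s = 0] (mod int q)"
    proof
      assume "[int s = 0] (mod int q)"
      then have "q dvd s" by (simp add: cong_0_iff)
      then show False using s q(1) \<open>r \<noteq> 1\<close> by (auto simp: dvd_def)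
    qed
    have c: "[int r * int s = 0] (mod int q)"
      using s by (simp add: cong_def)
    obtain B \<theta> where B\<theta>: "subgroup B G" "x \<in> B"
      "\<And>u v. u \<in> B \<Longrightarrow> v \<in> B \<Longrightarrow> [\<theta> (u \<otimes> v) = \<theta> u + \<theta> v] (mod int q)" "[\<theta> x = int s] (mod int q)"
    proof (rule character_extension[where B = "{\<one>}" and b = x and q = q and r = r
          and \<theta> = "\<lambda>_. 0" and c = "int s"])
      fix B' :: "'a set" and \<theta>' :: "'a \<Rightarrow> int"
      assume "subgroup B' G" "x \<in> B'"
        "\<And>u v. u \<in> B' \<Longrightarrow> v \<in> B' \<Longrightarrow> [\<theta>' (u \<otimes> v) = \<theta>' u + \<theta>' v] (mod int q)"
        "[\<theta>' x = int s] (mod int q)"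
      then show thesis by (rule that[of B' \<theta>'])
    qed (use one x(1) q(1) q(2)[OF x(1)] r(2) c in simp_all)
    have "\<not> [\<theta> x = 0] (mod int q)"
      using s_nz cong_trans[OF cong_sym[OF B\<theta>(4)]] by blast
    then show ?thesis unfolding P_def using B\<theta> by blast
  qed
  moreover have "finite {B. P B}"
    using fin by (rule_tac finite_subset[of _ "Pow (carrier G)"]) (auto simp: P_def dest: subgroup.subset)
  ultimately obtain B where B: "P B" and max: "\<And>B'. P B' \<Longrightarrow> B \<subseteq> B' \<Longrightarrow> B' = B"
    using finite_has_maximal[of "{B. P B}"] by auto
  obtain \<theta> :: "'a \<Rightarrow> int" where sub: "subgroup B G" and xB: "x \<in> B"
    and \<theta>: "\<And>u v. u \<in> B \<Longrightarrow> v \<in> B \<Longrightarrow> [\<theta> (u \<otimes> v) = \<theta> u + \<theta> v] (mod int q)"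
    and \<theta>x: "\<not> [\<theta> x = 0] (mod int q)"
    using B unfolding P_def by blast
  interpret B: subgroup B G by fact
  have "carrier G \<subseteq> B"
  proof
    fix b assume b: "b \<in> carrier G"
    obtain r where r: "r dvd q" "\<And>k. b [^] (k::nat) \<in> B \<longleftrightarrow> r dvd k"
      using relative_order[OF sub b q(1) q(2)[OF b]] by blast
    obtain s where s: "q = r * s" using r(1) by auto
    then have "s > 0" "r > 0" using q(1) by auto
    have br: "b [^] r \<in> B" using r(2) by simp
    have "[int s * \<theta> (b [^] r) = 0] (mod int q)"
    proof -
      have "(b [^] r) [^] s = (b [^] r) [^] (0::nat)"
        using q(2)[OF b] s b by (simp add: nat_pow_pow)
      then show ?thesis
        using cong_trans[OF cong_sym[OF cong_additive_pow(2)[OF sub br \<theta>, of s]]]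
          cong_additive_pow(2)[OF sub br \<theta>, of 0] by simp
    qed
    then have "int s * int r dvd int s * \<theta> (b [^] r)"
      by (simp add: s cong_0_iff mult.commute)
    then have "int r dvd \<theta> (b [^] r)" using \<open>s > 0\<close> by simp
    then obtain c where "\<theta> (b [^] r) = int r * c" by auto
    then have c: "[int r * c = \<theta> (b [^] r)] (mod int q)" by simp
    obtain B' \<theta>' where B': "subgroup B' G" "B \<subseteq> B'" "b \<in> B'"
      "\<And>u v. u \<in> B' \<Longrightarrow> v \<in> B' \<Longrightarrow> [\<theta>' (u \<otimes> v) = \<theta>' u + \<theta>' v] (mod int q)"
      "\<And>u. u \<in> B \<Longrightarrow> [\<theta>' u = \<theta> u] (mod int q)"
    proof (rule character_extension[where B = B and b = b and q = q and r = r and \<theta> = \<theta> and c = c])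
      fix B' :: "'a set" and \<theta>' :: "'a \<Rightarrow> int"
      assume "subgroup B' G" "B \<subseteq> B'" "b \<in> B'"
        "\<And>u v. u \<in> B' \<Longrightarrow> v \<in> B' \<Longrightarrow> [\<theta>' (u \<otimes> v) = \<theta>' u + \<theta>' v] (mod int q)"
        "\<And>u. u \<in> B \<Longrightarrow> [\<theta>' u = \<theta> u] (mod int q)"
      then show thesis by (rule that[of B' \<theta>'])
    qed (use sub b q(1) q(2)[OF b] \<theta> r(2) c in simp_all)
    have "\<not> [\<theta>' x = 0] (mod int q)"
      using \<theta>x cong_trans[OF cong_sym[OF B'(5)[OF xB]]] by blast
    then have "P B'" unfolding P_def using B' xB by blast
    then show "b \<in> B" using max[OF _ B'(2)] B'(3) by simp
  qed
  then show thesis using \<theta> \<theta>x by (intro that[of \<theta>]) auto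
qed

section \<open>Separating by invariant characters\<close>

locale profinite_setting = profinite_group G T + coefficient_setting G T n
  for G (structure) and T n
begin

text \<open>The hypotheses say that the image of \<open>H\<close> in \<open>G/K\<close> is central of exponent \<open>n\<close>.  Passing to a
  finite quotient \<open>G/W\<close> in which \<open>x\<close> survives, one separates \<open>x\<close> from \<open>1\<close> by a character of the
  image of \<open>H\<close> and pulls it back to \<open>M = H W\<close>; it is invariant as the image of \<open>H\<close> is central.\<close>

lemma invariant_character_exists:
  assumes H: "subgroup H G" and K: "K \<lhd> G" "closedin T K"
    and pow: "\<And>h. h \<in> H \<Longrightarrow> h [^] n \<in> K"
    and comm: "\<And>h g. h \<in> H \<Longrightarrow> g \<in> carrier G \<Longrightarrow> inv h \<otimes> inv g \<otimes> h \<otimes> g \<in> K"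
    and x: "x \<in> H" "x \<notin> K"
  obtains M \<phi> where "openin T M" and "H \<subseteq> M" and "subgroup M G"
    and "\<And>m. m \<in> M \<Longrightarrow> 0 \<le> \<phi> m \<and> \<phi> m < int n"
    and "\<And>a b. a \<in> M \<Longrightarrow> b \<in> M \<Longrightarrow> \<phi> (a \<otimes> b) = (\<phi> a + \<phi> b) mod int n"
    and "\<And>g m. g \<in> carrier G \<Longrightarrow> m \<in> M \<Longrightarrow> inv g \<otimes> m \<otimes> g \<in> M \<and> \<phi> (inv g \<otimes> m \<otimes> g) = \<phi> m"
    and "locally_constant T \<phi>" and "\<phi> x \<noteq> 0"
proof -
  interpret H: subgroup H G by fact
  obtain W where W: "W \<lhd> G" "openin T W" "K \<subseteq> W" "x \<notin> W"
    using closed_normal_subgroup_separation[OF K _ x(2)] x(1) H.mem_carrier by blast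
  interpret W: normal W G by fact
  interpret Q: group "G Mod W" by (rule W.factorgroup_is_group)
  define \<pi> where "\<pi> = (\<lambda>g. W #> g)"
  have \<pi>_hom: "\<pi> \<in> hom G (G Mod W)" unfolding \<pi>_def by (rule W.r_coset_hom_Mod)
  interpret \<pi>: group_hom G "G Mod W" \<pi>
    by (intro group_hom.intro group_hom_axioms.intro is_group Q.is_group \<pi>_hom)
  have \<pi>_W: "\<pi> w = \<one>\<^bsub>G Mod W\<^esub>" if "w \<in> W" for w
    unfolding \<pi>_def using W.rcos_const[OF is_group that] by simp
  have central: "\<pi> (h \<otimes> g) = \<pi> (g \<otimes> h)" if h: "h \<in> H" and g: "g \<in> carrier G" for h g
  proof -
    have hc: "h \<in> carrier G" using h by (rule H.mem_carrier)
    have "inv (inv h) \<otimes> inv (inv g) \<otimes> inv h \<otimes> inv g \<in> K" using h g by (intro comm) auto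
    then have c: "h \<otimes> g \<otimes> inv h \<otimes> inv g \<in> W" using W(3) hc g by auto
    have "h \<otimes> g = (h \<otimes> g \<otimes> inv h \<otimes> inv g) \<otimes> (g \<otimes> h)"
    proof -
      have "inv g \<otimes> (g \<otimes> h) = h" using hc g by (simp add: m_assoc[symmetric])
      then show ?thesis using hc g by (simp add: m_assoc)
    qed
    then have "\<pi> (h \<otimes> g) = \<pi> (h \<otimes> g \<otimes> inv h \<otimes> inv g) \<otimes>\<^bsub>G Mod W\<^esub> \<pi> (g \<otimes> h)"
      using hc g by (metis \<pi>.hom_mult inv_closed m_closed)
    also have "\<dots> = \<pi> (g \<otimes> h)"
      unfolding \<pi>_W[OF c] using hc g by (intro Q.l_one \<pi>.hom_closed) simp
    finally show ?thesis .
  qed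
  let ?A = "(G Mod W)\<lparr>carrier := \<pi> ` H\<rparr>"
  have subA: "subgroup (\<pi> ` H) (G Mod W)" by (rule \<pi>.subgroup_img_is_subgroup[OF H])
  interpret A: comm_group ?A
  proof (rule group.group_comm_groupI[OF Q.subgroup_imp_group[OF subA]])
    fix u v assume "u \<in> carrier ?A" "v \<in> carrier ?A"
    then obtain g h where "g \<in> H" "h \<in> H" "u = \<pi> g" "v = \<pi> h" by auto
    then show "u \<otimes>\<^bsub>?A\<^esub> v = v \<otimes>\<^bsub>?A\<^esub> u"
      using central[of g h] \<pi>.hom_mult[of g h] \<pi>.hom_mult[of h g] H.mem_carrier by simp
  qed
  have "finite (carrier ?A)"
    using finite_quotient[OF W(1,2)] subgroup.subset[OF subA] finite_subset by auto
  moreover have "a [^]\<^bsub>?A\<^esub> n = \<one>\<^bsub>?A\<^esub>" if a: "a \<in> carrier ?A" for a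
  proof -
    obtain h where h: "h \<in> H" "a = \<pi> h" using a by auto
    have "a [^]\<^bsub>?A\<^esub> n = a [^]\<^bsub>G Mod W\<^esub> n" by (simp add: nat_pow_def)
    also have "\<dots> = \<pi> (h [^] n)" using h H.mem_carrier \<pi>.hom_nat_pow by simp
    also have "\<dots> = \<one>\<^bsub>G Mod W\<^esub>" using pow[OF h(1)] W(3) by (intro \<pi>_W) blast
    finally show ?thesis by simp
  qed
  moreover have "\<pi> x \<in> carrier ?A" using x by simp
  moreover have "\<pi> x \<noteq> \<one>\<^bsub>?A\<^esub>"
  proof
    assume "\<pi> x = \<one>\<^bsub>?A\<^esub>"
    then have "W #> x = W" by (simp add: \<pi>_def)
    then show False
      using rcos_self[OF H.mem_carrier[OF x(1)] W.subgroup_axioms] W(4) by simp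
  qed
  ultimately obtain \<theta> :: "'a set \<Rightarrow> int" where
    \<theta>: "\<And>u v. u \<in> carrier ?A \<Longrightarrow> v \<in> carrier ?A \<Longrightarrow>
      [\<theta> (u \<otimes>\<^bsub>?A\<^esub> v) = \<theta> u + \<theta> v] (mod int n)"
    and \<theta>x: "\<not> [\<theta> (\<pi> x) = 0] (mod int n)"
    using A.character_separates[OF _ n_pos, of "\<pi> x"] by blast
  define M where "M = {g \<in> carrier G. \<pi> g \<in> \<pi> ` H}"
  define \<phi> where "\<phi> g = \<theta> (\<pi> g) mod int n" for g
  have M_I: "g \<in> M" if "g \<in> carrier G" "\<pi> g \<in> \<pi> ` H" for g using that by (simp add: M_def)
  have M_D: "g \<in> carrier G" "\<pi> g \<in> \<pi> ` H" if "g \<in> M" for g using that by (simp_all add: M_def)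
  have M_sub: "subgroup M G"
  proof (rule subgroupI)
    show "M \<subseteq> carrier G" using M_D by blast
    show "M \<noteq> {}" using M_I[of \<one>] H.one_closed by blast
    show "inv a \<in> M" if a: "a \<in> M" for a
    proof (rule M_I)
      have "\<pi> (inv a) = inv\<^bsub>G Mod W\<^esub> \<pi> a" using M_D[OF a] by simp
      then show "\<pi> (inv a) \<in> \<pi> ` H" using subgroup.m_inv_closed[OF subA M_D(2)[OF a]] by simp
    qed (simp add: M_D[OF a])
    show "a \<otimes> b \<in> M" if a: "a \<in> M" and b: "b \<in> M" for a b
    proof (rule M_I)
      show "\<pi> (a \<otimes> b) \<in> \<pi> ` H"
        using subgroup.m_closed[OF subA M_D(2)[OF a] M_D(2)[OF b]] M_D(1) a b by simp
    qed (simp add: M_D a b)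
  qed
  show thesis
  proof (rule that)
    show "subgroup M G" by (rule M_sub)
    show "H \<subseteq> M" using M_I H.mem_carrier by blast
    have "W \<subseteq> M"
    proof
      fix w assume w: "w \<in> W"
      show "w \<in> M"
        using \<pi>_W[OF w] \<pi>.hom_one H.one_closed W.mem_carrier[OF w] by (intro M_I) (metis imageI)+
    qed
    then show "openin T M" by (rule openin_subgroup_superset[OF M_sub W.subgroup_axioms W(2)])
    show "0 \<le> \<phi> m \<and> \<phi> m < int n" for m using n_pos by (simp add: \<phi>_def)
    show "\<phi> (a \<otimes> b) = (\<phi> a + \<phi> b) mod int n" if "a \<in> M" "b \<in> M" for a b
      using \<theta>[of "\<pi> a" "\<pi> b"] M_D that \<pi>.hom_mult[of a b]
      by (simp add: \<phi>_def cong_def mod_simps)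
    show "inv g \<otimes> m \<otimes> g \<in> M \<and> \<phi> (inv g \<otimes> m \<otimes> g) = \<phi> m" if g: "g \<in> carrier G" and m: "m \<in> M" for g m
    proof -
      obtain h where h: "h \<in> H" "\<pi> m = \<pi> h" using M_D[OF m] by blast
      have hc: "h \<in> carrier G" using h(1) by (rule H.mem_carrier)
      have "\<pi> (inv g \<otimes> m \<otimes> g) = \<pi> (inv g) \<otimes>\<^bsub>G Mod W\<^esub> \<pi> h \<otimes>\<^bsub>G Mod W\<^esub> \<pi> g"
        using g M_D[OF m] by (simp add: h(2) del: mult_FactGroup)
      also have "\<dots> = \<pi> (inv g) \<otimes>\<^bsub>G Mod W\<^esub> \<pi> (h \<otimes> g)"
        using g hc by (simp add: Q.m_assoc del: mult_FactGroup)
      also have "\<dots> = \<pi> (inv g \<otimes> (g \<otimes> h))"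
        unfolding central[OF h(1) g] by (rule \<pi>.hom_mult[symmetric]) (use g hc in simp_all)
      also have "inv g \<otimes> (g \<otimes> h) = h" using g hc by (simp add: m_assoc[symmetric])
      finally have "\<pi> (inv g \<otimes> m \<otimes> g) = \<pi> m" by (simp add: h(2))
      then show ?thesis using M_I[of "inv g \<otimes> m \<otimes> g"] M_D[OF m] g by (simp add: \<phi>_def)
    qed
    show "locally_constant T \<phi>"
      unfolding \<phi>_def \<pi>_def
      by (rule locally_constant_comp[OF locally_constant_coset[OF W.subgroup_axioms W(2)]])
    show "\<phi> x \<noteq> 0" using \<theta>x by (simp add: \<phi>_def cong_def)
  qed
qed

text \<open>The complement of \<open>V\<close> is compact, and it is covered by the open sets on which some character does
  not vanish.\<close>

lemma finitely_many_characters_suffice: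
  assumes V: "openin T V"
    and ker: "\<And>g. g \<in> carrier G \<Longrightarrow> (\<And>\<psi>. \<psi> \<in> X \<Longrightarrow> \<psi> g = 0) \<Longrightarrow> g \<in> V"
  obtains S where "finite S" and "S \<subseteq> X"
    and "\<And>g. g \<in> carrier G \<Longrightarrow> (\<And>\<psi>. \<psi> \<in> S \<Longrightarrow> \<psi> g = 0) \<Longrightarrow> g \<in> V"
proof -
  let ?N = "\<lambda>\<psi>. {g \<in> topspace T. \<psi> g \<noteq> 0}"
  have "\<forall>C\<in>insert V (?N ` X). openin T C"
    using V locally_constant_openin[OF H1_locally_constant, where P = "\<lambda>u. u \<noteq> 0"] by auto
  moreover have "topspace T \<subseteq> \<Union>(insert V (?N ` X))"
    using ker topspace_eq by auto
  ultimately obtain F where F: "finite F" "F \<subseteq> insert V (?N ` X)" "topspace T \<subseteq> \<Union>F"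
    using compact unfolding compact_space_def compactin_def by meson
  have "finite (F - {V})" "F - {V} \<subseteq> ?N ` X" using F by auto
  then obtain S where S: "S \<subseteq> X" "finite S" "F - {V} = ?N ` S"
    by (meson finite_subset_image)
  have "g \<in> V" if "g \<in> carrier G" "\<And>\<psi>. \<psi> \<in> S \<Longrightarrow> \<psi> g = 0" for g
  proof (rule ccontr)
    assume "g \<notin> V"
    then have "g \<in> \<Union>(F - {V})" using F(3) that(1) topspace_eq by blast
    then show False using S(3) that(2) by auto
  qed
  then show thesis using S that by blast
qed

end


section \<open>Dual systems of characters\<close>

text \<open>Surjectivity of \<open>H\<^sup>1(G, \<int>/q) \<rightarrow> H\<^sup>1(G, \<int>/p\<^sup>i)\<close> says that a character divisible by a power of
  \<open>p\<close> pointwise is divisible by it in \<open>H\<^sup>1\<close>; so the characters form a free \<open>\<int>/q\<close>-module as far as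
  finite sets are concerned.\<close>

locale lifting_setting = profinite_setting G T n for G (structure) and T n +
  fixes p d :: nat
  assumes prime: "prime p" and d_pos: "d \<ge> 1" and n_eq: "n = p ^ d"
    and lift: "\<And>i \<theta>. 1 \<le> i \<Longrightarrow> i \<le> d \<Longrightarrow> \<theta> \<in> carrier (H1 (p ^ i) G T) \<Longrightarrow>
      \<exists>\<psi>\<in>X. \<forall>g\<in>carrier G. \<theta> g = \<psi> g mod int (p ^ i)"
begin

text \<open>The characters \<open>\<eta> i\<close> are coordinates identifying \<open>G\<close> modulo their common kernel with
  \<open>(\<int>/n)\<^sup>k\<close>.\<close>

definition dual_system :: "nat \<Rightarrow> (nat \<Rightarrow> 'a \<Rightarrow> int) \<Rightarrow> (nat \<Rightarrow> 'a) \<Rightarrow> bool" where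
  "dual_system k \<eta> e \<longleftrightarrow> (\<forall>i<k. \<eta> i \<in> X \<and> e i \<in> carrier G) \<and>
     (\<forall>i<k. \<forall>j<k. \<eta> i (e j) = (if i = j then 1 else 0))"

lemma n_gt_1: "n > 1"
  unfolding n_eq using prime_gt_1_nat[OF prime] d_pos by (intro one_less_power) simp_all

text \<open>The projection of \<open>\<psi>\<close> to the characters that vanish at all \<open>e j\<close>, along the span of the
  \<open>\<eta> j\<close>.\<close>

definition residual :: "nat \<Rightarrow> (nat \<Rightarrow> 'a \<Rightarrow> int) \<Rightarrow> (nat \<Rightarrow> 'a) \<Rightarrow> ('a \<Rightarrow> int) \<Rightarrow> 'a \<Rightarrow> int" where
  "residual k \<eta> e \<psi> = (\<lambda>g\<in>carrier G. (\<psi> g - (\<Sum>j<k. \<psi> (e j) * \<eta> j g)) mod int n)"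

lemma residual_cong:
  "g \<in> carrier G \<Longrightarrow> [residual k \<eta> e \<psi> g = \<psi> g - (\<Sum>j<k. \<psi> (e j) * \<eta> j g)] (mod int n)"
  by (simp add: residual_def cong_def)

lemma residual_H1:
  assumes D: "dual_system k \<eta> e" and \<psi>: "\<psi> \<in> X"
  shows "residual k \<eta> e \<psi> \<in> X"
  unfolding residual_def
proof (rule H1_restrict_mod)
  have \<eta>: "\<eta> j \<in> X" if "j < k" for j using D that by (simp add: dual_system_def)
  have "locally_constant T (\<lambda>g. \<Sum>j<l. \<psi> (e j) * \<eta> j g)" if "l \<le> k" for l
    using that
  proof (induction l)
    case (Suc l)
    then show ?case
      using locally_constant_comp2[of T "\<lambda>g. \<Sum>j<l. \<psi> (e j) * \<eta> j g" "\<eta> l" "\<lambda>u v. u + \<psi> (e l) * v"]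
        H1_locally_constant[OF \<eta>[of l]] by simp
  qed simp
  from this[OF order_refl] show "locally_constant T (\<lambda>g. \<psi> g - (\<Sum>j<k. \<psi> (e j) * \<eta> j g))"
    by (rule locally_constant_comp2[where F = "(-)", OF H1_locally_constant[OF \<psi>]])
  fix g h assume gh: "g \<in> carrier G" "h \<in> carrier G"
  have "[\<psi> (g \<otimes> h) - (\<Sum>j<k. \<psi> (e j) * \<eta> j (g \<otimes> h)) =
      (\<psi> g + \<psi> h) - (\<Sum>j<k. \<psi> (e j) * (\<eta> j g + \<eta> j h))] (mod int n)"
    by (intro cong_diff cong_sum cong_mult cong_refl) (simp_all add: cong_def H1_hom gh \<psi> \<eta>)
  then show "(\<psi> (g \<otimes> h) - (\<Sum>j<k. \<psi> (e j) * \<eta> j (g \<otimes> h))) mod int n =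
      (\<psi> g - (\<Sum>j<k. \<psi> (e j) * \<eta> j g) + (\<psi> h - (\<Sum>j<k. \<psi> (e j) * \<eta> j h))) mod int n"
    by (simp add: cong_def algebra_simps sum.distrib)
qed

lemma residual_dual:
  assumes D: "dual_system k \<eta> e" and \<psi>: "\<psi> \<in> X" and i: "i < k"
  shows "residual k \<eta> e \<psi> (e i) = 0"
proof -
  have "(\<Sum>j<k. \<psi> (e j) * \<eta> j (e i)) = (\<Sum>j<k. if j = i then \<psi> (e j) else 0)"
    using D i by (intro sum.cong) (auto simp: dual_system_def)
  also have "\<dots> = \<psi> (e i)" using i by simp
  finally show ?thesis using D i by (simp add: residual_def dual_system_def)
qed

lemma element_with_coordinates:
  fixes c :: "nat \<Rightarrow> nat"
  assumes "\<And>i. i < k \<Longrightarrow> e i \<in> carrier G"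
  obtains h where "h \<in> carrier G"
    and "\<And>\<psi>. \<psi> \<in> X \<Longrightarrow> [\<psi> h = (\<Sum>j<k. int (c j) * \<psi> (e j))] (mod int n)"
  using assms
proof (induction k arbitrary: thesis)
  case 0
  then show ?case using one_closed by (metis H1_one_arg cong_refl lessThan_0 sum.empty)
next
  case (Suc k)
  obtain h where h: "h \<in> carrier G"
    "\<And>\<psi>. \<psi> \<in> X \<Longrightarrow> [\<psi> h = (\<Sum>j<k. int (c j) * \<psi> (e j))] (mod int n)"
    using Suc.IH Suc.prems(2) by (metis less_Suc_eq)
  have e: "e k \<in> carrier G" using Suc.prems(2) by simp
  show ?case
  proof (rule Suc.prems(1))
    show "h \<otimes> e k [^] c k \<in> carrier G" using h e by simp
    fix \<psi> assume \<psi>: "\<psi> \<in> X"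
    have "[\<psi> (h \<otimes> e k [^] c k) = \<psi> h + int (c k) * \<psi> (e k)] (mod int n)"
      using h e \<psi> by (simp add: H1_hom H1_pow cong_def mod_simps)
    also have "[\<psi> h + int (c k) * \<psi> (e k) = (\<Sum>j<k. int (c j) * \<psi> (e j)) + int (c k) * \<psi> (e k)] (mod int n)"
      by (intro cong_add h \<psi> cong_refl)
    finally show "[\<psi> (h \<otimes> e k [^] c k) = (\<Sum>j<Suc k. int (c j) * \<psi> (e j))] (mod int n)" by simp
  qed
qed

text \<open>Divide a nonzero character by the largest power \<open>p\<^sup>m\<close> that divides all its values.  The quotient
  is a character modulo \<open>p\<^sup>d\<^sup>-\<^sup>m\<close>, and \<open>\<omega>\<close> is a lift of it.\<close>

lemma primitive_part:
  assumes \<psi>: "\<psi> \<in> X" and nz: "\<exists>g\<in>carrier G. \<psi> g \<noteq> 0"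
  obtains m \<omega> g0 where "m < d" and "\<omega> \<in> X" and "g0 \<in> carrier G"
    and "\<not> int p ^ Suc m dvd \<psi> g0"
    and "\<And>g. g \<in> carrier G \<Longrightarrow> [int p ^ m * \<omega> g = \<psi> g] (mod int n)"
proof -
  define P where "P m \<longleftrightarrow> (\<forall>g\<in>carrier G. int p ^ m dvd \<psi> g)" for m
  have "\<not> P d"
  proof
    assume P: "P d"
    have "\<psi> g = 0" if g: "g \<in> carrier G" for g
    proof -
      have "int n dvd \<psi> g" using P g by (simp add: P_def n_eq)
      then show ?thesis using H1_mod[OF \<psi> g] by (simp add: mod_eq_0_iff_dvd)
    qed
    then show False using nz by blast
  qed
  define l where "l = (LEAST m. \<not> P m)"
  have l: "\<not> P l" "l \<le> d" unfolding l_def using \<open>\<not> P d\<close> by (rule LeastI, rule Least_le)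
  have "P 0" by (simp add: P_def)
  then obtain m where m: "l = Suc m" using l(1) by (cases l) auto
  have Pm: "P m" using not_less_Least[of m "\<lambda>m. \<not> P m"] m unfolding l_def by simp
  obtain g0 where g0: "g0 \<in> carrier G" "\<not> int p ^ Suc m dvd \<psi> g0"
    using l(1) unfolding m P_def by blast
  have md: "m < d" using l(2) m by simp
  define i where "i = d - m"
  have i: "1 \<le> i" "i \<le> d" and n_split: "int n = int p ^ m * int (p ^ i)"
    using md by (simp_all add: i_def n_eq flip: power_add)
  have p0: "int p ^ m > 0" "p ^ i > 0" using prime_gt_0_nat[OF prime] by simp_all
  interpret I: coefficient_setting G T "p ^ i" by unfold_locales (rule p0(2))
  define \<theta> where "\<theta> = (\<lambda>g\<in>carrier G. \<psi> g div int p ^ m)"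
  have \<theta>: "\<psi> g = int p ^ m * \<theta> g" if "g \<in> carrier G" for g
    using Pm that by (simp add: \<theta>_def P_def)
  have "\<theta> \<in> carrier (H1 (p ^ i) G T)"
    unfolding I.H1_iff I.C1_iff
  proof (intro conjI ballI)
    show "\<theta> \<in> extensional (carrier G)" by (simp add: \<theta>_def)
    have "locally_constant T \<theta> = locally_constant T (\<lambda>g. \<psi> g div int p ^ m)"
      by (rule locally_constant_cong) (simp add: \<theta>_def topspace_eq)
    then show "locally_constant T \<theta>"
      using locally_constant_comp[OF H1_locally_constant[OF \<psi>]] by simp
    fix g assume g: "g \<in> carrier G"
    show "0 \<le> \<theta> g" using H1_range[OF \<psi> g] p0 by (simp add: \<theta>[OF g] zero_le_mult_iff)
    have "int p ^ m * \<theta> g < int p ^ m * int (p ^ i)"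
      using H1_range[OF \<psi> g] by (simp only: \<theta>[OF g, symmetric] n_split[symmetric])
    then show "\<theta> g < int (p ^ i)" using p0(1) by (simp only: mult_less_cancel_left_pos)
    fix h assume h: "h \<in> carrier G"
    have "int p ^ m * \<theta> (g \<otimes> h) = (int p ^ m * (\<theta> g + \<theta> h)) mod (int p ^ m * int (p ^ i))"
      using H1_hom[OF \<psi> g h] g h by (simp only: \<theta>[symmetric] m_closed n_split[symmetric] distrib_left)
    also have "\<dots> = int p ^ m * ((\<theta> g + \<theta> h) mod int (p ^ i))" by (rule mult_mod_right[symmetric])
    finally show "\<theta> (g \<otimes> h) = (\<theta> g + \<theta> h) mod int (p ^ i)"
      using p0(1) by (metis less_irrefl mult_cancel_left)
  qed
  then obtain \<omega> where \<omega>: "\<omega> \<in> X" "\<And>g. g \<in> carrier G \<Longrightarrow> \<theta> g = \<omega> g mod int (p ^ i)"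
    using lift[OF i] by blast
  have "[int p ^ m * \<omega> g = \<psi> g] (mod int n)" if g: "g \<in> carrier G" for g
  proof -
    have "(int p ^ m * \<omega> g) mod int n = int p ^ m * (\<omega> g mod int (p ^ i))"
      unfolding n_split by (rule mult_mod_right[symmetric])
    also have "\<dots> = \<psi> g" using \<omega>(2)[OF g] \<theta>[OF g] by simp
    finally show ?thesis using H1_mod[OF \<psi> g] by (simp add: cong_def)
  qed
  then show thesis using md \<omega>(1) g0 that by blast
qed

text \<open>The residual of \<open>\<psi>\<close> is \<open>p\<^sup>m\<close> times a character \<open>\<omega>\<close> that takes a unit value; the residual of \<open>\<omega>\<close>
  still has both properties, so a suitable power of an element of the common kernel of the \<open>\<eta> j\<close> is dual to it.\<close>

lemma dual_system_adjoin:
  assumes D: "dual_system k \<eta> e" and \<psi>: "\<psi> \<in> X"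
  obtains k' \<eta>' e' where "dual_system k' \<eta>' e'"
    and "\<And>g. g \<in> carrier G \<Longrightarrow> (\<And>i. i < k' \<Longrightarrow> \<eta>' i g = 0) \<Longrightarrow> \<psi> g = 0 \<and> (\<forall>i<k. \<eta> i g = 0)"
proof -
  let ?\<rho> = "residual k \<eta> e"
  have \<eta>: "\<eta> j \<in> X" "e j \<in> carrier G" if "j < k" for j using D that by (simp_all add: dual_system_def)
  have recover: "\<psi> g = 0" if g: "g \<in> carrier G" "?\<rho> \<psi> g = 0" "\<And>i. i < k \<Longrightarrow> \<eta> i g = 0" for g
  proof -
    have "[\<psi> g - (\<Sum>j<k. \<psi> (e j) * \<eta> j g) = 0] (mod int n)"
      using residual_cong[OF g(1), of k \<eta> e \<psi>] by (simp add: g(2) cong_sym)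
    then have "\<psi> g mod int n = 0" using g(3) by (simp add: cong_def)
    then show ?thesis using \<psi> g(1) by simp
  qed
  show thesis
  proof (cases "\<exists>g\<in>carrier G. ?\<rho> \<psi> g \<noteq> 0")
    case False
    then show thesis using recover by (intro that[OF D]) auto
  next
    case True
    obtain m \<omega>0 g0 where m: "m < d" and \<omega>0: "\<omega>0 \<in> X" and g0: "g0 \<in> carrier G"
      and not_dvd: "\<not> int p ^ Suc m dvd ?\<rho> \<psi> g0"
      and mult: "\<And>g. g \<in> carrier G \<Longrightarrow> [int p ^ m * \<omega>0 g = ?\<rho> \<psi> g] (mod int n)"
      using primitive_part[OF residual_H1[OF D \<psi>] True] by blast
    define \<omega> where "\<omega> = ?\<rho> \<omega>0"
    have \<omega>: "\<omega> \<in> X" unfolding \<omega>_def by (rule residual_H1[OF D \<omega>0])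
    have \<omega>e: "\<omega> (e i) = 0" if "i < k" for i unfolding \<omega>_def by (rule residual_dual[OF D \<omega>0 that])
    have \<omega>_mult: "[int p ^ m * \<omega> g = ?\<rho> \<psi> g] (mod int n)" if g: "g \<in> carrier G" for g
    proof -
      have "[int p ^ m * \<omega> g = int p ^ m * (\<omega>0 g - (\<Sum>j<k. \<omega>0 (e j) * \<eta> j g))] (mod int n)"
        unfolding \<omega>_def by (intro cong_mult residual_cong g cong_refl)
      also have "int p ^ m * (\<omega>0 g - (\<Sum>j<k. \<omega>0 (e j) * \<eta> j g)) =
          int p ^ m * \<omega>0 g - (\<Sum>j<k. (int p ^ m * \<omega>0 (e j)) * \<eta> j g)"
        by (simp add: right_diff_distrib sum_distrib_left mult.assoc)
      also have "[\<dots> = ?\<rho> \<psi> g - (\<Sum>j<k. ?\<rho> \<psi> (e j) * \<eta> j g)] (mod int n)"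
        by (intro cong_diff cong_sum cong_mult mult g \<eta> cong_refl) auto
      also have "(\<Sum>j<k. ?\<rho> \<psi> (e j) * \<eta> j g) = 0"
        using residual_dual[OF D \<psi>] by simp
      finally show ?thesis by simp
    qed
    have "\<not> int p dvd \<omega> g0"
    proof
      assume "int p dvd \<omega> g0"
      then have "int p ^ Suc m dvd int p ^ m * \<omega> g0" by (simp add: mult.commute mult_dvd_mono)
      moreover have "int p ^ Suc m dvd int n" 
        unfolding n_eq of_nat_power by (rule le_imp_power_dvd) (use m in simp)
      ultimately have "int p ^ Suc m dvd ?\<rho> \<psi> g0"
        using \<omega>_mult[OF g0] by (meson cong_dvd_iff cong_dvd_modulus)
      then show False using not_dvd by simp
    qed
    then have "coprime (\<omega> g0) (int n)"
      using prime by (simp add: n_eq prime_imp_coprime coprime_commute)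
    then obtain z where z: "[\<omega> g0 * z = 1] (mod int n)" using cong_solve_coprime_int by blast
    define u where "u = nat (z mod int n)"
    have u: "[int u * \<omega> g0 = 1] (mod int n)"
      using z n_pos by (simp add: u_def cong_def mod_simps mult.commute)
    obtain h where h: "h \<in> carrier G"
      and coord: "\<And>\<psi>. \<psi> \<in> X \<Longrightarrow> [\<psi> h = (\<Sum>j<k. int (nat ((- \<eta> j g0) mod int n)) * \<psi> (e j))] (mod int n)"
      using element_with_coordinates[of k e "\<lambda>j. nat ((- \<eta> j g0) mod int n)"] \<eta> by blast
    define f where "f = (g0 \<otimes> h) [^] u"
    have f: "f \<in> carrier G" using g0 h by (simp add: f_def)
    have \<eta>f: "\<eta> i f = 0" if i: "i < k" for i
    proof -
      have "(\<Sum>j<k. int (nat ((- \<eta> j g0) mod int n)) * \<eta> i (e j)) =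
          (\<Sum>j<k. if j = i then (- \<eta> j g0) mod int n else 0)"
        using D i n_pos by (intro sum.cong) (auto simp: dual_system_def)
      also have "\<dots> = (- \<eta> i g0) mod int n" using i by simp
      finally have "[\<eta> i h = - \<eta> i g0] (mod int n)"
        using coord[OF \<eta>(1)[OF i]] by (simp add: cong_def)
      then have "[\<eta> i g0 + \<eta> i h = \<eta> i g0 + - \<eta> i g0] (mod int n)" by (intro cong_add cong_refl)
      then have "\<eta> i (g0 \<otimes> h) = 0" using \<eta>(1)[OF i] g0 h by (simp add: H1_hom cong_def)
      then show ?thesis using \<eta>(1)[OF i] g0 h by (simp add: f_def H1_pow)
    qed
    have \<omega>f: "\<omega> f = 1"
    proof -
      have "[\<omega> h = 0] (mod int n)" using coord[OF \<omega>] \<omega>e by simp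
      then have "\<omega> h = 0" using H1_mod[OF \<omega> h] by (simp add: cong_def)
      then have "\<omega> (g0 \<otimes> h) = \<omega> g0" using \<omega> g0 h by (simp add: H1_hom)
      then have "\<omega> f = (int u * \<omega> g0) mod int n" using \<omega> g0 h by (simp add: f_def H1_pow)
      also have "\<dots> = 1" using u n_gt_1 by (simp add: cong_def)
      finally show ?thesis .
    qed
    have D': "dual_system (Suc k) (\<eta>(k := \<omega>)) (e(k := f))"
      using D \<omega> f \<omega>e \<eta>f \<omega>f by (auto simp: dual_system_def less_Suc_eq)
    show thesis
    proof (rule that[OF D'])
      fix g assume g: "g \<in> carrier G" "\<And>i. i < Suc k \<Longrightarrow> (\<eta>(k := \<omega>)) i g = 0"
      have \<eta>g: "\<eta> i g = 0" if "i < k" for i using g(2)[of i] that by simp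
      have "\<omega> g = 0" using g(2)[of k] by simp
      then have "[0 = ?\<rho> \<psi> g] (mod int n)" using \<omega>_mult[OF g(1)] by simp
      then have "?\<rho> \<psi> g = 0" using H1_mod[OF residual_H1[OF D \<psi>] g(1)] by (simp add: cong_def)
      then show "\<psi> g = 0 \<and> (\<forall>i<k. \<eta> i g = 0)" using recover g(1) \<eta>g by blast
    qed
  qed
qed

lemma dual_system_exists:
  assumes "finite S" and "S \<subseteq> X"
  obtains k \<eta> e where "dual_system k \<eta> e"
    and "\<And>g \<psi>. g \<in> carrier G \<Longrightarrow> (\<And>i. i < k \<Longrightarrow> \<eta> i g = 0) \<Longrightarrow> \<psi> \<in> S \<Longrightarrow> \<psi> g = 0"
  using assms
proof (induction S arbitrary: thesis rule: finite_induct)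
  case empty
  have "dual_system 0 (\<lambda>_ _. 0) (\<lambda>_. \<one>)" by (simp add: dual_system_def)
  then show ?case using empty(1) by blast
next
  case (insert \<psi> S)
  obtain k \<eta> e where D: "dual_system k \<eta> e"
    and ker: "\<And>g \<psi>. g \<in> carrier G \<Longrightarrow> (\<And>i. i < k \<Longrightarrow> \<eta> i g = 0) \<Longrightarrow> \<psi> \<in> S \<Longrightarrow> \<psi> g = 0"
    using insert.IH insert.prems(2) by blast
  have "\<psi> \<in> X" using insert.prems(2) by simp
  then obtain k' \<eta>' e' where D': "dual_system k' \<eta>' e'"
    and ker': "\<And>g. g \<in> carrier G \<Longrightarrow> (\<And>i. i < k' \<Longrightarrow> \<eta>' i g = 0) \<Longrightarrow> \<psi> g = 0 \<and> (\<forall>i<k. \<eta> i g = 0)"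
    using dual_system_adjoin[OF D] by blast
  show ?case
  proof (rule insert.prems(1)[OF D'])
    fix g \<psi>' assume "g \<in> carrier G" "\<And>i. i < k' \<Longrightarrow> \<eta>' i g = 0" "\<psi>' \<in> insert \<psi> S"
    then show "\<psi>' g = 0" using ker'[of g] ker[of g \<psi>'] by auto
  qed
qed

end

section \<open>Extending invariant homomorphisms to cochains\<close>

lemma (in group) inv_cancel:
  assumes "a \<in> carrier G" and "b \<in> carrier G"
  shows "inv a \<otimes> (a \<otimes> b) = b" and "a \<otimes> (inv a \<otimes> b) = b"
  using assms by (simp_all add: m_assoc[symmetric])

context coefficient_setting
begin

text \<open>The values are not reduced modulo \<open>n\<close>, since \<open>has_coboundary\<close> compares modulo \<open>n\<close> anyway; this
  keeps the closure properties literal.\<close>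

inductive_set cup_carry_span :: "('a \<Rightarrow> 'a \<Rightarrow> int) set" where
  cup: "\<psi> \<in> X \<Longrightarrow> \<psi>' \<in> X \<Longrightarrow> (\<lambda>g h. \<psi> g * \<psi>' h) \<in> cup_carry_span"
| carry: "\<psi> \<in> X \<Longrightarrow> (\<lambda>g h. (\<psi> g + \<psi> h) div int n) \<in> cup_carry_span"
| zero: "(\<lambda>g h. 0) \<in> cup_carry_span"
| add: "f \<in> cup_carry_span \<Longrightarrow> f' \<in> cup_carry_span \<Longrightarrow> (\<lambda>g h. f g h + f' g h) \<in> cup_carry_span"
| minus: "f \<in> cup_carry_span \<Longrightarrow> (\<lambda>g h. - f g h) \<in> cup_carry_span"

lemma cup_carry_span_scale:
  assumes "f \<in> cup_carry_span"
  shows "(\<lambda>g h. int k * f g h) \<in> cup_carry_span"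
proof (induction k)
  case 0
  then show ?case by (simp add: cup_carry_span.zero)
next
  case (Suc k)
  have "(\<lambda>g h. int (Suc k) * f g h) = (\<lambda>g h. f g h + int k * f g h)"
    by (simp add: algebra_simps)
  then show ?case using cup_carry_span.add[OF assms Suc] by simp
qed

lemma cup_carry_span_pullback:
  assumes \<pi>: "\<And>\<psi>. \<psi> \<in> X \<Longrightarrow> \<exists>\<psi>'\<in>X. \<forall>g\<in>carrier G. \<psi> (\<pi> g) = \<psi>' g"
    and f: "f \<in> cup_carry_span"
  shows "\<exists>f'\<in>cup_carry_span. \<forall>g\<in>carrier G. \<forall>h\<in>carrier G. f (\<pi> g) (\<pi> h) = f' g h"
  using f
proof induction
  case (cup \<psi> \<psi>')
  obtain \<omega> \<omega>' where "\<omega> \<in> X" "\<omega>' \<in> X" "\<forall>g\<in>carrier G. \<psi> (\<pi> g) = \<omega> g" "\<forall>g\<in>carrier G. \<psi>' (\<pi> g) = \<omega>' g"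
    using \<pi>[OF cup(1)] \<pi>[OF cup(2)] by blast
  then show ?case by (intro bexI[OF _ cup_carry_span.cup[of \<omega> \<omega>']]) simp_all
next
  case (carry \<psi>)
  obtain \<omega> where "\<omega> \<in> X" "\<forall>g\<in>carrier G. \<psi> (\<pi> g) = \<omega> g" using \<pi>[OF carry] by blast
  then show ?case by (intro bexI[OF _ cup_carry_span.carry[of \<omega>]]) simp_all
next
  case zero
  show ?case by (intro bexI[OF _ cup_carry_span.zero]) simp
next
  case (add f f')
  obtain u u' where "u \<in> cup_carry_span" "u' \<in> cup_carry_span"
    "\<forall>g\<in>carrier G. \<forall>h\<in>carrier G. f (\<pi> g) (\<pi> h) = u g h"
    "\<forall>g\<in>carrier G. \<forall>h\<in>carrier G. f' (\<pi> g) (\<pi> h) = u' g h"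
    using add.IH by blast
  then show ?case by (intro bexI[OF _ cup_carry_span.add[of u u']]) simp_all
next
  case (minus f)
  obtain u where "u \<in> cup_carry_span" "\<forall>g\<in>carrier G. \<forall>h\<in>carrier G. f (\<pi> g) (\<pi> h) = u g h"
    using minus.IH by blast
  then show ?case by (intro bexI[OF _ cup_carry_span.minus[of u]]) simp_all
qed

end

context lifting_setting
begin

text \<open>By induction on \<open>l\<close> the homomorphism \<open>\<phi>\<close> is extended to the subgroup \<open>L l\<close> generated by \<open>M\<close> and
  \<open>e 0, \<dots>, e (l - 1)\<close>, namely to the common kernel of the remaining characters: with \<open>t = e l\<close> and
  \<open>\<theta> = \<eta> l\<close> every \<open>x \<in> L (l + 1)\<close> is \<open>\<pi> x \<cdot> t\<^sup>a\<close> with \<open>a = \<theta> x\<close> and \<open>\<pi> x \<in> L l\<close>, and the new cochain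
  is \<open>y \<circ> \<pi>\<close>.  For \<open>x = u t\<^sup>a\<close> and \<open>z = v t\<^sup>b\<close> one has \<open>\<pi> (x z) = u v [\<dots>] (t\<^sup>n)\<^sup>c\<close>, where \<open>c\<close> is the carry
  of \<open>a + b\<close> and the commutator of \<open>v\<close> and \<open>t\<^sup>a\<close> contributes \<open>a \<kappa>(v)\<close> for a character \<open>\<kappa>\<close>.\<close>

lemma extension_of_invariant_character:
  assumes D: "dual_system k \<eta> e"
    and M_def: "M = {g \<in> carrier G. \<forall>i<k. \<eta> i g = 0}"
    and \<phi>_range: "\<And>m. m \<in> M \<Longrightarrow> 0 \<le> \<phi> m \<and> \<phi> m < int n"
    and \<phi>_add: "\<And>a b. a \<in> M \<Longrightarrow> b \<in> M \<Longrightarrow> \<phi> (a \<otimes> b) = (\<phi> a + \<phi> b) mod int n"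
    and \<phi>_conj: "\<And>g m. g \<in> carrier G \<Longrightarrow> m \<in> M \<Longrightarrow> \<phi> (inv g \<otimes> m \<otimes> g) = \<phi> m"
    and \<phi>_lc: "locally_constant T \<phi>"
  obtains y f where "y \<in> C1" and "f \<in> cup_carry_span" and "has_coboundary y f"
    and "\<And>m. m \<in> M \<Longrightarrow> y m = \<phi> m"
proof -
  have \<eta>: "\<eta> i \<in> X" "e i \<in> carrier G" if "i < k" for i using D that by (simp_all add: dual_system_def)
  have \<eta>_e: "\<eta> i (e j) = (if i = j then 1 else 0)" if "i < k" "j < k" for i j
    using D that by (simp add: dual_system_def)
  have M_I: "g \<in> M" if "g \<in> carrier G" "\<And>i. i < k \<Longrightarrow> \<eta> i g = 0" for g using that by (simp add: M_def)
  have M_D: "g \<in> carrier G" "\<And>i. i < k \<Longrightarrow> \<eta> i g = 0" if "g \<in> M" for g using that by (simp_all add: M_def)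
  have M_one: "\<one> \<in> M" by (rule M_I) (simp_all add: \<eta>)
  have M_mult: "a \<otimes> b \<in> M" if a: "a \<in> M" and b: "b \<in> M" for a b
    by (rule M_I) (simp_all add: H1_hom \<eta> M_D[OF a] M_D[OF b])
  have M_conj: "inv g \<otimes> m \<otimes> g \<in> M" if g: "g \<in> carrier G" and m: "m \<in> M" for g m
    by (rule M_I) (simp_all add: g H1_hom H1_inv \<eta> M_D[OF m] mod_simps)
  have M_comm: "inv w \<otimes> v \<otimes> w \<otimes> inv v \<in> M" if w: "w \<in> carrier G" and v: "v \<in> carrier G" for w v
    by (rule M_I) (simp_all add: w v H1_hom H1_inv \<eta> mod_simps)
  have \<phi>_cong: "[\<phi> (a \<otimes> b) = \<phi> a + \<phi> b] (mod int n)" if "a \<in> M" "b \<in> M" for a b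
    using \<phi>_add[OF that] by (simp add: cong_def)
  have \<phi>_one: "\<phi> \<one> = 0"
  proof -
    have "[\<phi> \<one> + \<phi> \<one> = \<phi> \<one>] (mod int n)" using cong_sym[OF \<phi>_cong[OF M_one M_one]] by simp
    then have "[\<phi> \<one> = 0] (mod int n)" by (simp only: cong_add_lcancel_0)
    then show ?thesis using \<phi>_range[OF M_one] by (simp add: cong_def)
  qed
  have \<phi>_conj': "\<phi> (g \<otimes> m \<otimes> inv g) = \<phi> m" "g \<otimes> m \<otimes> inv g \<in> M"
    if "g \<in> carrier G" "m \<in> M" for g m
    using \<phi>_conj[of "inv g" m] M_conj[of "inv g" m] that by simp_all

  define L where "L l = {g \<in> carrier G. \<forall>i<k. l \<le> i \<longrightarrow> \<eta> i g = 0}" for l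
  have L_I: "g \<in> L l" if "g \<in> carrier G" "\<And>i. i < k \<Longrightarrow> l \<le> i \<Longrightarrow> \<eta> i g = 0" for g l
    using that by (simp add: L_def)
  have L_D: "g \<in> carrier G" "\<And>i. i < k \<Longrightarrow> l \<le> i \<Longrightarrow> \<eta> i g = 0" if "g \<in> L l" for g l
    using that by (simp_all add: L_def)
  have L_mult: "a \<otimes> b \<in> L l" if a: "a \<in> L l" and b: "b \<in> L l" for a b l
    by (rule L_I) (simp_all add: H1_hom \<eta> L_D[OF a] L_D[OF b])
  have "\<exists>y f. f \<in> cup_carry_span \<and> (\<forall>m\<in>M. y m = \<phi> m) \<and>
      (\<forall>x\<in>L l. \<forall>m\<in>M. [y (x \<otimes> m) = y x + \<phi> m] (mod int n)) \<and>
      (\<forall>x\<in>L l. \<forall>z\<in>L l. [y z - y (x \<otimes> z) + y x = f x z] (mod int n))" if "l \<le> k" for l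
    using that
  proof (induction l)
    case 0
    have "L 0 = M" by (simp add: L_def M_def)
    moreover have "[\<phi> z - \<phi> (x \<otimes> z) + \<phi> x = 0] (mod int n)" if "x \<in> M" "z \<in> M" for x z
    proof -
      have "[\<phi> z - \<phi> (x \<otimes> z) + \<phi> x = \<phi> z - (\<phi> x + \<phi> z) + \<phi> x] (mod int n)"
        by (intro cong_add cong_diff cong_refl \<phi>_cong that)
      then show ?thesis by simp
    qed
    ultimately show ?case
      using \<phi>_cong by (intro exI[of _ \<phi>] exI[of _ "\<lambda>g h. 0"]) (simp add: cup_carry_span.zero)
  next
    case (Suc l)
    then have l: "l < k" "l \<le> k" by simp_all
    obtain y f where f: "f \<in> cup_carry_span" and y_M: "\<And>m. m \<in> M \<Longrightarrow> y m = \<phi> m"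
      and y_mult: "\<And>x m. x \<in> L l \<Longrightarrow> m \<in> M \<Longrightarrow> [y (x \<otimes> m) = y x + \<phi> m] (mod int n)"
      and y_cob: "\<And>x z. x \<in> L l \<Longrightarrow> z \<in> L l \<Longrightarrow> [y z - y (x \<otimes> z) + y x = f x z] (mod int n)"
      using Suc.IH[OF l(2)] by blast
    define \<theta> where "\<theta> = \<eta> l"
    define t where "t = e l"
    have \<theta>: "\<theta> \<in> X" and t: "t \<in> carrier G" using \<eta>[OF l(1)] by (simp_all add: \<theta>_def t_def)
    have \<theta>t: "\<theta> t = 1" using \<eta>_e[OF l(1) l(1)] by (simp add: \<theta>_def t_def)
    have \<eta>t: "\<eta> i t = 0" if "i < k" "i \<noteq> l" for i using \<eta>_e[OF that(1) l(1)] that by (simp add: t_def)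
    define a where "a x = nat (\<theta> x)" for x
    have a: "int (a x) = \<theta> x" if "x \<in> carrier G" for x
      using H1_range[OF \<theta> that] by (simp add: a_def)
    define \<pi> where "\<pi> x = x \<otimes> inv (t [^] a x)" for x
    have \<pi>_closed: "\<pi> x \<in> carrier G" if "x \<in> carrier G" for x using that t by (simp add: \<pi>_def)
    have \<pi>_char: "\<psi> (\<pi> x) = (\<psi> x - \<psi> t * \<theta> x) mod int n" if "\<psi> \<in> X" "x \<in> carrier G" for \<psi> x
      using that t a[OF that(2)] by (simp add: \<pi>_def H1_hom H1_inv H1_pow mod_simps mult.commute)
    have \<pi>_H1: "\<exists>\<psi>'\<in>X. \<forall>g\<in>carrier G. \<psi> (\<pi> g) = \<psi>' g" if "\<psi> \<in> X" for \<psi>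
      using H1_lincomb[OF that \<theta>, of 1 "- \<psi> t"] \<pi>_char[OF that]
      by (intro bexI[of _ "\<lambda>x\<in>carrier G. (1 * \<psi> x + - \<psi> t * \<theta> x) mod int n"]) simp_all
    have \<pi>_L: "\<pi> x \<in> L l" if x: "x \<in> L (Suc l)" for x
    proof (rule L_I)
      show "\<pi> x \<in> carrier G" using \<pi>_closed L_D(1)[OF x] by simp
      fix i assume i: "i < k" "l \<le> i"
      show "\<eta> i (\<pi> x) = 0"
      proof (cases "i = l")
        case True
        then show ?thesis using \<pi>_char[OF \<theta> L_D(1)[OF x]] \<theta>t by (simp add: \<theta>_def)
      next
        case False
        then show ?thesis
          using \<pi>_char[OF \<eta>(1)[OF i(1)] L_D(1)[OF x]] \<eta>t[OF i(1) False] L_D(2)[OF x i(1)] i by simp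
      qed
    qed
    \<comment> \<open>Commutators are central modulo the kernel of \<open>\<phi>\<close>; therefore \<open>\<kappa>\<close> is additive.\<close>
    define \<kappa> where "\<kappa> = (\<lambda>w\<in>carrier G. \<phi> (inv w \<otimes> t \<otimes> w \<otimes> inv t) mod int n)"
    have \<kappa>_cong: "[\<kappa> w = \<phi> (inv w \<otimes> t \<otimes> w \<otimes> inv t)] (mod int n)" if "w \<in> carrier G" for w
      using that by (simp add: \<kappa>_def cong_def)
    have \<kappa>: "\<kappa> \<in> X"
      unfolding \<kappa>_def
    proof (rule H1_restrict_mod)
      have "continuous_map T T (\<lambda>w. inv w \<otimes> t \<otimes> w \<otimes> inv t)"
        using t by (intro continuous_map_group_mult continuous_inv continuous_map_id[unfolded id_def])
          (simp_all add: topspace_eq)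
      then show "locally_constant T (\<lambda>w. \<phi> (inv w \<otimes> t \<otimes> w \<otimes> inv t))"
        by (rule locally_constant_pullback[OF _ \<phi>_lc])
      fix w v assume wv: "w \<in> carrier G" "v \<in> carrier G"
      have "inv (w \<otimes> v) \<otimes> t \<otimes> (w \<otimes> v) \<otimes> inv t =
          (inv v \<otimes> (inv w \<otimes> t \<otimes> w \<otimes> inv t) \<otimes> v) \<otimes> (inv v \<otimes> t \<otimes> v \<otimes> inv t)"
        using wv t by (simp add: m_assoc inv_mult_group inv_cancel)
      then show "\<phi> (inv (w \<otimes> v) \<otimes> t \<otimes> (w \<otimes> v) \<otimes> inv t) mod int n =
          (\<phi> (inv w \<otimes> t \<otimes> w \<otimes> inv t) + \<phi> (inv v \<otimes> t \<otimes> v \<otimes> inv t)) mod int n"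
        using \<phi>_add[OF M_conj[OF wv(2) M_comm[OF wv(1) t]] M_comm[OF wv(2) t]]
          \<phi>_conj[OF wv(2) M_comm[OF wv(1) t]] by simp
    qed
    have \<kappa>_pow: "[\<phi> (inv w \<otimes> t [^] (j::nat) \<otimes> w \<otimes> inv (t [^] j)) = int j * \<kappa> w] (mod int n)"
      if w: "w \<in> carrier G" for w j
    proof (induction j)
      case 0
      then show ?case using w \<phi>_one by simp
    next
      case (Suc j)
      have tj: "t [^] j \<in> carrier G" using t by simp
      have "inv w \<otimes> t [^] Suc j \<otimes> w \<otimes> inv (t [^] Suc j) =
          (inv w \<otimes> t [^] j \<otimes> w \<otimes> inv (t [^] j)) \<otimes> (t [^] j \<otimes> (inv w \<otimes> t \<otimes> w \<otimes> inv t) \<otimes> inv (t [^] j))"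
        using w t tj by (simp add: m_assoc inv_mult_group inv_cancel)
      then have "[\<phi> (inv w \<otimes> t [^] Suc j \<otimes> w \<otimes> inv (t [^] Suc j)) =
          \<phi> (inv w \<otimes> t [^] j \<otimes> w \<otimes> inv (t [^] j)) + \<phi> (inv w \<otimes> t \<otimes> w \<otimes> inv t)] (mod int n)"
        using \<phi>_cong[OF M_comm[OF w tj] \<phi>_conj'(2)[OF tj M_comm[OF w t]]]
          \<phi>_conj'(1)[OF tj M_comm[OF w t]] by simp
      also have "[\<phi> (inv w \<otimes> t [^] j \<otimes> w \<otimes> inv (t [^] j)) + \<phi> (inv w \<otimes> t \<otimes> w \<otimes> inv t) =
          int j * \<kappa> w + \<kappa> w] (mod int n)"
        by (intro cong_add Suc cong_sym[OF \<kappa>_cong] w)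
      finally show ?case by (simp add: algebra_simps)
    qed
    have \<kappa>_\<pi>: "\<kappa> (\<pi> z) = \<kappa> z" if "z \<in> carrier G" for z
    proof -
      have "\<kappa> t = 0" using t \<phi>_one by (simp add: \<kappa>_def)
      then show ?thesis using \<pi>_char[OF \<kappa> that] H1_mod[OF \<kappa> that] by simp
    qed
    define E where "E = t [^] n"
    have E: "E \<in> M" unfolding E_def by (rule M_I) (simp_all add: t H1_pow \<eta>)
    have E_pow: "E [^] c \<in> M \<and> [\<phi> (E [^] c) = int c * \<phi> E] (mod int n)" for c :: nat
    proof (induction c)
      case 0
      then show ?case using M_one \<phi>_one by simp
    next
      case (Suc c)
      have "[\<phi> (E [^] c \<otimes> E) = \<phi> (E [^] c) + \<phi> E] (mod int n)" using Suc E by (intro \<phi>_cong) simp_all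
      also have "[\<phi> (E [^] c) + \<phi> E = int c * \<phi> E + \<phi> E] (mod int n)"
        using Suc by (intro cong_add cong_refl) simp
      finally show ?case using Suc E M_mult by (simp add: algebra_simps)
    qed
    obtain f' where f': "f' \<in> cup_carry_span"
      and f'_eq: "\<And>x z. x \<in> carrier G \<Longrightarrow> z \<in> carrier G \<Longrightarrow> f (\<pi> x) (\<pi> z) = f' x z"
      using cup_carry_span_pullback[where \<pi> = \<pi>, OF \<pi>_H1 f] by blast
    \<comment> \<open>The span is closed under scaling by natural numbers, whence \<open>nat (\<phi> E)\<close>.\<close>
    define F where "F x z = f' x z + - (\<theta> x * \<kappa> z + int (nat (\<phi> E)) * ((\<theta> x + \<theta> z) div int n))" for x z
    have F: "F \<in> cup_carry_span"
      unfolding F_def[abs_def]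
      by (intro cup_carry_span.add cup_carry_span.minus f' cup_carry_span.cup \<theta> \<kappa>
          cup_carry_span_scale cup_carry_span.carry)
    have \<phi>E: "int (nat (\<phi> E)) = \<phi> E" using \<phi>_range[OF E] by simp
    define y' where "y' x = y (\<pi> x)" for x
    have y'_M: "y' m = \<phi> m" if m: "m \<in> M" for m
      using y_M[OF m] M_D[OF m] l by (simp add: y'_def \<pi>_def a_def \<theta>_def)
    have y'_mult: "[y' (x \<otimes> m) = y' x + \<phi> m] (mod int n)" if x: "x \<in> L (Suc l)" and m: "m \<in> M" for x m
    proof -
      have c: "x \<in> carrier G" "m \<in> carrier G" "t [^] a x \<in> carrier G"
        using L_D(1)[OF x] M_D(1)[OF m] t by simp_all
      have "\<theta> (x \<otimes> m) = \<theta> x" using \<theta> c M_D(2)[OF m l(1)] by (simp add: H1_hom \<theta>_def)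
      then have "\<pi> (x \<otimes> m) = \<pi> x \<otimes> (t [^] a x \<otimes> m \<otimes> inv (t [^] a x))"
        using c by (simp add: \<pi>_def a_def m_assoc inv_cancel)
      then show ?thesis
        using y_mult[OF \<pi>_L[OF x] \<phi>_conj'(2)[OF c(3) m]] \<phi>_conj'(1)[OF c(3) m] by (simp add: y'_def)
    qed
    have y'_cob: "[y' z - y' (x \<otimes> z) + y' x = F x z] (mod int n)"
      if x: "x \<in> L (Suc l)" and z: "z \<in> L (Suc l)" for x z
    proof -
      define c where "c = (a x + a z) div n"
      have xz: "x \<in> carrier G" "z \<in> carrier G" using L_D(1)[OF x] L_D(1)[OF z] .
      have "int (a (x \<otimes> z)) = int ((a x + a z) mod n)"
        using xz a \<theta> by (simp add: H1_hom zmod_int)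
      then have s: "a x + a z = a (x \<otimes> z) + n * c" by (simp add: c_def)
      let ?A = "t [^] a x" and ?B = "t [^] a z" and ?S = "t [^] a (x \<otimes> z)"
      have ABS: "?A \<in> carrier G" "?B \<in> carrier G" "?S \<in> carrier G" using t by simp_all
      have pows: "?A \<otimes> ?B = E [^] c \<otimes> ?S"
        using t s by (simp add: E_def nat_pow_mult nat_pow_pow add.commute)
      have pz: "\<pi> x \<in> carrier G" "\<pi> z \<in> carrier G" using xz \<pi>_closed by simp_all
      have xx: "x = \<pi> x \<otimes> ?A" and zz: "z = \<pi> z \<otimes> ?B"
        using xz t by (simp_all add: \<pi>_def m_assoc)
      let ?C = "inv (\<pi> z) \<otimes> ?A \<otimes> \<pi> z \<otimes> inv ?A"
      have CM: "?C \<in> M" by (rule M_comm[OF pz(2) ABS(1)])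
      have EM: "E [^] c \<in> M" using E_pow by blast
      have Ec: "E [^] c \<in> carrier G" using M_D(1)[OF EM] .
      have "\<pi> (x \<otimes> z) = x \<otimes> z \<otimes> inv ?S" by (simp add: \<pi>_def)
      also have "\<dots> = (\<pi> x \<otimes> ?A) \<otimes> (\<pi> z \<otimes> ?B) \<otimes> inv ?S" using xx zz by simp
      also have "\<dots> = \<pi> x \<otimes> \<pi> z \<otimes> (?C \<otimes> ((?A \<otimes> ?B) \<otimes> inv ?S))"
        using pz ABS by (simp add: m_assoc inv_cancel)
      also have "(?A \<otimes> ?B) \<otimes> inv ?S = E [^] c"
        unfolding pows using Ec ABS by (simp add: m_assoc)
      finally have "[y' (x \<otimes> z) = y (\<pi> x \<otimes> \<pi> z) + \<phi> (?C \<otimes> E [^] c)] (mod int n)"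
        using y_mult[OF L_mult[OF \<pi>_L[OF x] \<pi>_L[OF z]] M_mult[OF CM EM]] by (simp add: y'_def)
      also have "[y (\<pi> x \<otimes> \<pi> z) + \<phi> (?C \<otimes> E [^] c) =
          y (\<pi> x \<otimes> \<pi> z) + (\<phi> ?C + \<phi> (E [^] c))] (mod int n)"
        by (intro cong_add cong_refl \<phi>_cong CM EM)
      also have "[y (\<pi> x \<otimes> \<pi> z) + (\<phi> ?C + \<phi> (E [^] c)) =
          y (\<pi> x \<otimes> \<pi> z) + (int (a x) * \<kappa> (\<pi> z) + int c * \<phi> E)] (mod int n)"
        using E_pow by (intro cong_add cong_refl \<kappa>_pow pz) blast
      also have "y (\<pi> x \<otimes> \<pi> z) + (int (a x) * \<kappa> (\<pi> z) + int c * \<phi> E) =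
          y (\<pi> x \<otimes> \<pi> z) + (\<theta> x * \<kappa> z + \<phi> E * ((\<theta> x + \<theta> z) div int n))"
        using a xz \<kappa>_\<pi> by (simp add: c_def zdiv_int mult.commute)
      finally have 1: "[y' (x \<otimes> z) =
          y (\<pi> x \<otimes> \<pi> z) + (\<theta> x * \<kappa> z + \<phi> E * ((\<theta> x + \<theta> z) div int n))] (mod int n)" .
      have "[y' z - y' (x \<otimes> z) + y' x = y (\<pi> z) - (y (\<pi> x \<otimes> \<pi> z) +
          (\<theta> x * \<kappa> z + \<phi> E * ((\<theta> x + \<theta> z) div int n))) + y (\<pi> x)] (mod int n)"
        unfolding y'_def[of z] y'_def[of x] by (intro cong_add cong_diff 1 cong_refl)
      also have "y (\<pi> z) - (y (\<pi> x \<otimes> \<pi> z) +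
          (\<theta> x * \<kappa> z + \<phi> E * ((\<theta> x + \<theta> z) div int n))) + y (\<pi> x) =
          (y (\<pi> z) - y (\<pi> x \<otimes> \<pi> z) + y (\<pi> x)) -
          (\<theta> x * \<kappa> z + \<phi> E * ((\<theta> x + \<theta> z) div int n))"
        by simp
      also have "[\<dots> = f (\<pi> x) (\<pi> z) - (\<theta> x * \<kappa> z + \<phi> E * ((\<theta> x + \<theta> z) div int n))] (mod int n)"
        by (intro cong_diff cong_refl y_cob \<pi>_L x z)
      also have "f (\<pi> x) (\<pi> z) - (\<theta> x * \<kappa> z + \<phi> E * ((\<theta> x + \<theta> z) div int n)) = F x z"
        unfolding F_def \<phi>E by (simp add: f'_eq xz)
      finally show ?thesis .
    qed
    show ?case using F y'_M y'_mult y'_cob by blast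
  qed
  from this[OF order_refl] obtain y f where f: "f \<in> cup_carry_span"
    and y_M: "\<And>m. m \<in> M \<Longrightarrow> y m = \<phi> m"
    and y_mult': "\<And>x m. x \<in> L k \<Longrightarrow> m \<in> M \<Longrightarrow> [y (x \<otimes> m) = y x + \<phi> m] (mod int n)"
    and y_cob': "\<And>x z. x \<in> L k \<Longrightarrow> z \<in> L k \<Longrightarrow> [y z - y (x \<otimes> z) + y x = f x z] (mod int n)"
    by blast
  have Lk: "L k = carrier G" by (simp add: L_def)
  have M_open: "openin T {g \<in> topspace T. \<forall>i<l. \<eta> i g = 0}" if "l \<le> k" for l
    using that
  proof (induction l)
    case (Suc l)
    have "{g \<in> topspace T. \<forall>i<Suc l. \<eta> i g = 0} =
        {g \<in> topspace T. \<forall>i<l. \<eta> i g = 0} \<inter> {g \<in> topspace T. \<eta> l g = 0}"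
      by (auto simp: less_Suc_eq)
    then show ?case
      using Suc H1_locally_constant[OF \<eta>(1)[of l]] by (simp add: locally_constant_def openin_Int)
  qed simp
  \<comment> \<open>Continuity: the cochain is constant on the left cosets of the open subgroup \<open>Ker \<phi>\<close>.\<close>
  define N where "N = {g \<in> topspace T. \<forall>i<k. \<eta> i g = 0} \<inter> {g \<in> topspace T. \<phi> g = 0}"
  have N_open: "openin T N"
    unfolding N_def using M_open[OF order_refl] \<phi>_lc by (simp add: locally_constant_def openin_Int)
  have N_D: "m \<in> M" "\<phi> m = 0" if "m \<in> N" for m using that by (simp_all add: N_def M_def topspace_eq)
  have N_one: "\<one> \<in> N" using M_D[OF M_one] \<phi>_one by (simp add: N_def topspace_eq)
  have y_lc: "locally_constant T (\<lambda>x. y x mod int n)"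
    unfolding locally_constant_def
  proof
    fix v
    have "{x \<in> topspace T. y x mod int n = v} =
        (\<Union>x0\<in>{x \<in> carrier G. y x mod int n = v}. {x \<in> topspace T. inv x0 \<otimes> x \<in> N})" (is "?l = ?r")
    proof (intro equalityI subsetI)
      fix x assume "x \<in> ?l"
      then show "x \<in> ?r" using N_one by (auto simp: topspace_eq)
    next
      fix x assume "x \<in> ?r"
      then obtain x0 where x: "x0 \<in> carrier G" "y x0 mod int n = v" "x \<in> carrier G" "inv x0 \<otimes> x \<in> N"
        by (auto simp: topspace_eq)
      have "[y (x0 \<otimes> (inv x0 \<otimes> x)) = y x0 + 0] (mod int n)"
        using y_mult'[of x0 "inv x0 \<otimes> x"] x N_D[OF x(4)] by (simp add: Lk)
      then show "x \<in> ?l" using x by (simp add: inv_cancel cong_def topspace_eq)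
    qed
    also have "openin T \<dots>"
      using N_open continuous_map_translation(1)
      by (intro openin_Union) (auto intro!: openin_continuous_map_preimage)
    finally show "openin T {x \<in> topspace T. y x mod int n = v}" .
  qed
  show thesis
  proof (rule that[OF C1_restrict_mod[OF y_lc] f])
    show "(\<lambda>x\<in>carrier G. y x mod int n mod int n) m = \<phi> m" if m: "m \<in> M" for m
      using y_M[OF m] M_D(1)[OF m] \<phi>_range[OF m] by simp
    let ?y = "\<lambda>x\<in>carrier G. y x mod int n mod int n"
    show "has_coboundary ?y f"
    proof (rule has_coboundaryI)
      fix g h assume gh: "g \<in> carrier G" "h \<in> carrier G"
      have "[?y h - ?y (g \<otimes> h) + ?y g = y h - y (g \<otimes> h) + y g] (mod int n)"
        by (intro cong_add cong_diff) (simp_all add: gh cong_def)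
      also have "[y h - y (g \<otimes> h) + y g = f g h] (mod int n)"
        using y_cob'[of g h] gh by (simp add: Lk)
      finally show "[?y h - ?y (g \<otimes> h) + ?y g = f g h] (mod int n)" .
    qed
  qed
qed

end

section \<open>The descending central series\<close>

context profinite_setting
begin

text \<open>Normality is inherited because \<open>g k g\<^sup>-\<^sup>1\<close> differs from \<open>k\<close> by a commutator that lies in the next
  term.\<close>

lemma central_series_normal:
  assumes H: "central_series n G T (Suc i) \<lhd> G" "closedin T (central_series n G T (Suc i))"
  shows "central_series n G T (Suc (Suc i)) \<lhd> G" and "closedin T (central_series n G T (Suc (Suc i)))"
    and "\<And>h. h \<in> central_series n G T (Suc i) \<Longrightarrow> h [^] n \<in> central_series n G T (Suc (Suc i))"
    and "\<And>h g. h \<in> central_series n G T (Suc i) \<Longrightarrow> g \<in> carrier G \<Longrightarrow>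
      inv h \<otimes> inv g \<otimes> h \<otimes> g \<in> central_series n G T (Suc (Suc i))"
proof -
  let ?H = "central_series n G T (Suc i)" and ?K = "central_series n G T (Suc (Suc i))"
  interpret H: normal ?H G by fact
  let ?R = "{h [^] n | h. h \<in> ?H} \<union> {inv h \<otimes> inv g \<otimes> h \<otimes> g | h g. h \<in> ?H \<and> g \<in> carrier G}"
  have K_eq: "?K = T closure_of generate G ?R" by simp
  have R: "?R \<subseteq> carrier G"
  proof (rule Un_least)
    show "{h [^] n | h. h \<in> ?H} \<subseteq> carrier G" using H.mem_carrier nat_pow_closed by blast
    show "{inv h \<otimes> inv g \<otimes> h \<otimes> g | h g. h \<in> ?H \<and> g \<in> carrier G} \<subseteq> carrier G"
      using H.mem_carrier inv_closed m_closed by blast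
  qed
  have gen: "subgroup (generate G ?R) G" by (rule generate_is_subgroup[OF R])
  have "generate G ?R \<subseteq> ?K"
    unfolding K_eq using subgroup.subset[OF gen] topspace_eq by (intro closure_of_subset) simp
  then have RK: "?R \<subseteq> ?K" using generate.incl[of _ ?R G] by blast
  show pow: "h [^] n \<in> ?K" if "h \<in> ?H" for h using RK that by blast
  show comm: "inv h \<otimes> inv g \<otimes> h \<otimes> g \<in> ?K" if "h \<in> ?H" "g \<in> carrier G" for h g using RK that by blast
  show "closedin T ?K" unfolding K_eq by (rule closedin_closure_of)
  have sub: "subgroup ?K G" unfolding K_eq by (rule subgroup_closure_of[OF gen])
  have KH: "?K \<subseteq> ?H"
  proof (rule central_series_step_subset[OF H.subgroup_axioms H(2)])
    fix h assume h: "h \<in> ?H"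
    have "h [^] j \<in> ?H" for j :: nat by (induction j) (simp_all add: h)
    then show "h [^] n \<in> ?H" .
    fix g assume g: "g \<in> carrier G"
    have "inv g \<otimes> h \<otimes> g \<in> ?H" using H.inv_op_closed1 g h by simp
    then have "inv h \<otimes> (inv g \<otimes> h \<otimes> g) \<in> ?H" using h by simp
    then show "inv h \<otimes> inv g \<otimes> h \<otimes> g \<in> ?H"
      using h g H.mem_carrier[OF h] by (simp add: m_assoc)
  qed
  show "?K \<lhd> G"
  proof (rule normal_invI[OF sub])
    fix g k assume g: "g \<in> carrier G" and k: "k \<in> ?K"
    have kc: "k \<in> carrier G" using subgroup.mem_carrier[OF sub k] .
    have "inv k \<otimes> inv (inv g) \<otimes> k \<otimes> inv g \<in> ?K" using KH k g by (intro comm) auto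
    then have "k \<otimes> (inv k \<otimes> inv (inv g) \<otimes> k \<otimes> inv g) \<in> ?K" by (rule subgroup.m_closed[OF sub k])
    moreover have "k \<otimes> (inv k \<otimes> inv (inv g) \<otimes> k \<otimes> inv g) = g \<otimes> k \<otimes> inv g"
      using kc g by (simp add: m_assoc inv_cancel)
    ultimately show "g \<otimes> k \<otimes> inv g \<in> ?K" by simp
  qed
qed

lemma carrier_normal: "carrier G \<lhd> G"
  by (rule normal_invI) (simp_all add: subgroup_self)

lemma closedin_carrier: "closedin T (carrier G)"
  using closedin_topspace[of T] topspace_eq by simp

text \<open>The quotient of \<open>G\<close> by \<open>G\<^sup>(\<^sup>2\<^sup>)\<close> is abelian of exponent \<open>n\<close>, so characters separate its points.\<close>

lemma characters_detect_central_series_2: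
  assumes x: "x \<in> carrier G" and zero: "\<And>\<psi>. \<psi> \<in> X \<Longrightarrow> \<psi> x = 0"
  shows "x \<in> central_series n G T (Suc (Suc 0))"
proof (rule ccontr)
  assume nx: "x \<notin> central_series n G T (Suc (Suc 0))"
  note c = central_series_normal[of 0, unfolded central_series.simps(2),
      OF carrier_normal closedin_carrier]
  obtain M \<phi> where M: "carrier G \<subseteq> M" "subgroup M G"
    and add: "\<And>a b. a \<in> M \<Longrightarrow> b \<in> M \<Longrightarrow> \<phi> (a \<otimes> b) = (\<phi> a + \<phi> b) mod int n"
    and range: "\<And>m. m \<in> M \<Longrightarrow> 0 \<le> \<phi> m \<and> \<phi> m < int n"
    and lc: "locally_constant T \<phi>" and "\<phi> x \<noteq> 0"
    using invariant_character_exists[OF subgroup_self c(1,2) c(3) c(4) x nx] by metis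
  have "(\<lambda>g\<in>carrier G. \<phi> g mod int n) \<in> X"
  proof (rule H1_restrict_mod[OF lc])
    show "\<phi> (g \<otimes> h) mod int n = (\<phi> g + \<phi> h) mod int n" if "g \<in> carrier G" "h \<in> carrier G" for g h
      using add[of g h] M(1) that by (simp add: subset_iff)
  qed
  then have "\<phi> x mod int n = 0" using zero x by fastforce
  moreover have "x \<in> M" using M(1) x by blast
  ultimately show False using range[of x] \<open>\<phi> x \<noteq> 0\<close> by simp
qed

end

section \<open>Cochains that vanish on the intersection of the distinguished subgroups\<close>

context coefficient_setting
begin

lemma Delta_carrier: "x \<in> Delta n G T \<Longrightarrow> x \<in> carrier G"
  by (simp add: Delta_def)

lemma simple_vanishes_on_Delta:
  assumes \<psi>: "\<psi> \<in> X" "\<psi>' \<in> X" and y: "y \<in> C1" and x: "x \<in> Delta n G T"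
    and cob: "has_coboundary y
      (\<lambda>g h. \<psi> g * \<psi>' h + (if n = 2 then 0 else (\<psi> g + \<psi> h) div int n))"
  shows "y x = 0"
proof (rule Delta_simple_coboundary[OF \<psi> y _ x])
  show "coboundary n G y = simple_cochain n G \<psi> \<psi>'"
    using cob
    by (auto simp: has_coboundary_def coboundary_def simple_cochain_def cong_def intro!: restrict_ext)
qed

text \<open>A character is a cochain with zero coboundary, and \<open>0\<close> is an element of simple type.\<close>

lemma H1_vanishes_on_Delta:
  assumes \<psi>: "\<psi> \<in> X" and x: "x \<in> Delta n G T"
  shows "\<psi> x = 0"
proof (rule simple_vanishes_on_Delta[OF H1_zero H1_zero _ x])
  show "\<psi> \<in> C1" using \<psi> by (simp add: H1_iff)
  show "has_coboundary \<psi> (\<lambda>g h. (\<lambda>x\<in>carrier G. 0) g * (\<lambda>x\<in>carrier G. 0) h +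
      (if n = 2 then 0 else ((\<lambda>x\<in>carrier G. 0) g + (\<lambda>x\<in>carrier G. 0) h) div int n))"
  proof (rule has_coboundaryI)
    fix g h assume gh: "g \<in> carrier G" "h \<in> carrier G"
    have "[\<psi> h - \<psi> (g \<otimes> h) + \<psi> g = \<psi> h - (\<psi> g + \<psi> h) + \<psi> g] (mod int n)"
      by (intro cong_add cong_diff cong_refl) (simp add: H1_hom[OF \<psi> gh] cong_def)
    then show "[\<psi> h - \<psi> (g \<otimes> h) + \<psi> g = (\<lambda>x\<in>carrier G. 0) g * (\<lambda>x\<in>carrier G. 0) h +
        (if n = 2 then 0 else ((\<lambda>x\<in>carrier G. 0) g + (\<lambda>x\<in>carrier G. 0) h) div int n)] (mod int n)"
      using gh by (cases "n = 2") simp_all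
  qed
qed

definition Delta_trivial :: "('a \<Rightarrow> 'a \<Rightarrow> int) \<Rightarrow> bool" where
  "Delta_trivial f \<longleftrightarrow> (\<exists>w\<in>C1. has_coboundary w f \<and> (\<forall>x\<in>Delta n G T. w x = 0))"

lemma Delta_trivialI:
  "w \<in> C1 \<Longrightarrow> has_coboundary w f \<Longrightarrow> (\<And>x. x \<in> Delta n G T \<Longrightarrow> w x = 0) \<Longrightarrow> Delta_trivial f"
  by (auto simp: Delta_trivial_def)

lemma Delta_trivialE:
  assumes "Delta_trivial f"
  obtains w where "w \<in> C1" and "has_coboundary w f" and "\<And>x. x \<in> Delta n G T \<Longrightarrow> w x = 0"
  using assms by (auto simp: Delta_trivial_def)

lemma Delta_trivial_cong:
  assumes "Delta_trivial f"
    and "\<And>g h. g \<in> carrier G \<Longrightarrow> h \<in> carrier G \<Longrightarrow> [f' g h = f g h] (mod int n)"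
  shows "Delta_trivial f'"
proof -
  obtain w where w: "w \<in> C1" "has_coboundary w f" "\<And>x. x \<in> Delta n G T \<Longrightarrow> w x = 0"
    by (rule Delta_trivialE[OF assms(1)]) (rule that; assumption)
  have "has_coboundary w f'"
    by (rule has_coboundary_cong[OF w(2)]) (rule cong_sym[OF assms(2)])
  then show ?thesis using w by (intro Delta_trivialI)
qed

lemma Delta_trivial_zero: "Delta_trivial (\<lambda>g h. 0)"
proof (rule Delta_trivialI)
  show "(\<lambda>g\<in>carrier G. 0) \<in> C1" using H1_zero by (simp add: H1_iff)
  show "has_coboundary (\<lambda>g\<in>carrier G. 0) (\<lambda>g h. 0)" by (simp add: has_coboundary_def)
qed (simp add: Delta_carrier)

lemma Delta_trivial_lincomb:
  assumes "Delta_trivial f" and "Delta_trivial f'"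
  shows "Delta_trivial (\<lambda>g h. a * f g h + b * f' g h)"
proof -
  obtain u where u: "u \<in> C1" "has_coboundary u f" "\<And>x. x \<in> Delta n G T \<Longrightarrow> u x = 0"
    by (rule Delta_trivialE[OF assms(1)]) (rule that; assumption)
  obtain v where v: "v \<in> C1" "has_coboundary v f'" "\<And>x. x \<in> Delta n G T \<Longrightarrow> v x = 0"
    by (rule Delta_trivialE[OF assms(2)]) (rule that; assumption)
  obtain w where w: "w \<in> C1" "has_coboundary w (\<lambda>g h. a * f g h + b * f' g h)"
    "\<And>x. x \<in> carrier G \<Longrightarrow> [w x = a * u x + b * v x] (mod int n)"
    by (rule has_coboundary_lincomb[OF u(1,2) v(1,2), of a b]) (rule that; assumption)
  show ?thesis
  proof (rule Delta_trivialI[OF w(1,2)])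
    fix x assume x: "x \<in> Delta n G T"
    show "w x = 0"
      using w(3)[OF Delta_carrier[OF x]] u(3)[OF x] v(3)[OF x]
      by (intro C1_zero[OF w(1) Delta_carrier[OF x]]) simp
  qed
qed

lemma Delta_trivial_add:
  assumes "Delta_trivial f" and "Delta_trivial f'"
  shows "Delta_trivial (\<lambda>g h. f g h + f' g h)"
  using Delta_trivial_lincomb[OF assms, of 1 1] by simp

lemma Delta_trivial_minus:
  assumes "Delta_trivial f"
  shows "Delta_trivial (\<lambda>g h. - f g h)"
  using Delta_trivial_lincomb[OF assms assms, of "-1" 0] by simp

text \<open>Two solutions of the same coboundary equation differ by a character, and characters vanish on
  \<open>\<Delta>\<close>; hence \<open>\<Delta>\<close>-triviality does not depend on the solution.\<close>

lemma Delta_trivial_vanishes: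
  assumes f: "Delta_trivial f" and y: "y \<in> C1" "has_coboundary y f" and x: "x \<in> Delta n G T"
  shows "y x = 0"
proof -
  note xc = Delta_carrier[OF x]
  obtain w where w: "w \<in> C1" "has_coboundary w f" "\<And>x. x \<in> Delta n G T \<Longrightarrow> w x = 0"
    by (rule Delta_trivialE[OF f]) (rule that; assumption)
  obtain \<psi> where \<psi>: "\<psi> \<in> C1" "has_coboundary \<psi> (\<lambda>g h. 1 * f g h + -1 * f g h)"
    "\<And>x. x \<in> carrier G \<Longrightarrow> [\<psi> x = 1 * y x + -1 * w x] (mod int n)"
    by (rule has_coboundary_lincomb[OF y w(1,2), of 1 "-1"]) (rule that; assumption)
  have "\<psi> \<in> X" using \<psi>(1,2) by (intro H1_of_zero_coboundary) simp_all
  then have "\<psi> x = 0" using x by (rule H1_vanishes_on_Delta)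
  then have "[0 = y x] (mod int n)" using \<psi>(3)[OF xc] w(3)[OF x] by simp
  then show ?thesis by (intro C1_zero[OF y(1) xc]) (rule cong_sym)
qed

end


section \<open>Relations of Galois relation type\<close>

locale galois_relation_setting = lifting_setting G T n p d for G (structure) and T n p d +
  fixes S :: "(('a \<Rightarrow> int) \<times> ('a \<Rightarrow> int) \<Rightarrow>\<^sub>0 int) set set" and \<xi> :: "'a \<Rightarrow> int"
  assumes S: "S \<subseteq> {pure_tensor (H1 n G T) (H1 n G T) \<psi> \<psi>' | \<psi> \<psi>'. \<psi> \<in> X \<and> \<psi>' \<in> X}"
    and kernel_cup: "kernel (H1_tensor_H1 n G T) (H2 n G T) (cup_hom n G T) =
      generate (H1_tensor_H1 n G T) S"
    and \<xi>: "\<xi> \<in> X"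
    and cup_\<xi>: "\<And>\<psi>. \<psi> \<in> X \<Longrightarrow>
      cup n G T \<psi> \<xi> \<otimes>\<^bsub>H2 n G T\<^esub> bockstein n G T \<psi> = \<one>\<^bsub>H2 n G T\<^esub>"
begin

abbreviation \<T> where "\<T> \<equiv> H1_tensor_H1 n G T"

abbreviation pure where "pure \<equiv> pure_tensor (H1 n G T) (H1 n G T)"

lemma bockstein_relation_Delta_trivial:
  assumes \<psi>: "\<psi> \<in> X" and "n \<noteq> 2"
  shows "Delta_trivial (\<lambda>g h. \<psi> g * \<xi> h + (\<psi> g + \<psi> h) div int n)"
proof -
  interpret Z: comm_group "Z2 n G T" by (rule comm_group_Z2)
  let ?f = "cup_cochain n G \<psi> \<xi> \<otimes>\<^bsub>Z2 n G T\<^esub> carry_cochain n G \<psi>"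
  have f: "?f \<in> carrier (Z2 n G T)"
    using cup_cochain_Z2[OF \<psi> \<xi>] carry_cochain_Z2[OF \<psi>] by (rule Z.m_closed)
  have "H2_class n G T ?f = \<one>\<^bsub>H2 n G T\<^esub>"
    using cup_\<xi>[OF \<psi>] by (simp add: H2_class_mult cup_cochain_Z2 carry_cochain_Z2 \<psi> \<xi> cup_eq bockstein_eq
        del: Z2_mult)
  then obtain y where y: "y \<in> C1" "has_coboundary y (\<lambda>g h. ?f (g, h))"
    unfolding H2_class_eq_one_iff[OF f] by blast
  have cob: "has_coboundary y (\<lambda>g h. \<psi> g * \<xi> h + (\<psi> g + \<psi> h) div int n)"
    using y(2) by (rule has_coboundary_cong)
      (simp add: cup_cochain_def carry_cochain_def cong_def mod_simps)
  show ?thesis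
  proof (rule Delta_trivialI[OF y(1) cob])
    show "y x = 0" if "x \<in> Delta n G T" for x
      using cob \<open>n \<noteq> 2\<close> by (intro simple_vanishes_on_Delta[OF \<psi> \<xi> y(1) that]) simp
  qed
qed

text \<open>A relation \<open>\<psi> \<union> \<psi>' = 0\<close> of \<open>G\<close> is the difference of the relations attached to
  \<open>(\<psi> \<otimes> (\<psi>' + \<xi>), \<psi>)\<close> and \<open>(\<psi> \<otimes> \<xi>, \<psi>)\<close>, both of simple type.\<close>

lemma cup_relation_Delta_trivial:
  assumes \<psi>: "\<psi> \<in> X" and \<psi>': "\<psi>' \<in> X" and triv: "cup n G T \<psi> \<psi>' = \<one>\<^bsub>H2 n G T\<^esub>"
  shows "Delta_trivial (\<lambda>g h. \<psi> g * \<psi>' h)"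
proof -
  obtain z where z: "z \<in> C1" "has_coboundary z (\<lambda>g h. cup_cochain n G \<psi> \<psi>' (g, h))"
    using triv unfolding cup_eq H2_class_eq_one_iff[OF cup_cochain_Z2[OF \<psi> \<psi>']] by blast
  have cob: "has_coboundary z (\<lambda>g h. \<psi> g * \<psi>' h)"
    using z(2) by (rule has_coboundary_cong) (simp add: cup_cochain_def cong_def)
  show ?thesis
  proof (rule Delta_trivialI[OF z(1) cob])
    fix x assume x: "x \<in> Delta n G T"
    show "z x = 0"
    proof (cases "n = 2")
      case True
      then show ?thesis using cob by (intro simple_vanishes_on_Delta[OF \<psi> \<psi>' z(1) x]) simp
    next
      case False
      obtain v where v: "v \<in> C1" "has_coboundary v (\<lambda>g h. \<psi> g * \<xi> h + (\<psi> g + \<psi> h) div int n)"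
        "\<And>x. x \<in> Delta n G T \<Longrightarrow> v x = 0"
        by (rule Delta_trivialE[OF bockstein_relation_Delta_trivial[OF \<psi> False]]) (rule that; assumption)
      obtain w where w: "w \<in> C1" "has_coboundary w
          (\<lambda>g h. 1 * (\<psi> g * \<psi>' h) + 1 * (\<psi> g * \<xi> h + (\<psi> g + \<psi> h) div int n))"
        "\<And>x. x \<in> carrier G \<Longrightarrow> [w x = 1 * z x + 1 * v x] (mod int n)"
        by (rule has_coboundary_lincomb[OF z(1) cob v(1,2), of 1 1]) (rule that; assumption)
      let ?\<omega> = "\<lambda>g\<in>carrier G. (1 * \<psi>' g + 1 * \<xi> g) mod int n"
      have "w x = 0"
      proof (rule simple_vanishes_on_Delta[OF \<psi> H1_lincomb[OF \<psi>' \<xi>] w(1) x])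
        show "has_coboundary w (\<lambda>g h. \<psi> g * ?\<omega> h + (if n = 2 then 0 else (\<psi> g + \<psi> h) div int n))"
          using w(2)
        proof (rule has_coboundary_cong)
          fix g h assume gh: "g \<in> carrier G" "h \<in> carrier G"
          have "[\<psi> g * (\<psi>' h + \<xi> h) + (\<psi> g + \<psi> h) div int n =
              \<psi> g * ?\<omega> h + (\<psi> g + \<psi> h) div int n] (mod int n)"
            by (intro cong_add cong_mult cong_refl) (simp add: gh cong_def)
          then show "[1 * (\<psi> g * \<psi>' h) + 1 * (\<psi> g * \<xi> h + (\<psi> g + \<psi> h) div int n) =
              \<psi> g * ?\<omega> h + (if n = 2 then 0 else (\<psi> g + \<psi> h) div int n)] (mod int n)"
            using False by (simp add: algebra_simps)
        qed
      qed
      then have "[0 = z x] (mod int n)" using w(3)[OF Delta_carrier[OF x]] v(3)[OF x] by simp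
      then show ?thesis by (intro C1_zero[OF z(1) Delta_carrier[OF x]]) (rule cong_sym)
    qed
  qed
qed

lemma tensor_cochain_rules:
  assumes gh: "g \<in> carrier G" "h \<in> carrier G"
  shows "\<And>s t. s \<in> carrier \<T> \<Longrightarrow> t \<in> carrier \<T> \<Longrightarrow>
      [tensor_cochain (s \<otimes>\<^bsub>\<T>\<^esub> t) (g, h) = tensor_cochain s (g, h) + tensor_cochain t (g, h)] (mod int n)"
    and "\<And>t. t \<in> carrier \<T> \<Longrightarrow>
      [tensor_cochain (inv\<^bsub>\<T>\<^esub> t) (g, h) = - tensor_cochain t (g, h)] (mod int n)"
    and "[tensor_cochain \<one>\<^bsub>\<T>\<^esub> (g, h) = 0] (mod int n)"
    and "\<And>\<psi> \<psi>'. \<psi> \<in> X \<Longrightarrow> \<psi>' \<in> X \<Longrightarrow> [tensor_cochain (pure \<psi> \<psi>') (g, h) = \<psi> g * \<psi>' h] (mod int n)"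
proof -
  interpret Z: comm_group "Z2 n G T" by (rule comm_group_Z2)
  interpret Te: comm_group \<T> by (rule comm_group_tensor[OF group_H1 group_H1])
  interpret \<kappa>: group_hom \<T> "Z2 n G T" tensor_cochain
    by (intro group_hom.intro group_hom_axioms.intro Te.is_group Z.is_group tensor_cochain_hom)
  show "[tensor_cochain (s \<otimes>\<^bsub>\<T>\<^esub> t) (g, h) = tensor_cochain s (g, h) + tensor_cochain t (g, h)] (mod int n)"
    if "s \<in> carrier \<T>" "t \<in> carrier \<T>" for s t
    using \<kappa>.hom_mult[OF that] gh by (simp add: cong_def)
  show "[tensor_cochain (inv\<^bsub>\<T>\<^esub> t) (g, h) = - tensor_cochain t (g, h)] (mod int n)"
    if "t \<in> carrier \<T>" for t
    using \<kappa>.hom_inv[OF that] Z2_inv[OF \<kappa>.hom_closed[OF that]] gh by (simp add: cong_def)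
  show "[tensor_cochain \<one>\<^bsub>\<T>\<^esub> (g, h) = 0] (mod int n)"
    using \<kappa>.hom_one gh by (simp add: cong_def)
  show "[tensor_cochain (pure \<psi> \<psi>') (g, h) = \<psi> g * \<psi>' h] (mod int n)"
    if "\<psi> \<in> X" "\<psi>' \<in> X" for \<psi> \<psi>'
    using that gh by (simp add: tensor_cochain_pure cup_cochain_def cong_def)
qed

text \<open>The generators of the kernel are pure tensors, which \<open>cup_relation_Delta_trivial\<close> deals with.\<close>

lemma kernel_cup_Delta_trivial:
  assumes "t \<in> kernel \<T> (H2 n G T) (cup_hom n G T)"
  shows "Delta_trivial (\<lambda>g h. tensor_cochain t (g, h))"
proof -
  interpret Te: comm_group \<T> by (rule comm_group_tensor[OF group_H1 group_H1])
  have generator: "s \<in> carrier \<T>" "Delta_trivial (\<lambda>g h. tensor_cochain s (g, h))" if sS: "s \<in> S" for s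
  proof -
    obtain \<psi> \<psi>' where s: "s = pure \<psi> \<psi>'" "\<psi> \<in> X" "\<psi>' \<in> X" using S sS by blast
    show sc: "s \<in> carrier \<T>" unfolding s(1) by (rule pure_tensor_closed[OF s(2,3)])
    have "s \<in> kernel \<T> (H2 n G T) (cup_hom n G T)"
      unfolding kernel_cup by (rule generate.incl[OF sS])
    then have triv: "cup n G T \<psi> \<psi>' = \<one>\<^bsub>H2 n G T\<^esub>"
      using cup_hom_eq[OF sc] tensor_cochain_pure[OF s(2,3)] s(1) by (simp add: kernel_def cup_eq)
    show "Delta_trivial (\<lambda>g h. tensor_cochain s (g, h))"
      unfolding s(1)
      by (rule Delta_trivial_cong[OF cup_relation_Delta_trivial[OF s(2,3) triv]])
        (rule tensor_cochain_rules(4)[OF _ _ s(2,3)])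
  qed
  have "t \<in> carrier \<T> \<and> Delta_trivial (\<lambda>g h. tensor_cochain t (g, h))"
    using assms unfolding kernel_cup
  proof induction
    case one
    have "Delta_trivial (\<lambda>g h. tensor_cochain \<one>\<^bsub>\<T>\<^esub> (g, h))"
      by (rule Delta_trivial_cong[OF Delta_trivial_zero]) (rule tensor_cochain_rules(3))
    then show ?case by simp
  next
    case (incl s)
    then show ?case using generator by blast
  next
    case (inv s)
    note s = generator[OF inv]
    have "Delta_trivial (\<lambda>g h. tensor_cochain (inv\<^bsub>\<T>\<^esub> s) (g, h))"
      by (rule Delta_trivial_cong[OF Delta_trivial_minus[OF s(2)]])
        (rule tensor_cochain_rules(2)[OF _ _ s(1)])
    then show ?case using s by simp
  next
    case (eng s t)
    then have st: "s \<in> carrier \<T>" "t \<in> carrier \<T>" by simp_all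
    have "Delta_trivial (\<lambda>g h. tensor_cochain s (g, h) + tensor_cochain t (g, h))"
      using eng by (intro Delta_trivial_add) simp_all
    then have "Delta_trivial (\<lambda>g h. tensor_cochain (s \<otimes>\<^bsub>\<T>\<^esub> t) (g, h))"
      by (rule Delta_trivial_cong) (rule tensor_cochain_rules(1)[OF _ _ st])
    then show ?case using st by simp
  qed
  then show ?thesis by simp
qed

text \<open>Modulo \<open>\<Delta>\<close>-trivial functions every Bockstein is a cup product: \<open>\<beta>(\<psi>) = -\<psi> \<union> \<xi>\<close>, or already
  on cochains \<open>\<beta>(\<psi>) = \<psi> \<union> \<psi>\<close> if \<open>q = 2\<close>, as the carry of two bits is their product.\<close>

lemma cup_carry_span_decomposition:
  assumes "f \<in> cup_carry_span"
  obtains t r where "t \<in> carrier \<T>" and "Delta_trivial r"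
    and "\<And>g h. g \<in> carrier G \<Longrightarrow> h \<in> carrier G \<Longrightarrow>
      [f g h = tensor_cochain t (g, h) + r g h] (mod int n)"
  using assms
proof (induction arbitrary: thesis)
  case (cup \<psi> \<psi>')
  show ?case
  proof (rule cup.prems[OF pure_tensor_closed[OF cup.hyps] Delta_trivial_zero])
    show "[\<psi> g * \<psi>' h = tensor_cochain (pure \<psi> \<psi>') (g, h) + 0] (mod int n)"
      if "g \<in> carrier G" "h \<in> carrier G" for g h
      using cong_sym[OF tensor_cochain_rules(4)[OF that cup.hyps]] by simp
  qed
next
  case (carry \<psi>)
  note \<psi> = carry.hyps
  show ?case
  proof (cases "n = 2")
    case True
    show ?thesis
    proof (rule carry.prems[OF pure_tensor_closed[OF \<psi> \<psi>] Delta_trivial_zero])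
      fix g h assume gh: "g \<in> carrier G" "h \<in> carrier G"
      have "\<psi> g = 0 \<or> \<psi> g = 1" "\<psi> h = 0 \<or> \<psi> h = 1"
        using H1_range[OF \<psi> gh(1)] H1_range[OF \<psi> gh(2)] True by auto
      then have "(\<psi> g + \<psi> h) div int n = \<psi> g * \<psi> h" using True by auto
      then show "[(\<psi> g + \<psi> h) div int n = tensor_cochain (pure \<psi> \<psi>) (g, h) + 0] (mod int n)"
        using cong_sym[OF tensor_cochain_rules(4)[OF gh \<psi> \<psi>]] by simp
    qed
  next
    case False
    interpret Te: comm_group \<T> by (rule comm_group_tensor[OF group_H1 group_H1])
    have pc: "pure \<psi> \<xi> \<in> carrier \<T>" by (rule pure_tensor_closed[OF \<psi> \<xi>])
    show ?thesis
    proof (rule carry.prems[OF Te.inv_closed[OF pc] bockstein_relation_Delta_trivial[OF \<psi> False]])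
      fix g h assume gh: "g \<in> carrier G" "h \<in> carrier G"
      have "[- tensor_cochain (pure \<psi> \<xi>) (g, h) = - (\<psi> g * \<xi> h)] (mod int n)"
        using tensor_cochain_rules(4)[OF gh \<psi> \<xi>] by (simp only: cong_minus_minus_iff)
      from cong_trans[OF tensor_cochain_rules(2)[OF gh pc] this]
      have "[tensor_cochain (inv\<^bsub>\<T>\<^esub> (pure \<psi> \<xi>)) (g, h) + (\<psi> g * \<xi> h + (\<psi> g + \<psi> h) div int n) =
          - (\<psi> g * \<xi> h) + (\<psi> g * \<xi> h + (\<psi> g + \<psi> h) div int n)] (mod int n)"
        by (intro cong_add cong_refl)
      then show "[(\<psi> g + \<psi> h) div int n = tensor_cochain (inv\<^bsub>\<T>\<^esub> (pure \<psi> \<xi>)) (g, h) +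
          (\<psi> g * \<xi> h + (\<psi> g + \<psi> h) div int n)] (mod int n)"
        by (simp add: cong_sym)
    qed
  qed
next
  case zero
  interpret Te: comm_group \<T> by (rule comm_group_tensor[OF group_H1 group_H1])
  show ?case
  proof (rule zero.prems[OF Te.one_closed Delta_trivial_zero])
    show "[0 = tensor_cochain \<one>\<^bsub>\<T>\<^esub> (g, h) + 0] (mod int n)"
      if "g \<in> carrier G" "h \<in> carrier G" for g h
      using cong_sym[OF tensor_cochain_rules(3)[OF that]] by simp
  qed
next
  case (add f f')
  interpret Te: comm_group \<T> by (rule comm_group_tensor[OF group_H1 group_H1])
  obtain s r where s: "s \<in> carrier \<T>" "Delta_trivial r" "\<And>g h. g \<in> carrier G \<Longrightarrow> h \<in> carrier G \<Longrightarrow>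
      [f g h = tensor_cochain s (g, h) + r g h] (mod int n)"
    by (rule add.IH(1)) (rule that; assumption)
  obtain t r' where t: "t \<in> carrier \<T>" "Delta_trivial r'" "\<And>g h. g \<in> carrier G \<Longrightarrow> h \<in> carrier G \<Longrightarrow>
      [f' g h = tensor_cochain t (g, h) + r' g h] (mod int n)"
    by (rule add.IH(2)) (rule that; assumption)
  show ?case
  proof (rule add.prems[OF Te.m_closed[OF s(1) t(1)] Delta_trivial_add[OF s(2) t(2)]])
    fix g h assume gh: "g \<in> carrier G" "h \<in> carrier G"
    have "[f g h + f' g h = (tensor_cochain s (g, h) + r g h) + (tensor_cochain t (g, h) + r' g h)] (mod int n)"
      by (intro cong_add s(3) t(3) gh)
    also have "(tensor_cochain s (g, h) + r g h) + (tensor_cochain t (g, h) + r' g h) =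
        (tensor_cochain s (g, h) + tensor_cochain t (g, h)) + (r g h + r' g h)"
      by simp
    also have "[\<dots> = tensor_cochain (s \<otimes>\<^bsub>\<T>\<^esub> t) (g, h) + (r g h + r' g h)] (mod int n)"
      by (intro cong_add cong_refl cong_sym[OF tensor_cochain_rules(1)[OF gh s(1) t(1)]])
    finally show "[f g h + f' g h = tensor_cochain (s \<otimes>\<^bsub>\<T>\<^esub> t) (g, h) + (r g h + r' g h)] (mod int n)" .
  qed
next
  case (minus f)
  interpret Te: comm_group \<T> by (rule comm_group_tensor[OF group_H1 group_H1])
  obtain s r where s: "s \<in> carrier \<T>" "Delta_trivial r" "\<And>g h. g \<in> carrier G \<Longrightarrow> h \<in> carrier G \<Longrightarrow>
      [f g h = tensor_cochain s (g, h) + r g h] (mod int n)"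
    by (rule minus.IH) (rule that; assumption)
  show ?case
  proof (rule minus.prems[OF Te.inv_closed[OF s(1)] Delta_trivial_minus[OF s(2)]])
    fix g h assume gh: "g \<in> carrier G" "h \<in> carrier G"
    have "[- f g h = - (tensor_cochain s (g, h) + r g h)] (mod int n)"
      using s(3)[OF gh] by (simp only: cong_minus_minus_iff)
    also have "- (tensor_cochain s (g, h) + r g h) = - tensor_cochain s (g, h) + - r g h" by simp
    also have "[\<dots> = tensor_cochain (inv\<^bsub>\<T>\<^esub> s) (g, h) + - r g h] (mod int n)"
      by (intro cong_add cong_refl cong_sym[OF tensor_cochain_rules(2)[OF gh s(1)]])
    finally show "[- f g h = tensor_cochain (inv\<^bsub>\<T>\<^esub> s) (g, h) + - r g h] (mod int n)" .
  qed
qed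

text \<open>Write \<open>f\<close> as the cochain of a tensor \<open>t\<close> plus a \<open>\<Delta>\<close>-trivial function.  If \<open>f\<close> is a coboundary, so
  is the cochain of \<open>t\<close>; that is, \<open>t\<close> lies in the kernel of the cup product.\<close>

lemma cup_carry_span_Delta_trivial:
  assumes f: "f \<in> cup_carry_span" and y: "y \<in> C1" "has_coboundary y f"
  shows "Delta_trivial f"
proof -
  obtain t r where t: "t \<in> carrier \<T>" and r: "Delta_trivial r"
    and f_eq: "\<And>g h. g \<in> carrier G \<Longrightarrow> h \<in> carrier G \<Longrightarrow>
      [f g h = tensor_cochain t (g, h) + r g h] (mod int n)"
    by (rule cup_carry_span_decomposition[OF f]) (rule that; assumption)
  obtain v where v: "v \<in> C1" "has_coboundary v r"
    using Delta_trivialE[OF r] by blast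
  obtain w where w: "w \<in> C1" "has_coboundary w (\<lambda>g h. 1 * f g h + -1 * r g h)"
    using has_coboundary_lincomb[OF y v, of 1 "-1"] by blast
  have "has_coboundary w (\<lambda>g h. tensor_cochain t (g, h))"
    using w(2)
  proof (rule has_coboundary_cong)
    fix g h assume gh: "g \<in> carrier G" "h \<in> carrier G"
    have "[1 * f g h + -1 * r g h = (tensor_cochain t (g, h) + r g h) + -1 * r g h] (mod int n)"
      using f_eq[OF gh] by (intro cong_add cong_refl) simp
    then show "[1 * f g h + -1 * r g h = tensor_cochain t (g, h)] (mod int n)" by simp
  qed
  moreover have "tensor_cochain t \<in> carrier (Z2 n G T)"
    using tensor_cochain_hom t by (rule hom_in_carrier)
  ultimately have "H2_class n G T (tensor_cochain t) = \<one>\<^bsub>H2 n G T\<^esub>"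
    using w(1) H2_class_eq_one_iff by blast
  then have "t \<in> kernel \<T> (H2 n G T) (cup_hom n G T)"
    using t cup_hom_eq[OF t] by (simp add: kernel_def)
  from Delta_trivial_add[OF kernel_cup_Delta_trivial[OF this] r] show ?thesis
    by (rule Delta_trivial_cong) (rule f_eq)
qed

lemma Delta_subset_central_series: "Delta n G T \<subseteq> central_series n G T 3"
proof
  fix x assume x: "x \<in> Delta n G T"
  note xc = Delta_carrier[OF x]
  note c2 = central_series_normal[of 0, unfolded central_series.simps(2),
      OF carrier_normal closedin_carrier]
  note c3 = central_series_normal[OF c2(1,2)]
  have x2: "x \<in> central_series n G T (Suc (Suc 0))"
    by (rule characters_detect_central_series_2[OF xc]) (rule H1_vanishes_on_Delta[OF _ x])
  show "x \<in> central_series n G T 3"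
  proof (rule ccontr)
    assume "x \<notin> central_series n G T 3"
    then have x3: "x \<notin> central_series n G T (Suc (Suc (Suc 0)))" unfolding numeral_3_eq_3 .
    obtain M0 \<phi> where M0: "openin T M0" "central_series n G T (Suc (Suc 0)) \<subseteq> M0" "subgroup M0 G"
      and \<phi>_range: "\<And>m. m \<in> M0 \<Longrightarrow> 0 \<le> \<phi> m \<and> \<phi> m < int n"
      and \<phi>_add: "\<And>a b. a \<in> M0 \<Longrightarrow> b \<in> M0 \<Longrightarrow> \<phi> (a \<otimes> b) = (\<phi> a + \<phi> b) mod int n"
      and \<phi>_conj: "\<And>g m. g \<in> carrier G \<Longrightarrow> m \<in> M0 \<Longrightarrow>
        inv g \<otimes> m \<otimes> g \<in> M0 \<and> \<phi> (inv g \<otimes> m \<otimes> g) = \<phi> m"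
      and \<phi>_lc: "locally_constant T \<phi>" and \<phi>x: "\<phi> x \<noteq> 0"
      by (rule invariant_character_exists[OF normal_imp_subgroup[OF c2(1)] c3(1,2) c3(3) c3(4) x2 x3])
        (assumption | rule that; assumption)+
    have "g \<in> M0" if "g \<in> carrier G" "\<And>\<psi>. \<psi> \<in> X \<Longrightarrow> \<psi> g = 0" for g
    proof (rule subsetD[OF M0(2)])
      show "g \<in> central_series n G T (Suc (Suc 0))"
        by (rule characters_detect_central_series_2[OF that(1)]) (rule that(2))
    qed
    then obtain F where F: "finite F" "F \<subseteq> X"
      "\<And>g. g \<in> carrier G \<Longrightarrow> (\<And>\<psi>. \<psi> \<in> F \<Longrightarrow> \<psi> g = 0) \<Longrightarrow> g \<in> M0"
      using finitely_many_characters_suffice[OF M0(1)] by blast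
    obtain k \<eta> e where D: "dual_system k \<eta> e"
      and D_ker: "\<And>g \<psi>. g \<in> carrier G \<Longrightarrow> (\<And>i. i < k \<Longrightarrow> \<eta> i g = 0) \<Longrightarrow> \<psi> \<in> F \<Longrightarrow> \<psi> g = 0"
      using dual_system_exists[OF F(1,2)] by blast
    define M where "M = {g \<in> carrier G. \<forall>i<k. \<eta> i g = 0}"
    have MM0: "m \<in> M0" if "m \<in> M" for m
      using that F(3)[of m] D_ker[of m] by (auto simp: M_def)
    obtain y f where y: "y \<in> C1" "f \<in> cup_carry_span" "has_coboundary y f"
      "\<And>m. m \<in> M \<Longrightarrow> y m = \<phi> m"
      by (rule extension_of_invariant_character[OF D M_def \<phi>_range[OF MM0] \<phi>_add[OF MM0 MM0]
            conjunct2[OF \<phi>_conj[OF _ MM0]] \<phi>_lc])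
        (assumption | rule that; assumption)+
    have "y x = 0"
      by (rule Delta_trivial_vanishes[OF cup_carry_span_Delta_trivial[OF y(2,1,3)] y(1,3) x])
    moreover have "x \<in> M"
      using D H1_vanishes_on_Delta[OF _ x] xc by (simp add: M_def dual_system_def)
    ultimately show False using y(4)[of x] \<phi>x by simp
  qed
qed

end


section \<open>The theorem\<close>

theorem theorem5p2:
  fixes G :: "('a, 'm) monoid_scheme" and T :: "'a topology" and p d q :: nat
  assumes "prime p" and "d \<ge> 1" and "q = p ^ d"
    and "profinite_group G T"
    and "galois_relation_type p d G T"
  shows "central_series q G T 3 = Delta q G T"
proof -
  interpret profinite_group G T by fact
  have q: "q > 0" using assms(1,3) prime_gt_0_nat by simp
  have rel: "\<exists>S. S \<subseteq> {pure_tensor (H1 q G T) (H1 q G T) \<psi> \<psi>' | \<psi> \<psi>'.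
               \<psi> \<in> carrier (H1 q G T) \<and> \<psi>' \<in> carrier (H1 q G T)} \<and>
          kernel (H1_tensor_H1 q G T) (H2 q G T) (cup_hom q G T) = generate (H1_tensor_H1 q G T) S"
    and bock: "\<exists>\<xi>\<in>carrier (H1 q G T). \<forall>\<psi>\<in>carrier (H1 q G T).
        cup q G T \<psi> \<xi> \<otimes>\<^bsub>H2 q G T\<^esub> bockstein q G T \<psi> = \<one>\<^bsub>H2 q G T\<^esub>"
    and lift: "\<And>i. 1 \<le> i \<Longrightarrow> i \<le> d \<Longrightarrow>
        (\<lambda>\<psi>. \<lambda>g\<in>carrier G. \<psi> g mod int (p ^ i)) ` carrier (H1 q G T) = carrier (H1 (p ^ i) G T)"
    using assms(5) unfolding galois_relation_type_def assms(3)[symmetric] Let_def by blast+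
  interpret lifting_setting G T q p d
  proof
    show "\<exists>\<psi>\<in>carrier (H1 q G T). \<forall>g\<in>carrier G. \<theta> g = \<psi> g mod int (p ^ i)"
      if i: "1 \<le> i" "i \<le> d" and \<theta>: "\<theta> \<in> carrier (H1 (p ^ i) G T)" for i \<theta>
    proof -
      obtain \<psi> where "\<psi> \<in> carrier (H1 q G T)" "\<theta> = (\<lambda>g\<in>carrier G. \<psi> g mod int (p ^ i))"
        using \<theta> unfolding lift[OF i, symmetric] by blast
      then show ?thesis by auto
    qed
  qed (rule q assms(1-3))+
  obtain S where S: "S \<subseteq> {pure_tensor (H1 q G T) (H1 q G T) \<psi> \<psi>' | \<psi> \<psi>'. \<psi> \<in> X \<and> \<psi>' \<in> X}"
    "kernel (H1_tensor_H1 q G T) (H2 q G T) (cup_hom q G T) = generate (H1_tensor_H1 q G T) S"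
    using rel by (elim exE conjE)
  obtain \<xi> where \<xi>: "\<xi> \<in> X"
    "\<forall>\<psi>\<in>X. cup q G T \<psi> \<xi> \<otimes>\<^bsub>H2 q G T\<^esub> bockstein q G T \<psi> = \<one>\<^bsub>H2 q G T\<^esub>"
    using bock by (elim bexE)
  interpret galois_relation_setting G T q p d S \<xi>
    by unfold_locales (rule S \<xi>(1) bspec[OF \<xi>(2)], assumption?)+
  show ?thesis
    using central_series_subset_Delta Delta_subset_central_series by (rule equalityI)
qed

end
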